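(* Let $\alpha>0$ and $\beta>0$. Suppose there exist independent identically distributed random variables $\xi_z$, $z\in\mathbb{Z}^d$, such that for all $z$ $$0\le \xi_z\le 1,\qquad |S_z|\ge \xi_z,\qquad \mathbf{P}\{\xi_z=0\}\le p,\qquad \mu=\mathbf{E}\xi_z>0,$$ where $p\in(0,1)$. Then $$\forall\varepsilon>0\qquad \lim_{t\to\infty}\mathbf{P}\{\lambda(t,\alpha,\beta)>\mathcal{C}_{\alpha,\beta}-\varepsilon\}=1,$$ where $$\mathcal{C}_{\alpha,\beta}=\inf\{\mathcal{K}_\alpha(\phi)+\beta\,\mathcal{G}(\phi;d):\ \phi\in\mathbf{H}^1(\mathbb{R}^d),\ \|\phi\|_2=1\}.$$
   Context: $d\ge 2$. $|A|$ is Lebesgue measure of $A\subset\mathbb{R}^d$. $V=V(x,\omega)$ is a measurable $\{0,1\}$-valued random field on $\mathbb{R}^d$ on a probability space $\langle\Omega,\mathcal{F},\mathbf{P}\rangle$, such that $S=S(\omega)=\{x\in\mathbb{R}^d: V(x,\omega)=1\}$ is closed. For $z\in\mathbb{Z}^d$, $S_z=S\cap\{x: x-z\in(-\frac12,\frac12]^d\}$. For $t>1$, $\widehat{Q}^0_t=(-\frac12 t,\frac12 t)^d$. $\mathbf{H}^1_0(G)$ and $\mathbf{H}^1(\mathbb{R}^d)$ are the usual Sobolev spaces of $\mathbb{R}^d$-valued functions; functions in $\mathbf{H}^1_0(G)$ are extended by zero to $\mathbb{R}^d$; $|\nabla\phi|^2=\sum_{j,k}(\nabla_j\phi^{(k)})^2$.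 Put $$\mathcal{K}_\alpha(\phi)=\int_{\mathbb{R}^d}\left(|\nabla\phi|^2+\alpha^{-1}(\mathrm{div}(\phi))^2\right)dx,$$ $$\mathfrak{C}_{\alpha,\beta,t}=\inf_{\phi\in\mathbf{H}^1_0(\widehat{Q}^0_t),\,\phi\ne0}\|\phi\|_2^{-2}\left(\mathcal{K}_\alpha(\phi)+(\ln t)^{-2/d}\beta\|V^{1/2}\phi\|_2^2\right),\qquad \lambda(t,\alpha,\beta)=(\ln t)^{2/d}\,\mathfrak{C}_{\alpha,\beta,t}.$$ With $G(u)=-\ln\mathbf{E}\exp\{-u\xi_0\}$ define $$\Gamma(h;\phi)=\int_{\mathbb{R}^d}G(h|\phi(x)|^2)\,dx,\ h>0,\qquad \mathcal{G}(\phi;D)=\sup_{h>0}\{h^{-1}(\Gamma(h;\phi)-D)\},\ D\in\mathbb{R}.$$ *)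

theory Defs
  imports "HOL-Probability.Probability"
begin

text \<open>
  The dimension $d$ is \<open>CARD('n)\<close>.  Elements of Lebesgue and Sobolev spaces are represented by
  Borel functions on all of $\mathbf{R}^d$, with no quotient taken: every a.e.-class has a Borel
  representative, and all functionals below depend only on the class.
\<close>

primrec C_k :: "nat \<Rightarrow> ('a::real_normed_vector \<Rightarrow> 'b::real_normed_vector) \<Rightarrow> bool" where
  "C_k 0 f \<longleftrightarrow> continuous_on UNIV f"
| "C_k (Suc k) f \<longleftrightarrow>
     (\<forall>x. f differentiable (at x)) \<and> (\<forall>v. C_k k (\<lambda>x. frechet_derivative f (at x) v))"

definition test_functions :: "(real^'n) set \<Rightarrow> (real^'n \<Rightarrow> 'b::real_normed_vector) set" where
  "test_functions U = {\<psi>. (\<forall>k. C_k k \<psi>) \<and>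
     compact (closure {x. \<psi> x \<noteq> 0}) \<and> closure {x. \<psi> x \<noteq> 0} \<subseteq> U}"

definition L2 :: "(real^'n \<Rightarrow> real^'n) set" where
  "L2 = {f. f \<in> borel_measurable lborel \<and> integrable lborel (\<lambda>x. (norm (f x))\<^sup>2)}"

definition L2_norm :: "(real^'n \<Rightarrow> real^'n) \<Rightarrow> real" where
  "L2_norm f = sqrt (\<integral>x. (norm (f x))\<^sup>2 \<partial>lborel)"

definition is_weak_deriv :: "'n::finite \<Rightarrow> (real^'n \<Rightarrow> real^'n) \<Rightarrow> (real^'n \<Rightarrow> real^'n) \<Rightarrow> bool" where
  "is_weak_deriv j \<phi> v \<longleftrightarrow>
     (\<forall>\<psi> \<in> (test_functions UNIV :: (real^'n \<Rightarrow> real) set).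
        (\<integral>x. frechet_derivative \<psi> (at x) (axis j 1) *\<^sub>R \<phi> x \<partial>lborel) = - (\<integral>x. \<psi> x *\<^sub>R v x \<partial>lborel))"

definition H1 :: "(real^'n \<Rightarrow> real^'n) set" where
  "H1 = {\<phi> \<in> L2. \<forall>j. \<exists>v \<in> L2. is_weak_deriv j \<phi> v}"

text \<open>Weak derivatives are unique up to null sets, so for \<open>\<phi> \<in> H1\<close> the choice is immaterial.\<close>

definition weak_deriv :: "'n::finite \<Rightarrow> (real^'n \<Rightarrow> real^'n) \<Rightarrow> real^'n \<Rightarrow> real^'n" where
  "weak_deriv j \<phi> = (SOME v. v \<in> L2 \<and> is_weak_deriv j \<phi> v)"

definition grad_sq :: "(real^'n \<Rightarrow> real^'n) \<Rightarrow> real^'n \<Rightarrow> real" where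
  "grad_sq \<phi> x = (\<Sum>j\<in>UNIV. \<Sum>k\<in>UNIV. (weak_deriv j \<phi> x $ k)\<^sup>2)"

definition divergence :: "(real^'n \<Rightarrow> real^'n) \<Rightarrow> real^'n \<Rightarrow> real" where
  "divergence \<phi> x = (\<Sum>j\<in>UNIV. weak_deriv j \<phi> x $ j)"

definition H1_norm :: "(real^'n \<Rightarrow> real^'n) \<Rightarrow> real" where
  "H1_norm \<phi> = sqrt ((L2_norm \<phi>)\<^sup>2 + (\<integral>x. grad_sq \<phi> x \<partial>lborel))"

text \<open>
  The closure in $\mathbf{H}^1$ of the test functions on \<open>U\<close>.  The approximants are functions on
  $\mathbf{R}^d$ vanishing outside \<open>U\<close>, so extension by zero is built in.
\<close>

definition H1_0 :: "(real^'n) set \<Rightarrow> (real^'n \<Rightarrow> real^'n) set" where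
  "H1_0 U = {\<phi> \<in> H1. \<exists>\<psi>. (\<forall>m::nat. \<psi> m \<in> test_functions U) \<and>
     (\<lambda>m. H1_norm (\<lambda>x. \<psi> m x - \<phi> x)) \<longlonglongrightarrow> 0}"

definition Q_hat :: "real \<Rightarrow> (real^'n) set" where
  "Q_hat t = {x. \<forall>i. - t / 2 < x $ i \<and> x $ i < t / 2}"

definition unit_cell :: "int^'n \<Rightarrow> (real^'n) set" where
  "unit_cell z = {x. \<forall>i. - 1 / 2 < x $ i - of_int (z $ i) \<and> x $ i - of_int (z $ i) \<le> 1 / 2}"

definition K_energy :: "real \<Rightarrow> (real^'n \<Rightarrow> real^'n) \<Rightarrow> real" where
  "K_energy \<alpha> \<phi> = (\<integral>x. grad_sq \<phi> x + inverse \<alpha> * (divergence \<phi> x)\<^sup>2 \<partial>lborel)"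

text \<open>
  Infima and suprema are taken in the extended reals, so that they have their usual meaning
  without a prior boundedness argument.  The argument \<open>W\<close> is the potential $V(\cdot,\omega)$ for
  a fixed $\omega$.
\<close>

definition C_frak :: "(real^'n \<Rightarrow> real) \<Rightarrow> real \<Rightarrow> real \<Rightarrow> real \<Rightarrow> ereal" where
  "C_frak W \<alpha> \<beta> t =
     (INF \<phi> \<in> {\<phi> \<in> H1_0 (Q_hat t). \<not> (AE x in lborel. \<phi> x = 0)}.
        ereal (inverse ((L2_norm \<phi>)\<^sup>2) *
          (K_energy \<alpha> \<phi> +
           ln t powr (- 2 / real CARD('n)) * \<beta> * (L2_norm (\<lambda>x. sqrt (W x) *\<^sub>R \<phi> x))\<^sup>2)))"

definition lambda_eig :: "(real^'n \<Rightarrow> real) \<Rightarrow> real \<Rightarrow> real \<Rightarrow> real \<Rightarrow> ereal" where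
  "lambda_eig W t \<alpha> \<beta> = ereal (ln t powr (2 / real CARD('n))) * C_frak W \<alpha> \<beta> t"

definition G_fun :: "'w measure \<Rightarrow> ('w \<Rightarrow> real) \<Rightarrow> real \<Rightarrow> real" where
  "G_fun M X u = - ln (\<integral>\<omega>. exp (- u * X \<omega>) \<partial>M)"

definition Gamma_fun :: "(real \<Rightarrow> real) \<Rightarrow> real \<Rightarrow> (real^'n \<Rightarrow> real^'n) \<Rightarrow> real" where
  "Gamma_fun G h \<phi> = (\<integral>x. G (h * (norm (\<phi> x))\<^sup>2) \<partial>lborel)"

definition G_cal :: "(real \<Rightarrow> real) \<Rightarrow> (real^'n \<Rightarrow> real^'n) \<Rightarrow> real \<Rightarrow> ereal" where
  "G_cal G \<phi> D = (SUP h \<in> {0<..}. ereal (inverse h * (Gamma_fun G h \<phi> - D)))"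

text \<open>
  The dimension enters \<open>C_cal\<close> only through the type of the functions over which the infimum runs,
  hence the \<open>itself\<close> argument.
\<close>

definition C_cal :: "'n::finite itself \<Rightarrow> (real \<Rightarrow> real) \<Rightarrow> real \<Rightarrow> real \<Rightarrow> ereal" where
  "C_cal _ G \<alpha> \<beta> =
     (INF \<phi> \<in> {\<phi> \<in> (H1 :: (real^'n \<Rightarrow> real^'n) set). L2_norm \<phi> = 1}.
        ereal (K_energy \<alpha> \<phi>) + ereal \<beta> * G_cal G \<phi> (real CARD('n)))"

end

theory Submission
  imports Defs "HOL-Computational_Algebra.Polynomial" "HOL-Real_Asymp.Real_Asymp"
begin

text \<open>
  Put \<open>L = (ln t) powr (1 / d)\<close>.  If the eigenvalue lies below \<open>C - \<epsilon>\<close>, a test field on the cube of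
  side \<open>t\<close> has a small Rayleigh quotient.  Averaging over all translates of one fixed cutoff of
  width \<open>L R\<close> (the cross terms average to zero) yields a field with nearly the same quotient that is
  supported in a cube of side of order \<open>L\<close> with integer centre; there are of order \<open>t^d\<close> such
  centres.  After rescaling by \<open>L\<close>, these fields form a totally bounded family in \<open>L2\<close>, so finitely
  many representatives \<open>\<psi>\<close> suffice.  For each of them the exponential Chebyshev inequality with
  parameter \<open>h L^d\<close>, together with independence and \<open>L^d = ln t\<close>, bounds the probability of a small
  potential energy \<open>a\<close> by \<open>t powr (h a - \<Gamma>(h; \<psi>) + o(1))\<close>.  The definition of \<open>C\<close> provides an \<open>h\<close> for
  which this exponent is below \<open>- d\<close>, and the union bound over the centres finishes the proof.
\<close>

section \<open>Compactly supported functions of class C1\<close>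

definition C0c :: "(real^'n \<Rightarrow> 'b::real_normed_vector) \<Rightarrow> bool" where
  "C0c f \<longleftrightarrow> continuous_on UNIV f \<and> bounded {x. f x \<noteq> 0}"

definition C1c :: "(real^'n \<Rightarrow> 'b::real_normed_vector) \<Rightarrow> bool" where
  "C1c f \<longleftrightarrow> (\<forall>x. f differentiable (at x)) \<and>
     (\<forall>v. continuous_on UNIV (\<lambda>x. frechet_derivative f (at x) v)) \<and> bounded {x. f x \<noteq> 0}"

definition pd :: "'n \<Rightarrow> (real^'n \<Rightarrow> 'b) \<Rightarrow> real^'n \<Rightarrow> 'b::real_normed_vector" where
  "pd j f x = frechet_derivative f (at x) (axis j 1)"

lemma C1cI:
  assumes "\<And>x. (f has_derivative D x) (at x)" "\<And>v. continuous_on UNIV (\<lambda>x. D x v)"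
    and "bounded {x. f x \<noteq> 0}"
  shows "C1c f"
proof -
  have "frechet_derivative f (at x) = D x" for x
    using frechet_derivative_at[OF assms(1)] by simp
  then show ?thesis unfolding C1c_def using assms by (auto simp: differentiable_def)
qed

lemma C1c_has_derivative:
  "C1c f \<Longrightarrow> (f has_derivative frechet_derivative f (at x)) (at x)"
  by (simp add: C1c_def frechet_derivative_works)

lemma pd_eq: "(f has_derivative D) (at x) \<Longrightarrow> pd j f x = D (axis j 1)"
  unfolding pd_def using frechet_derivative_at by metis

lemma C1c_C0c: "C1c f \<Longrightarrow> C0c f"
  unfolding C1c_def C0c_def
  by (auto intro!: continuous_at_imp_continuous_on differentiable_imp_continuous_within)

lemma frechet_derivative_outside_support:
  assumes "x \<notin> closure {x. f x \<noteq> 0}"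
  shows "frechet_derivative f (at x) = (\<lambda>_. 0)"
proof -
  have "\<forall>\<^sub>F y in at x. y \<in> - closure {x. f x \<noteq> 0}"
    using assms by (intro eventually_at_in_open') auto
  then have ev: "\<forall>\<^sub>F y in at x. (\<lambda>_. 0) y = f y"
    by eventually_elim (use closure_subset[of "{x. f x \<noteq> 0}"] in auto)
  have "f x = 0" using assms closure_subset[of "{x. f x \<noteq> 0}"] by auto
  then have "(f has_derivative (\<lambda>_. 0)) (at x)"
    using has_derivative_transform_eventually[OF has_derivative_const[of 0] ev] by simp
  then show ?thesis using frechet_derivative_at by metis
qed

lemma C1c_C0c_derivative:
  assumes "C1c f" shows "C0c (\<lambda>x. frechet_derivative f (at x) v)"
proof -
  have "{x. frechet_derivative f (at x) v \<noteq> 0} \<subseteq> closure {x. f x \<noteq> 0}"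
    using frechet_derivative_outside_support by fastforce
  then show ?thesis using assms bounded_subset unfolding C1c_def C0c_def
    by (metis bounded_closure)
qed

lemma C0c_pd: "C1c f \<Longrightarrow> C0c (pd j f)"
  using C1c_C0c_derivative[of f "axis j 1"] unfolding pd_def[abs_def] .

lemma C0c_measurable: "C0c f \<Longrightarrow> f \<in> borel_measurable borel"
  unfolding C0c_def by (simp add: borel_measurable_continuous_onI)

lemma C0c_bounded:
  assumes "C0c f" shows "\<exists>B>0. \<forall>x. norm (f x) \<le> B"
proof -
  let ?K = "closure {x. f x \<noteq> 0}"
  have "compact (f ` ?K)"
    using assms unfolding C0c_def
    by (intro compact_continuous_image) (auto intro: continuous_on_subset)
  then obtain B where B: "B > 0" "\<And>y. y \<in> f ` ?K \<Longrightarrow> norm y \<le> B"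
    using compact_imp_bounded bounded_pos by metis
  have "norm (f x) \<le> B" for x
  proof (cases "f x = 0")
    case False
    then have "x \<in> ?K" using closure_subset[of "{x. f x \<noteq> 0}"] by auto
    then show ?thesis using B by blast
  qed (use B in simp)
  then show ?thesis using B(1) by blast
qed

lemma C0c_integrable:
  fixes f :: "real^'n \<Rightarrow> 'b::{banach, second_countable_topology}"
  assumes "C0c f" shows "integrable lborel f"
proof -
  let ?K = "closure {x. f x \<noteq> 0}"
  have "integrable lborel (\<lambda>x. indicator ?K x *\<^sub>R f x)"
    using assms unfolding C0c_def
    by (intro borel_integrable_compact) (auto intro: continuous_on_subset)
  also have "(\<lambda>x. indicator ?K x *\<^sub>R f x) = f"
    using closure_subset[of "{x. f x \<noteq> 0}"] by (auto simp: indicator_def fun_eq_iff)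
  finally show ?thesis .
qed

lemma C0c_comp:
  assumes "C0c f" "continuous_on UNIV g" "g 0 = 0" shows "C0c (\<lambda>x. g (f x))"
proof -
  have "{x. g (f x) \<noteq> 0} \<subseteq> {x. f x \<noteq> 0}" using assms(3) by auto
  moreover have "continuous_on UNIV (\<lambda>x. g (f x))"
    using continuous_on_compose2[OF assms(2), of UNIV f] assms(1) by (auto simp: C0c_def)
  ultimately show ?thesis using assms(1) bounded_subset unfolding C0c_def by metis
qed

lemma C0c_add: "C0c f \<Longrightarrow> C0c g \<Longrightarrow> C0c (\<lambda>x. f x + g x)"
  unfolding C0c_def
  by (auto intro!: continuous_intros intro: bounded_subset[of "{x. f x \<noteq> 0} \<union> {x. g x \<noteq> 0}"])

lemma C0c_diff: "C0c f \<Longrightarrow> C0c g \<Longrightarrow> C0c (\<lambda>x. f x - g x)"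
  unfolding C0c_def
  by (auto intro!: continuous_intros intro: bounded_subset[of "{x. f x \<noteq> 0} \<union> {x. g x \<noteq> 0}"])

lemma C0c_zero: "C0c (\<lambda>_. 0)" by (simp add: C0c_def)

lemma C0c_sum: "(\<And>i. i \<in> I \<Longrightarrow> C0c (f i)) \<Longrightarrow> C0c (\<lambda>x. \<Sum>i\<in>I. f i x)"
  by (induction I rule: infinite_finite_induct) (auto simp: C0c_zero C0c_add)

lemma C0c_scaleR: "continuous_on UNIV a \<Longrightarrow> C0c f \<Longrightarrow> C0c (\<lambda>x. a x *\<^sub>R f x)"
  unfolding C0c_def by (auto intro!: continuous_intros elim: bounded_subset)

lemma C0c_scaleR': "C0c a \<Longrightarrow> C0c f \<Longrightarrow> C0c (\<lambda>x. a x *\<^sub>R f x)"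
  by (rule C0c_scaleR) (auto simp: C0c_def)

lemma C0c_mult:
  fixes f :: "real^'n \<Rightarrow> real"
  shows "C0c f \<Longrightarrow> C0c g \<Longrightarrow> C0c (\<lambda>x. f x * g x)"
  using C0c_scaleR[of f g] by (simp add: C0c_def)

lemma C0c_nth: "C0c f \<Longrightarrow> C0c (\<lambda>x. f x $ k)"
  using C0c_comp[of f "\<lambda>y. y $ k"] by (simp add: continuous_intros)

lemma C0c_norm_sq: "C0c f \<Longrightarrow> C0c (\<lambda>x. (norm (f x))\<^sup>2)"
  using C0c_comp[of f "\<lambda>y. (norm y)\<^sup>2"] by (simp add: continuous_intros)

lemma C0c_sq: "C0c f \<Longrightarrow> C0c (\<lambda>x. (f x :: real)\<^sup>2)"
  using C0c_comp[of f "\<lambda>y. y\<^sup>2"] by (simp add: continuous_intros)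

lemma bounded_affine_vimage:
  fixes S :: "(real^'n) set"
  assumes "bounded S" "c \<noteq> 0" shows "bounded {x. a + c *\<^sub>R x \<in> S}"
proof -
  have "{x. a + c *\<^sub>R x \<in> S} = (\<lambda>y. inverse c *\<^sub>R y) ` ((+) (- a) ` S)"
    using assms(2) by (force simp: image_image)
  then show ?thesis
    using bounded_scaling[OF bounded_translation[OF assms(1), of "- a"], of "inverse c"] by simp
qed

lemma continuous_on_affine_arg:
  fixes f :: "real^'n \<Rightarrow> 'b::topological_space"
  assumes "continuous_on UNIV f" shows "continuous_on UNIV (\<lambda>x. f (a + c *\<^sub>R x))"
  by (rule continuous_on_compose2[OF assms, of UNIV "\<lambda>x. a + c *\<^sub>R x"])
     (auto intro!: continuous_intros)

lemma C0c_affine: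
  assumes "C0c f" "c \<noteq> 0" shows "C0c (\<lambda>x. f (a + c *\<^sub>R x))"
  using assms bounded_affine_vimage[of "{x. f x \<noteq> 0}" c a] unfolding C0c_def
  by (auto intro: continuous_on_affine_arg)

lemma nn_integral_affine:
  fixes f :: "real^'n \<Rightarrow> ennreal"
  assumes "f \<in> borel_measurable borel" "c \<noteq> 0"
  shows "(\<integral>\<^sup>+x. f x \<partial>lborel) = ennreal (\<bar>c\<bar>^CARD('n)) * (\<integral>\<^sup>+x. f (a + c *\<^sub>R x) \<partial>lborel)"
  using assms
  by (subst lborel_affine[OF assms(2), of a])
     (simp add: nn_integral_density nn_integral_distr nn_integral_cmult)

lemma has_bochner_integral_affine:
  fixes f :: "real^'n \<Rightarrow> 'b::{banach, second_countable_topology}"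
  assumes f: "integrable lborel f" and c: "c \<noteq> 0"
  shows "has_bochner_integral lborel (\<lambda>x. f (a + c *\<^sub>R x))
    (inverse (\<bar>c\<bar>^CARD('n)) *\<^sub>R (LBINT x. f x))"
proof -
  have fb[measurable]: "f \<in> borel_measurable borel" using f by auto
  have eq: "(lborel :: (real^'n) measure) =
      density (distr lborel borel (\<lambda>x. a + c *\<^sub>R x)) (\<lambda>_. ennreal (\<bar>c\<bar>^CARD('n)))"
    using lborel_affine[OF c, of a] by simp
  have "integrable (density (distr lborel borel (\<lambda>x. a + c *\<^sub>R x)) (\<lambda>_. ennreal (\<bar>c\<bar>^CARD('n)))) f"
    using f eq by simp
  then have "integrable (distr lborel borel (\<lambda>x. a + c *\<^sub>R x)) (\<lambda>x. \<bar>c\<bar>^CARD('n) *\<^sub>R f x)"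
    by (subst (asm) integrable_density) (auto simp: c)
  then have i: "integrable lborel (\<lambda>x. \<bar>c\<bar>^CARD('n) *\<^sub>R f (a + c *\<^sub>R x))"
    by (subst (asm) integrable_distr_eq) auto
  have i2: "integrable lborel (\<lambda>x. f (a + c *\<^sub>R x))"
    using integrable_scaleR_right[OF i, of "inverse (\<bar>c\<bar>^CARD('n))"] c by simp
  have "(LBINT x. f x) = (\<integral>x. f x \<partial>(density (distr lborel borel (\<lambda>x. a + c *\<^sub>R x)) (\<lambda>_. ennreal (\<bar>c\<bar>^CARD('n)))))"
    using eq by simp
  also have "\<dots> = (\<integral>x. \<bar>c\<bar>^CARD('n) *\<^sub>R f x \<partial>(distr lborel borel (\<lambda>x. a + c *\<^sub>R x)))"
    by (rule integral_density) auto
  also have "\<dots> = \<bar>c\<bar>^CARD('n) *\<^sub>R (LBINT x. f (a + c *\<^sub>R x))"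
    by (subst integral_distr) auto
  finally show ?thesis using i2 c by (simp add: has_bochner_integral_iff)
qed

lemmas integrable_affine = has_bochner_integral_affine[THEN integrable.intros]
lemmas integral_affine = has_bochner_integral_affine[THEN has_bochner_integral_integral_eq]

lemma derivative_along_line:
  assumes "C1c f"
  shows "((\<lambda>t. f (x + t *\<^sub>R u)) has_vector_derivative frechet_derivative f (at (x + t *\<^sub>R u)) u) (at t within S)"
proof -
  have "(f has_derivative frechet_derivative f (at (x + t *\<^sub>R u))) (at (x + t *\<^sub>R u))"
    by (rule C1c_has_derivative[OF assms])
  then have "((\<lambda>t. f (x + t *\<^sub>R u)) has_derivative (\<lambda>h. frechet_derivative f (at (x + t *\<^sub>R u)) (h *\<^sub>R u))) (at t within S)"
    by (rule has_derivative_compose[rotated]) (auto intro!: derivative_eq_intros)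
  moreover have "linear (frechet_derivative f (at (x + t *\<^sub>R u)))"
    using assms C1c_def linear_frechet_derivative by blast
  ultimately show ?thesis unfolding has_vector_derivative_def
    by (simp add: linear_cmul)
qed

lemma C1c_increment_bound:
  assumes "C1c f" "\<And>y. norm (frechet_derivative f (at y) u) \<le> B"
  shows "norm (f (x + s *\<^sub>R u) - f x) \<le> B * \<bar>s\<bar>"
proof -
  have "norm (f (x + s *\<^sub>R u) - f (x + 0 *\<^sub>R u)) \<le> B * norm (s - 0)"
  proof (rule differentiable_bound[of UNIV "\<lambda>t. f (x + t *\<^sub>R u)"
        "\<lambda>t h. h *\<^sub>R frechet_derivative f (at (x + t *\<^sub>R u)) u"])
    show "((\<lambda>t. f (x + t *\<^sub>R u)) has_derivative (\<lambda>h. h *\<^sub>R frechet_derivative f (at (x + t *\<^sub>R u)) u)) (at t within UNIV)" for t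
      using derivative_along_line[OF assms(1)] unfolding has_vector_derivative_def .
    show "onorm (\<lambda>h. h *\<^sub>R frechet_derivative f (at (x + t *\<^sub>R u)) u) \<le> B" for t
      using mult_right_mono[OF assms(2) abs_ge_zero]
      by (intro onorm_le) (simp add: mult.commute)
  qed auto
  then show ?thesis by simp
qed

lemma integral_pd_zero:
  fixes f :: "real^'n \<Rightarrow> 'b::{banach, second_countable_topology}"
  assumes f: "C1c f"
  shows "(LBINT x. pd j f x) = 0"
proof -
  let ?e = "axis j 1 :: real^'n"
  have fb[measurable]: "f \<in> borel_measurable borel" using f C1c_C0c C0c_measurable by blast
  have pb[measurable]: "pd j f \<in> borel_measurable borel" using f C0c_pd C0c_measurable by blast
  obtain B where B: "B > 0" "\<And>x. norm (pd j f x) \<le> B" using C0c_bounded[OF C0c_pd[OF f]] by blast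
  obtain R where R: "\<And>x. f x \<noteq> 0 \<Longrightarrow> norm x \<le> R"
    using f unfolding C1c_def bounded_iff by blast
  define s where "s m x = (real (Suc m)) *\<^sub>R (f (x + (1 / real (Suc m)) *\<^sub>R ?e) - f x)" for m x
  have zero: "(LBINT x. s m x) = 0" for m
  proof -
    have i: "integrable lborel f" using C0c_integrable C1c_C0c f by blast
    show ?thesis
      using integral_affine[OF i, of 1 "(1 / real (Suc m)) *\<^sub>R ?e"]
        integrable_affine[OF i, of 1 "(1 / real (Suc m)) *\<^sub>R ?e"] i
      unfolding s_def by (simp add: add.commute)
  qed
  have "(\<lambda>m. LBINT x. s m x) \<longlonglongrightarrow> (LBINT x. pd j f x)"
  proof (rule integral_dominated_convergence[where w="\<lambda>x. B * indicator (cball 0 (R + 1)) x"])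
    show "integrable lborel (\<lambda>x. B * indicator (cball (0::real^'n) (R + 1)) x)"
      using borel_integrable_compact[of "cball (0::real^'n) (R+1)" "\<lambda>_. B"] by (simp add: mult.commute)
    show "AE x in lborel. (\<lambda>m. s m x) \<longlonglongrightarrow> pd j f x"
    proof (rule AE_I2)
      fix x
      have "((\<lambda>t. f (x + t *\<^sub>R ?e)) has_vector_derivative pd j f x) (at 0)"
        using derivative_along_line[OF f, of x ?e 0 UNIV] by (simp add: pd_def)
      then have l: "((\<lambda>h. norm (f (x + h *\<^sub>R ?e) - f x - h *\<^sub>R pd j f x) / norm h) \<longlongrightarrow> 0) (at 0)"
          unfolding has_vector_derivative_def has_derivative_at by simp
      have "((\<lambda>h. norm ((1/h) *\<^sub>R (f (x + h *\<^sub>R ?e) - f x) - pd j f x)) \<longlongrightarrow> 0) (at 0)"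
      proof (rule Lim_transform_eventually[OF l], unfold eventually_at_topological, intro exI[of _ UNIV] conjI ballI impI)
        fix h :: real assume "h \<noteq> 0"
        then have "(1/h) *\<^sub>R (f (x + h *\<^sub>R ?e) - f x) - pd j f x
            = (1/h) *\<^sub>R (f (x + h *\<^sub>R ?e) - f x - h *\<^sub>R pd j f x)"
          by (simp add: scaleR_diff_right)
        then show "norm (f (x + h *\<^sub>R ?e) - f x - h *\<^sub>R pd j f x) / norm h
            = norm ((1/h) *\<^sub>R (f (x + h *\<^sub>R ?e) - f x) - pd j f x)" by simp
      qed auto
      then have "((\<lambda>h. (1/h) *\<^sub>R (f (x + h *\<^sub>R ?e) - f x)) \<longlongrightarrow> pd j f x) (at 0)"
        by (rule LIM_zero_cancel[OF tendsto_norm_zero_cancel])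
      moreover have "filterlim (\<lambda>m. 1 / real (Suc m)) (at 0) sequentially"
        using LIMSEQ_Suc[OF lim_1_over_n[where 'a=real]] by (intro filterlim_atI) auto
      ultimately have "(\<lambda>m. (1/(1 / real (Suc m))) *\<^sub>R (f (x + (1 / real (Suc m)) *\<^sub>R ?e) - f x)) \<longlonglongrightarrow> pd j f x"
        by (rule filterlim_compose)
      then show "(\<lambda>m. s m x) \<longlonglongrightarrow> pd j f x" unfolding s_def by simp
    qed
    fix m
    show "AE x in lborel. norm (s m x) \<le> B * indicator (cball 0 (R + 1)) x"
    proof (rule AE_I2)
      fix x
      have a: "norm (s m x) \<le> B"
      proof -
        have "norm (f (x + (1 / real (Suc m)) *\<^sub>R ?e) - f x) \<le> B * \<bar>1 / real (Suc m)\<bar>"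
          by (rule C1c_increment_bound[OF f]) (use B in \<open>simp add: pd_def\<close>)
        then have "real (Suc m) * norm (f (x + (1 / real (Suc m)) *\<^sub>R ?e) - f x) \<le> real (Suc m) * (B * \<bar>1 / real (Suc m)\<bar>)"
          by (rule mult_left_mono) simp
        then show ?thesis unfolding s_def by simp
      qed
      show "norm (s m x) \<le> B * indicator (cball 0 (R + 1)) x"
      proof (cases "x \<in> cball 0 (R + 1)")
        case False
        then have n: "norm x > R + 1" by simp
        then have "f x = 0" using R[of x] by fastforce
        moreover have "f (x + (1 / real (Suc m)) *\<^sub>R ?e) = 0"
        proof (rule ccontr)
          assume "f (x + (1 / real (Suc m)) *\<^sub>R ?e) \<noteq> 0"
          then have "norm (x + (1 / real (Suc m)) *\<^sub>R ?e) \<le> R" by (rule R)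
          moreover have "norm x \<le> norm (x + (1 / real (Suc m)) *\<^sub>R ?e) + norm ((1 / real (Suc m)) *\<^sub>R ?e)"
            by (metis add_diff_cancel_right' norm_triangle_ineq4)
          moreover have "norm ((1 / real (Suc m)) *\<^sub>R ?e) \<le> 1" by (simp add: divide_simps)
          ultimately show False using n by linarith
        qed
        ultimately have "s m x = 0" unfolding s_def by simp
        then show ?thesis using False by simp
      qed (use a in simp)
    qed
  qed (auto simp: s_def[abs_def])
  then show ?thesis unfolding zero using LIMSEQ_unique tendsto_const by metis
qed

lemma C1c_scaleR:
  assumes "C1c a" "C1c f"
  shows "C1c (\<lambda>x. a x *\<^sub>R f x)" "pd j (\<lambda>x. a x *\<^sub>R f x) x = pd j a x *\<^sub>R f x + a x *\<^sub>R pd j f x"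
proof -
  let ?D = "\<lambda>x v. a x *\<^sub>R frechet_derivative f (at x) v + frechet_derivative a (at x) v *\<^sub>R f x"
  have d: "((\<lambda>x. a x *\<^sub>R f x) has_derivative ?D x) (at x)" for x
    by (rule has_derivative_scaleR[OF C1c_has_derivative C1c_has_derivative]) fact+
  have c: "continuous_on UNIV a" "continuous_on UNIV f"
    using C1c_C0c assms unfolding C0c_def by blast+
  show "C1c (\<lambda>x. a x *\<^sub>R f x)"
    by (rule C1cI[OF d])
       (use c assms in \<open>auto simp: C1c_def intro!: continuous_intros elim: bounded_subset\<close>)
  show "pd j (\<lambda>x. a x *\<^sub>R f x) x = pd j a x *\<^sub>R f x + a x *\<^sub>R pd j f x"
    using pd_eq[OF d] by (simp add: pd_def)
qed

lemma C1c_diff: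
  assumes "C1c f" "C1c g"
  shows "C1c (\<lambda>x. f x - g x)" "pd j (\<lambda>x. f x - g x) x = pd j f x - pd j g x"
proof -
  let ?D = "\<lambda>x v. frechet_derivative f (at x) v - frechet_derivative g (at x) v"
  have d: "((\<lambda>x. f x - g x) has_derivative ?D x) (at x)" for x
    by (rule has_derivative_diff[OF C1c_has_derivative C1c_has_derivative]) fact+
  show "C1c (\<lambda>x. f x - g x)"
    by (rule C1cI[OF d]) (use assms C0c_diff[OF C1c_C0c C1c_C0c, OF assms] in
       \<open>auto simp: C1c_def C0c_def intro!: continuous_intros\<close>)
  show "pd j (\<lambda>x. f x - g x) x = pd j f x - pd j g x"
    using pd_eq[OF d] by (simp add: pd_def)
qed

lemma C1c_cmult:
  assumes "C1c f"
  shows "C1c (\<lambda>x. c *\<^sub>R f x)" "pd j (\<lambda>x. c *\<^sub>R f x) x = c *\<^sub>R pd j f x"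
proof -
  let ?D = "\<lambda>x v. c *\<^sub>R frechet_derivative f (at x) v"
  have d: "((\<lambda>x. c *\<^sub>R f x) has_derivative ?D x) (at x)" for x
    by (rule has_derivative_scaleR_right[OF C1c_has_derivative]) fact
  show "C1c (\<lambda>x. c *\<^sub>R f x)"
    by (rule C1cI[OF d]) (use assms in \<open>auto simp: C1c_def intro!: continuous_intros elim: bounded_subset\<close>)
  show "pd j (\<lambda>x. c *\<^sub>R f x) x = c *\<^sub>R pd j f x"
    using pd_eq[OF d] by (simp add: pd_def)
qed

lemma C1c_affine:
  assumes "C1c f" "c \<noteq> 0"
  shows "C1c (\<lambda>x. f (a + c *\<^sub>R x))" "pd j (\<lambda>x. f (a + c *\<^sub>R x)) x = c *\<^sub>R pd j f (a + c *\<^sub>R x)"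
proof -
  let ?D = "\<lambda>x v. c *\<^sub>R frechet_derivative f (at (a + c *\<^sub>R x)) v"
  have lin: "linear (frechet_derivative f (at y))" for y
    using assms C1c_def linear_frechet_derivative by blast
  have d: "((\<lambda>x. f (a + c *\<^sub>R x)) has_derivative ?D x) (at x)" for x
  proof -
    have "((\<lambda>x. f (a + c *\<^sub>R x)) has_derivative (\<lambda>v. frechet_derivative f (at (a + c *\<^sub>R x)) (c *\<^sub>R v))) (at x)"
      by (rule has_derivative_compose[OF _ C1c_has_derivative[OF assms(1)]])
         (auto intro!: derivative_eq_intros)
    then show ?thesis by (simp add: linear_cmul[OF lin])
  qed
  show "C1c (\<lambda>x. f (a + c *\<^sub>R x))"
  proof (rule C1cI[OF d])
    show "bounded {x. f (a + c *\<^sub>R x) \<noteq> 0}"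
      using bounded_affine_vimage[of "{x. f x \<noteq> 0}" c a] assms by (simp add: C1c_def)
    show "continuous_on UNIV (\<lambda>x. c *\<^sub>R frechet_derivative f (at (a + c *\<^sub>R x)) v)" for v
      by (intro continuous_on_scaleR continuous_on_const
            continuous_on_affine_arg[of "\<lambda>y. frechet_derivative f (at y) v"])
         (use assms(1) in \<open>auto simp: C1c_def\<close>)
  qed
  show "pd j (\<lambda>x. f (a + c *\<^sub>R x)) x = c *\<^sub>R pd j f (a + c *\<^sub>R x)"
    using pd_eq[OF d] by (simp add: pd_def)
qed

lemma integral_by_parts_pd:
  fixes f :: "real^'n \<Rightarrow> 'b::{banach, second_countable_topology}"
  assumes "C1c a" "C1c f"
  shows "(LBINT x. pd j a x *\<^sub>R f x) = - (LBINT x. a x *\<^sub>R pd j f x)"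
proof -
  have i: "integrable lborel (\<lambda>x. pd j a x *\<^sub>R f x)" "integrable lborel (\<lambda>x. a x *\<^sub>R pd j f x)"
    by (intro C0c_integrable C0c_scaleR' C0c_pd C1c_C0c assms)+
  have "(LBINT x. pd j a x *\<^sub>R f x + a x *\<^sub>R pd j f x) = 0"
    using integral_pd_zero[OF C1c_scaleR(1)[OF assms], of j] by (simp add: C1c_scaleR(2)[OF assms])
  then show ?thesis using i by (simp add: add_eq_0_iff)
qed

section \<open>Smooth bump functions\<close>

definition flat :: "real poly \<Rightarrow> real \<Rightarrow> real" where
  "flat p s = (if s > 0 then poly p (1 / s) * exp (- (1 / s)) else 0)"

lemma poly_exp_tendsto_0: "((\<lambda>x::real. poly q x * exp (- x)) \<longlongrightarrow> 0) at_top"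
proof -
  have "((\<lambda>x::real. \<Sum>i\<le>degree q. coeff q i * (x ^ i / exp x)) \<longlongrightarrow> (\<Sum>i\<le>degree q. coeff q i * 0)) at_top"
    by (intro tendsto_intros tendsto_power_div_exp_0)
  moreover have "poly q x * exp (- x) = (\<Sum>i\<le>degree q. coeff q i * (x ^ i / exp x))" for x
    by (simp add: poly_altdef sum_distrib_right exp_minus divide_inverse mult.assoc)
  ultimately show ?thesis by simp
qed

lemma flat_tendsto_0: "(flat q \<longlongrightarrow> 0) (at 0)"
proof (rule filterlim_split_at)
  have "((\<lambda>s. poly q (inverse s) * exp (- inverse s)) \<longlongrightarrow> 0) (at_right 0)"
    by (rule filterlim_compose[OF poly_exp_tendsto_0 filterlim_inverse_at_top_right])
  moreover have "\<forall>\<^sub>F s in at_right 0. poly q (inverse s) * exp (- inverse s) = flat q s"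
    by (rule eventually_at_rightI[of 0 1]) (auto simp: flat_def inverse_eq_divide)
  ultimately show "(flat q \<longlongrightarrow> 0) (at_right 0)" by (rule Lim_transform_eventually)
  have "\<forall>\<^sub>F s in at_left (0::real). 0 = flat q s"
    by (rule eventually_at_leftI[of "-1"]) (auto simp: flat_def)
  then show "(flat q \<longlongrightarrow> 0) (at_left 0)" by (rule Lim_transform_eventually[OF tendsto_const])
qed

lemma flat_has_derivative:
  "(flat p has_real_derivative flat ([:0, 0, 1:] * (p - pderiv p)) s) (at s)"
proof (cases s "0::real" rule: linorder_cases)
  case less
  have "((\<lambda>_. 0) has_real_derivative 0) (at s)" by simp
  then have "(flat p has_real_derivative 0) (at s)"
    by (rule DERIV_cong_ev[THEN iffD1, rotated -1])
       (use less in \<open>auto simp: flat_def intro!: eventually_nhds_in_open[of "{..<0}", THEN eventually_mono]\<close>)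
  then show ?thesis using less by (simp add: flat_def)
next
  case equal
  have "((\<lambda>h. (flat p (0 + h) - flat p 0) / h) \<longlongrightarrow> 0) (at 0)"
  proof (rule Lim_transform_eventually[OF flat_tendsto_0[of "[:0,1:] * p"]])
    show "\<forall>\<^sub>F h in at 0. flat ([:0,1:] * p) h = (flat p (0 + h) - flat p 0) / h"
      by (rule always_eventually) (auto simp: flat_def)
  qed
  then show ?thesis using equal by (simp add: flat_def DERIV_def)
next
  case greater
  have "((\<lambda>s. poly p (1 / s) * exp (- (1 / s))) has_real_derivative
      flat ([:0, 0, 1:] * (p - pderiv p)) s) (at s)"
    using greater
    by (auto intro!: derivative_eq_intros poly_DERIV[THEN DERIV_chain2] simp: flat_def)
       (simp add: field_simps power2_eq_square)
  then show ?thesis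
    by (rule DERIV_cong_ev[THEN iffD1, rotated -1])
       (use greater in \<open>auto simp: flat_def intro!: eventually_nhds_in_open[of "{0<..}", THEN eventually_mono]\<close>)
qed

text \<open>A class of functions closed under directional derivatives consists of smooth functions.\<close>

inductive flat_alg :: "(real^'n \<Rightarrow> real) \<Rightarrow> bool" where
  const: "flat_alg (\<lambda>_. c)"
| flat: "flat_alg (\<lambda>x. flat p (a * x $ i + b))"
| add: "flat_alg f \<Longrightarrow> flat_alg g \<Longrightarrow> flat_alg (\<lambda>x. f x + g x)"
| mult: "flat_alg f \<Longrightarrow> flat_alg g \<Longrightarrow> flat_alg (\<lambda>x. f x * g x)"

lemma flat_alg_derivative:
  fixes f :: "real^'n \<Rightarrow> real"
  shows "flat_alg f \<Longrightarrow> \<exists>D. (\<forall>x. (f has_derivative D x) (at x)) \<and> (\<forall>v. flat_alg (\<lambda>x. D x v))"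
proof (induction rule: flat_alg.induct)
  case (const c)
  show ?case by (intro exI[of _ "\<lambda>_ _. 0"]) (auto intro: flat_alg.const)
next
  case (flat p a i b)
  let ?q = "[:0, 0, 1:] * (p - pderiv p)"
  have "((\<lambda>x. flat p (a * x $ i + b)) has_derivative (\<lambda>v. flat ?q (a * x $ i + b) * (a * v $ i))) (at x)" for x :: "real^'n"
  proof (rule has_derivative_compose[of "\<lambda>x. a * x $ i + b" _ _ _ "flat p" "(*) (flat ?q (a * x $ i + b))"])
    show "(flat p has_derivative (*) (flat ?q (a * x $ i + b))) (at (a * x $ i + b))"
      using flat_has_derivative has_field_derivative_def by blast
  qed (auto intro!: derivative_eq_intros bounded_linear_vec_nth[THEN bounded_linear.has_derivative])
  moreover have "flat_alg (\<lambda>x::real^'n. flat ?q (a * x $ i + b) * (a * v $ i))" for v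
    by (rule flat_alg.mult[OF flat_alg.flat flat_alg.const])
  ultimately show ?case by (intro exI[of _ "\<lambda>x v. flat ?q (a * x $ i + b) * (a * v $ i)"]) blast
next
  case (add f g)
  then obtain D E where "\<forall>x. (f has_derivative D x) (at x)" "\<forall>v. flat_alg (\<lambda>x. D x v)"
    "\<forall>x. (g has_derivative E x) (at x)" "\<forall>v. flat_alg (\<lambda>x. E x v)" by blast
  then show ?case
    by (intro exI[of _ "\<lambda>x v. D x v + E x v"]) (auto intro: flat_alg.add has_derivative_add)
next
  case (mult f g)
  then obtain D E where "\<forall>x. (f has_derivative D x) (at x)" "\<forall>v. flat_alg (\<lambda>x. D x v)"
    "\<forall>x. (g has_derivative E x) (at x)" "\<forall>v. flat_alg (\<lambda>x. E x v)" by blast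
  moreover from this have "flat_alg (\<lambda>x. f x * E x v + D x v * g x)" for v
    using mult.hyps by (intro flat_alg.add[OF flat_alg.mult flat_alg.mult]) auto
  ultimately show ?case
    by (intro exI[of _ "\<lambda>x v. f x * E x v + D x v * g x"]) (auto intro: has_derivative_mult)
qed

lemma flat_alg_C_k: "flat_alg f \<Longrightarrow> C_k k f"
proof (induction k arbitrary: f)
  case 0
  then obtain D where "\<And>x. (f has_derivative D x) (at x)" using flat_alg_derivative by blast
  then show ?case
    by (auto intro!: continuous_at_imp_continuous_on has_derivative_continuous)
next
  case (Suc k)
  then obtain D where D: "\<And>x. (f has_derivative D x) (at x)" "\<And>v. flat_alg (\<lambda>x. D x v)"
    using flat_alg_derivative by metis
  have "frechet_derivative f (at x) = D x" for x
    using frechet_derivative_at[OF D(1)] by simp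
  then show ?case using D Suc.IH by (auto simp: differentiable_def)
qed

lemma flat_alg_prod: "(\<And>i. i \<in> I \<Longrightarrow> flat_alg (f i)) \<Longrightarrow> flat_alg (\<lambda>x. \<Prod>i\<in>I. f i x)"
  by (induction I rule: infinite_finite_induct) (auto intro: flat_alg.const flat_alg.mult)

definition bump :: "nat \<Rightarrow> real^'n \<Rightarrow> real^'n \<Rightarrow> real^'n \<Rightarrow> real" where
  "bump m a b x = (\<Prod>i\<in>UNIV. flat 1 (real m * (x $ i - a $ i)) * flat 1 (real m * (b $ i - x $ i)))"

lemma flat_1: "flat 1 s = (if s > 0 then exp (- (1 / s)) else 0)"
  by (simp add: flat_def)

lemma flat_1_nonzero: "flat 1 s \<noteq> 0 \<longleftrightarrow> s > 0"
  by (simp add: flat_1)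

lemma bump_nonneg: "0 \<le> bump m a b x"
  unfolding bump_def by (intro prod_nonneg) (auto simp: flat_1)

lemma bump_le_1: "bump m a b x \<le> 1"
  unfolding bump_def by (intro prod_le_1) (auto simp: flat_1 mult_le_one)

lemma bump_nonzero_iff: "m > 0 \<Longrightarrow> bump m a b x \<noteq> 0 \<longleftrightarrow> x \<in> box a b"
  unfolding bump_def by (auto simp: flat_1_nonzero mem_box_cart zero_less_mult_iff)

lemma bump_test_function:
  assumes "m > 0" shows "bump m a b \<in> test_functions UNIV"
proof -
  have "flat_alg (bump m a b)"
  proof -
    have "flat_alg (\<lambda>x. \<Prod>i\<in>UNIV. flat 1 (real m * x $ i + - (real m * a $ i)) * flat 1 (- real m * x $ i + real m * b $ i))"
      by (intro flat_alg_prod flat_alg.mult flat_alg.flat)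
    then show ?thesis unfolding bump_def[abs_def] by (simp add: algebra_simps)
  qed
  moreover have "{x. bump m a b x \<noteq> 0} = box a b" using bump_nonzero_iff[OF assms] by blast
  ultimately show ?thesis
    unfolding test_functions_def by (auto intro: flat_alg_C_k simp: compact_closure bounded_box)
qed

lemma bump_tendsto_indicator: "(\<lambda>m. bump (Suc m) a b x) \<longlonglongrightarrow> indicator (box a b) x"
proof (cases "x \<in> box a b")
  case True
  have *: "(\<lambda>m. flat 1 (real (Suc m) * s)) \<longlonglongrightarrow> 1" if "s > 0" for s
  proof -
    have "(\<lambda>m. exp (- (1 / s * (1 / real (Suc m))))) \<longlonglongrightarrow> exp (- (1 / s * 0))"
      by (intro tendsto_intros LIMSEQ_Suc lim_1_over_n)
    then show ?thesis using that by (simp add: flat_1 mult.commute)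
  qed
  have "(\<lambda>m. bump (Suc m) a b x) \<longlonglongrightarrow> (\<Prod>i\<in>(UNIV::'a set). 1 * 1)"
    unfolding bump_def using True by (intro tendsto_prod tendsto_mult *) (auto simp: mem_box_cart)
  then show ?thesis using True by simp
next
  case False
  then have "bump (Suc m) a b x = 0" for m using bump_nonzero_iff[of "Suc m" a b x] by simp
  then show ?thesis using False by simp
qed

lemma test_functions_C1c: "\<psi> \<in> test_functions U \<Longrightarrow> C1c \<psi>"
proof -
  assume a: "\<psi> \<in> test_functions U"
  then have "C_k (Suc 0) \<psi>" by (auto simp: test_functions_def)
  moreover have "bounded {x. \<psi> x \<noteq> 0}"
    using a compact_imp_bounded bounded_subset closure_subset by (auto simp: test_functions_def)
  ultimately show "C1c \<psi>" by (simp add: C1c_def)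
qed

section \<open>Uniqueness of weak derivatives\<close>

lemma L2_set_integrable:
  assumes "v \<in> L2" "integrable lborel g" "\<And>x. \<bar>g x\<bar> \<le> B"
  shows "integrable lborel (\<lambda>x. g x *\<^sub>R v x)"
proof (rule Bochner_Integration.integrable_bound)
  show "integrable lborel (\<lambda>x. \<bar>g x\<bar> + B * (norm (v x))\<^sup>2)"
    using assms unfolding L2_def by auto
  show "(\<lambda>x. g x *\<^sub>R v x) \<in> borel_measurable lborel"
    using assms unfolding L2_def by auto
  show "AE x in lborel. norm (g x *\<^sub>R v x) \<le> norm (\<bar>g x\<bar> + B * (norm (v x))\<^sup>2)"
  proof (rule AE_I2)
    fix x
    have B: "B \<ge> 0" using assms(3)[of x] by linarith
    have "norm (v x) \<le> 1 + (norm (v x))\<^sup>2"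
      using sum_squares_ge_zero[of "norm (v x) - 1/2" 0] by (simp add: power2_eq_square algebra_simps)
    then have "\<bar>g x\<bar> * norm (v x) \<le> \<bar>g x\<bar> * (1 + (norm (v x))\<^sup>2)" by (intro mult_left_mono) auto
    also have "\<dots> \<le> \<bar>g x\<bar> + B * (norm (v x))\<^sup>2" using assms(3)[of x] by (simp add: algebra_simps mult_right_mono)
    finally show "norm (g x *\<^sub>R v x) \<le> norm (\<bar>g x\<bar> + B * (norm (v x))\<^sup>2)" using B by simp
  qed
qed

lemma L2_diff:
  assumes "u \<in> L2" "v \<in> L2" shows "(\<lambda>x. u x - v x) \<in> L2"
proof -
  have m: "u \<in> borel_measurable lborel" "v \<in> borel_measurable lborel" using assms by (auto simp: L2_def)
  have "integrable lborel (\<lambda>x. (norm (u x - v x))\<^sup>2)"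
  proof (rule Bochner_Integration.integrable_bound)
    show "integrable lborel (\<lambda>x. 2 * (norm (u x))\<^sup>2 + 2 * (norm (v x))\<^sup>2)"
      using assms unfolding L2_def by auto
    show "AE x in lborel. norm ((norm (u x - v x))\<^sup>2) \<le> norm (2 * (norm (u x))\<^sup>2 + 2 * (norm (v x))\<^sup>2)"
    proof (rule AE_I2)
      fix x
      have "(norm (u x - v x))\<^sup>2 \<le> (norm (u x) + norm (v x))\<^sup>2" by (intro power_mono norm_triangle_ineq4) auto
      also have "\<dots> \<le> 2 * (norm (u x))\<^sup>2 + 2 * (norm (v x))\<^sup>2"
        using sum_squares_ge_zero[of "norm (u x) - norm (v x)" 0] by (simp add: power2_eq_square algebra_simps)
      finally show "norm ((norm (u x - v x))\<^sup>2) \<le> norm (2 * (norm (u x))\<^sup>2 + 2 * (norm (v x))\<^sup>2)" by simp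
    qed
  qed (use m in measurable)
  then show ?thesis using m by (auto simp: L2_def)
qed

lemma fundamental_lemma:
  fixes v :: "real^'n \<Rightarrow> real^'n"
  assumes v: "v \<in> L2" and 0: "\<And>\<psi>. \<psi> \<in> test_functions UNIV \<Longrightarrow> (LBINT x. \<psi> x *\<^sub>R v x) = 0"
  shows "AE x in lborel. v x = 0"
proof -
  have vb[measurable]: "v \<in> borel_measurable lborel" using v by (auto simp: L2_def)
  have ib: "integrable lborel (\<lambda>x. indicator (box a b) x *\<^sub>R v x)" for a b
    by (rule L2_set_integrable[OF v, of _ 1])
       (auto intro!: integrable_real_indicator emeasure_bounded_finite bounded_box)
  have box: "(LBINT x. indicator (box a b) x *\<^sub>R v x) = 0" for a b
  proof -
    have "(\<lambda>m. LBINT x. bump (Suc m) a b x *\<^sub>R v x) \<longlonglongrightarrow> (LBINT x. indicator (box a b) x *\<^sub>R v x)"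
    proof (rule integral_dominated_convergence[where w="\<lambda>x. norm (indicator (box a b) x *\<^sub>R v x)"])
      show "(\<lambda>x. bump (Suc m) a b x *\<^sub>R v x) \<in> borel_measurable lborel" for m
        using C0c_measurable[OF C1c_C0c[OF test_functions_C1c[OF bump_test_function[of "Suc m" a b]]]] by simp
      show "AE x in lborel. norm (bump (Suc m) a b x *\<^sub>R v x) \<le> norm (indicator (box a b) x *\<^sub>R v x)" for m
      proof (rule AE_I2)
        fix x
        show "norm (bump (Suc m) a b x *\<^sub>R v x) \<le> norm (indicator (box a b) x *\<^sub>R v x)"
          using bump_le_1[of "Suc m" a b x] bump_nonneg[of "Suc m" a b x] bump_nonzero_iff[of "Suc m" a b x]
          by (cases "x \<in> box a b") (auto simp: mult_left_le_one_le)
      qed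
      show "AE x in lborel. (\<lambda>m. bump (Suc m) a b x *\<^sub>R v x) \<longlonglongrightarrow> indicator (box a b) x *\<^sub>R v x"
        by (intro AE_I2 tendsto_scaleR bump_tendsto_indicator tendsto_const)
      show "integrable lborel (\<lambda>x. norm (indicator (box a b) x *\<^sub>R v x))"
        by (rule integrable_norm[OF ib])
    qed measurable
    moreover have "(LBINT x. bump (Suc m) a b x *\<^sub>R v x) = 0" for m
      by (rule 0[OF bump_test_function]) simp
    ultimately show ?thesis by (simp add: LIMSEQ_const_iff)
  qed
  have comp: "AE x in lborel. v x $ k = 0" for k
  proof -
    have vk[measurable]: "(\<lambda>x. v x $ k) \<in> borel_measurable borel"
      using measurable_compose[OF vb borel_measurable_continuous_onI[of "\<lambda>y. y $ k"]]
      by (simp add: continuous_intros)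
    have ik: "integrable lborel (\<lambda>x. indicator (box a b) x * v x $ k)"
      and zk: "(LBINT x. indicator (box a b) x * v x $ k) = 0" for a b
    proof -
      show "integrable lborel (\<lambda>x. indicator (box a b) x * v x $ k)"
        using integrable_bounded_linear[OF bounded_linear_vec_nth ib[of a b], of k] by simp
      show "(LBINT x. indicator (box a b) x * v x $ k) = 0"
        using integral_bounded_linear[OF bounded_linear_vec_nth ib[of a b], of k] box[of a b] by simp
    qed
    define M where "M a b = density lborel (\<lambda>x. ennreal (indicator (box a b) x * max 0 (v x $ k)))" for a b
    define N where "N a b = density lborel (\<lambda>x. ennreal (indicator (box a b) x * max 0 (- (v x $ k))))" for a b
    have em: "emeasure (M a b) (box l u) = emeasure (N a b) (box l u)" for a b l u
    proof -
      obtain c d where cd: "box a b \<inter> box l u = box c d" unfolding box_Int_box by blast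
      have i1: "integrable lborel (\<lambda>x. indicator (box c d) x * max 0 (v x $ k))"
        and i2: "integrable lborel (\<lambda>x. indicator (box c d) x * max 0 (- (v x $ k)))"
        by (rule Bochner_Integration.integrable_bound[OF ik[of c d]]; auto split: split_indicator)+
      have "emeasure (M a b) (box l u) = (\<integral>\<^sup>+x. ennreal (indicator (box c d) x * max 0 (v x $ k)) \<partial>lborel)"
        unfolding M_def cd[symmetric]
        by (subst emeasure_density) (auto intro!: nn_integral_cong simp: indicator_def)
      also have "\<dots> = ennreal (LBINT x. indicator (box c d) x * max 0 (v x $ k))"
        by (rule nn_integral_eq_integral[OF i1]) auto
      also have "(LBINT x. indicator (box c d) x * max 0 (v x $ k))
          = (LBINT x. indicator (box c d) x * max 0 (- (v x $ k)))"
      proof -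
        have "(LBINT x. indicator (box c d) x * max 0 (v x $ k))
          - (LBINT x. indicator (box c d) x * max 0 (- (v x $ k)))
          = (LBINT x. indicator (box c d) x * v x $ k)"
          unfolding Bochner_Integration.integral_diff[OF i1 i2, symmetric]
          by (intro Bochner_Integration.integral_cong) (auto simp: indicator_def)
        then show ?thesis using zk by simp
      qed
      also have "ennreal \<dots> = (\<integral>\<^sup>+x. ennreal (indicator (box c d) x * max 0 (- (v x $ k))) \<partial>lborel)"
        by (rule nn_integral_eq_integral[OF i2, symmetric]) auto
      also have "\<dots> = emeasure (N a b) (box l u)"
        unfolding N_def cd[symmetric]
        by (subst emeasure_density) (auto intro!: nn_integral_cong simp: indicator_def)
      finally show ?thesis .
    qed
    have MN: "M a b = N a b" for a b
    proof (rule measure_eqI_generator_eq[where E="range (\<lambda>(a, b). box a b)" and \<Omega>=UNIV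
            and A="\<lambda>n. box (- (real n *\<^sub>R One)) (real n *\<^sub>R One)"])
      show "Int_stable (range (\<lambda>(a, b). box a b :: (real^'n) set))"
        by (auto simp: Int_stable_def box_Int_box)
      show "sets (M a b) = sigma_sets UNIV (range (\<lambda>(a, b). box a b))"
        "sets (N a b) = sigma_sets UNIV (range (\<lambda>(a, b). box a b))"
        by (simp_all add: M_def N_def borel_eq_box)
      show "emeasure (M a b) (box (- (real n *\<^sub>R One)) (real n *\<^sub>R One)) \<noteq> \<infinity>" for n
      proof -
        have i1: "integrable lborel (\<lambda>x. indicator (box a b) x * max 0 (v x $ k))"
          by (rule Bochner_Integration.integrable_bound[OF ik[of a b]]) (auto split: split_indicator)
        have "emeasure (M a b) (box (- (real n *\<^sub>R One)) (real n *\<^sub>R One)) \<le> emeasure (M a b) UNIV"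
          by (rule emeasure_mono) (auto simp: M_def)
        also have "\<dots> = ennreal (LBINT x. indicator (box a b) x * max 0 (v x $ k))"
          unfolding M_def by (subst emeasure_density) (auto simp: nn_integral_eq_integral[OF i1])
        finally show ?thesis by (metis ennreal_less_top infinity_ennreal_def leD top_greatest)
      qed
      show "(\<Union>n. box (- (real n *\<^sub>R One)) (real n *\<^sub>R One)) = (UNIV :: (real^'n) set)"
        by (rule UN_box_eq_UNIV)
    qed (use em in auto)
    have "AE x in lborel. ennreal (indicator (box a b) x * max 0 (v x $ k)) = ennreal (indicator (box a b) x * max 0 (- (v x $ k)))" for a b
      using MN[of a b] unfolding M_def N_def by (subst (asm) sigma_finite_measure.density_unique_iff[OF sigma_finite_lborel]) auto
    then have "AE x in lborel. \<forall>n::nat. ennreal (indicator (box (- (real n *\<^sub>R One)) (real n *\<^sub>R One)) x * max 0 (v x $ k))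
      = ennreal (indicator (box (- (real n *\<^sub>R One)) (real n *\<^sub>R One)) x * max 0 (- (v x $ k)))"
      unfolding AE_all_countable by blast
    then show ?thesis
    proof eventually_elim
      case (elim x)
      have "x \<in> (\<Union>n. box (- (real n *\<^sub>R One)) (real n *\<^sub>R One))" by (simp only: UN_box_eq_UNIV UNIV_I)
      then obtain n where "x \<in> box (- (real n *\<^sub>R One)) (real n *\<^sub>R One)" by blast
      then have *: "ennreal (v x $ k) = ennreal (- (v x $ k))" using elim[rule_format, of n] by simp
      show ?case
      proof (cases "v x $ k \<le> 0")
        case True
        then have "- (v x $ k) \<le> 0" using * by (metis ennreal_eq_0_iff)
        with True show ?thesis by simp
      next
        case False
        then have "v x $ k \<le> 0" using * by (metis ennreal_eq_0_iff less_eq_real_def linorder_not_le neg_le_0_iff_le)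
        with False show ?thesis by simp
      qed
    qed
  qed
  have "AE x in lborel. \<forall>k. v x $ k = 0" using comp by (simp add: AE_all_countable)
  then show ?thesis by eventually_elim (simp add: vec_eq_iff)
qed

lemma C1c_integrable_scaleR_L2:
  assumes "C1c \<psi>" "v \<in> L2"
  shows "integrable lborel (\<lambda>x. \<psi> x *\<^sub>R v x)" "integrable lborel (\<lambda>x. pd j \<psi> x *\<^sub>R v x)"
proof -
  have "integrable lborel (\<lambda>x. f x *\<^sub>R v x)" if f: "C0c f" for f
  proof -
    obtain B where "\<And>x. norm (f x) \<le> B" using C0c_bounded[OF f] by blast
    then show ?thesis by (intro L2_set_integrable[OF assms(2) C0c_integrable[OF f], of B]) simp
  qed
  then show "integrable lborel (\<lambda>x. \<psi> x *\<^sub>R v x)" "integrable lborel (\<lambda>x. pd j \<psi> x *\<^sub>R v x)"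
    using C1c_C0c C0c_pd assms(1) by blast+
qed

lemma weak_deriv_unique:
  assumes "v \<in> L2" "w \<in> L2" "is_weak_deriv j \<phi> v" "is_weak_deriv j \<phi> w"
  shows "AE x in lborel. v x = w x"
proof -
  have "AE x in lborel. v x - w x = 0"
  proof (rule fundamental_lemma[OF L2_diff[OF assms(1,2)]])
    fix \<psi> :: "real^'a \<Rightarrow> real" assume p: "\<psi> \<in> test_functions UNIV"
    then have "(LBINT x. \<psi> x *\<^sub>R v x) = (LBINT x. \<psi> x *\<^sub>R w x)"
      using bspec[OF assms(3)[unfolded is_weak_deriv_def] p] bspec[OF assms(4)[unfolded is_weak_deriv_def] p]
      by simp
    then show "(LBINT x. \<psi> x *\<^sub>R (v x - w x)) = 0"
      using C1c_integrable_scaleR_L2(1)[OF test_functions_C1c[OF p] assms(1)]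
        C1c_integrable_scaleR_L2(1)[OF test_functions_C1c[OF p] assms(2)]
      by (simp add: scaleR_diff_right)
  qed
  then show ?thesis by simp
qed

lemma weak_deriv_props:
  assumes "\<phi> \<in> H1" shows "weak_deriv j \<phi> \<in> L2" "is_weak_deriv j \<phi> (weak_deriv j \<phi>)"
proof -
  have "\<exists>v. v \<in> L2 \<and> is_weak_deriv j \<phi> v" using assms unfolding H1_def by blast
  from someI_ex[OF this] show "weak_deriv j \<phi> \<in> L2" "is_weak_deriv j \<phi> (weak_deriv j \<phi>)"
    unfolding weak_deriv_def by auto
qed

lemma weak_deriv_AE:
  assumes "\<phi> \<in> H1" "v \<in> L2" "is_weak_deriv j \<phi> v"
  shows "AE x in lborel. weak_deriv j \<phi> x = v x"
  using weak_deriv_unique[OF weak_deriv_props(1)[OF assms(1)] assms(2) weak_deriv_props(2)[OF assms(1)] assms(3)] .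

lemma H1_diff:
  assumes "\<phi> \<in> H1" "\<psi> \<in> H1"
  shows "(\<lambda>x. \<phi> x - \<psi> x) \<in> H1"
    and "AE x in lborel. weak_deriv j (\<lambda>x. \<phi> x - \<psi> x) x = weak_deriv j \<phi> x - weak_deriv j \<psi> x"
proof -
  note w = weak_deriv_props[OF assms(1)] weak_deriv_props[OF assms(2)]
  have L: "\<phi> \<in> L2" "\<psi> \<in> L2" using assms by (auto simp: H1_def)
  have d: "is_weak_deriv j (\<lambda>x. \<phi> x - \<psi> x) (\<lambda>x. weak_deriv j \<phi> x - weak_deriv j \<psi> x)" for j
    unfolding is_weak_deriv_def
  proof
    fix \<theta> :: "real^'a \<Rightarrow> real" assume t: "\<theta> \<in> test_functions UNIV"
    note c = test_functions_C1c[OF t]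
    show "(LBINT x. frechet_derivative \<theta> (at x) (axis j 1) *\<^sub>R (\<phi> x - \<psi> x))
      = - (LBINT x. \<theta> x *\<^sub>R (weak_deriv j \<phi> x - weak_deriv j \<psi> x))"
      using C1c_integrable_scaleR_L2(2)[OF c L(1), of j] C1c_integrable_scaleR_L2(2)[OF c L(2), of j]
        C1c_integrable_scaleR_L2(1)[OF c w(1), of j] C1c_integrable_scaleR_L2(1)[OF c w(3), of j]
        w(2)[of j] w(4)[of j] t
      unfolding is_weak_deriv_def pd_def by (simp add: scaleR_diff_right)
  qed
  show h: "(\<lambda>x. \<phi> x - \<psi> x) \<in> H1"
    unfolding H1_def using L2_diff[OF L] L2_diff[OF w(1) w(3)] d by blast
  show "AE x in lborel. weak_deriv j (\<lambda>x. \<phi> x - \<psi> x) x = weak_deriv j \<phi> x - weak_deriv j \<psi> x"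
    by (rule weak_deriv_AE[OF h L2_diff[OF w(1) w(3)] d])
qed

lemma C0c_L2: "C0c f \<Longrightarrow> f \<in> L2"
  unfolding L2_def using C0c_measurable C0c_integrable[OF C0c_norm_sq] by auto

lemma C1c_H1:
  fixes f :: "real^'n \<Rightarrow> real^'n"
  assumes "C1c f"
  shows "f \<in> H1" "AE x in lborel. weak_deriv j f x = pd j f x"
proof -
  have d: "is_weak_deriv j f (pd j f)" for j
    unfolding is_weak_deriv_def
    using integral_by_parts_pd[OF test_functions_C1c assms] by (simp add: pd_def)
  show h: "f \<in> H1" unfolding H1_def
    using C0c_L2[OF C1c_C0c[OF assms]] C0c_L2[OF C0c_pd[OF assms]] d by blast
  show "AE x in lborel. weak_deriv j f x = pd j f x"
    by (rule weak_deriv_AE[OF h C0c_L2[OF C0c_pd[OF assms]] d])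
qed

section \<open>The energy form\<close>

definition energy_form :: "real \<Rightarrow> ('n \<Rightarrow> real^'n) \<Rightarrow> real" where
  "energy_form \<alpha> D = (\<Sum>j\<in>UNIV. \<Sum>k\<in>UNIV. (D j $ k)\<^sup>2) + inverse \<alpha> * (\<Sum>j\<in>UNIV. D j $ j)\<^sup>2"

definition energy :: "real \<Rightarrow> (real^'n \<Rightarrow> real^'n) \<Rightarrow> real" where
  "energy \<alpha> \<phi> = (LBINT x. energy_form \<alpha> (\<lambda>j. pd j \<phi> x))"

definition l2sq :: "(real^'n \<Rightarrow> real^'n) \<Rightarrow> real" where
  "l2sq \<phi> = (LBINT x. (norm (\<phi> x))\<^sup>2)"

definition wl2sq :: "(real^'n \<Rightarrow> real) \<Rightarrow> (real^'n \<Rightarrow> real^'n) \<Rightarrow> real" where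
  "wl2sq W \<phi> = (LBINT x. W x * (norm (\<phi> x))\<^sup>2)"

lemma l2sq_nonneg: "0 \<le> l2sq \<phi>" by (simp add: l2sq_def)

lemma L2_norm_sq: "(L2_norm \<phi>)\<^sup>2 = l2sq \<phi>"
  by (simp add: L2_norm_def l2sq_def)

lemma K_energy_energy_form: "K_energy \<alpha> \<phi> = (LBINT x. energy_form \<alpha> (\<lambda>j. weak_deriv j \<phi> x))"
  by (simp add: K_energy_def energy_form_def grad_sq_def divergence_def)

lemma energy_form_nonneg: "\<alpha> > 0 \<Longrightarrow> 0 \<le> energy_form \<alpha> D"
  unfolding energy_form_def by (intro add_nonneg_nonneg sum_nonneg) auto

lemma norm_sq_vec: "(norm (v :: real^'n))\<^sup>2 = (\<Sum>k\<in>UNIV. (v $ k)\<^sup>2)"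
  by (simp add: norm_vec_def L2_set_def sum_nonneg)

lemma sum_sq_le: "(\<Sum>j\<in>UNIV. f j)\<^sup>2 \<le> real CARD('n) * (\<Sum>j\<in>(UNIV::'n::finite set). (f j)\<^sup>2)"
  using Cauchy_Schwarz_ineq_sum[of "\<lambda>_. 1" f "UNIV :: 'n set"] by simp

lemma energy_form_le:
  fixes D :: "'n \<Rightarrow> real^'n"
  assumes "\<alpha> > 0"
  shows "energy_form \<alpha> D \<le> (1 + real CARD('n) / \<alpha>) * (\<Sum>j\<in>UNIV. (norm (D j))\<^sup>2)"
proof -
  have "(\<Sum>j\<in>UNIV. D j $ j)\<^sup>2 \<le> real CARD('n) * (\<Sum>j\<in>UNIV. (D j $ j)\<^sup>2)" by (rule sum_sq_le)
  also have "\<dots> \<le> real CARD('n) * (\<Sum>j\<in>UNIV. (norm (D j))\<^sup>2)"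
    unfolding norm_sq_vec by (intro mult_left_mono sum_mono member_le_sum) auto
  finally have "inverse \<alpha> * (\<Sum>j\<in>UNIV. D j $ j)\<^sup>2 \<le> inverse \<alpha> * (real CARD('n) * (\<Sum>j\<in>UNIV. (norm (D j))\<^sup>2))"
    using assms by (intro mult_left_mono) auto
  then show ?thesis unfolding energy_form_def norm_sq_vec[symmetric] by (simp add: algebra_simps divide_inverse)
qed

lemma sum_norm_sq_le_energy_form: "\<alpha> > 0 \<Longrightarrow> (\<Sum>j\<in>UNIV. (norm (D j))\<^sup>2) \<le> energy_form \<alpha> D"
  unfolding energy_form_def norm_sq_vec by simp

lemma young_diff:
  fixes a b \<tau> :: real
  assumes "\<tau> > 0" shows "\<bar>a\<^sup>2 - b\<^sup>2\<bar> \<le> (1 + 1/\<tau>) * (a - b)\<^sup>2 + \<tau> * b\<^sup>2"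
proof -
  have "0 \<le> (\<tau> * b - (a - b))\<^sup>2 / \<tau>" "0 \<le> (\<tau> * b + (a - b))\<^sup>2 / \<tau>" using assms by auto
  then have "2 * b * (a - b) \<le> \<tau> * b\<^sup>2 + (a - b)\<^sup>2 / \<tau>" "- (2 * b * (a - b)) \<le> \<tau> * b\<^sup>2 + (a - b)\<^sup>2 / \<tau>"
    using assms by (auto simp: field_simps power2_eq_square)
  moreover have "a\<^sup>2 - b\<^sup>2 = (a - b)\<^sup>2 + 2 * b * (a - b)" by (simp add: power2_eq_square algebra_simps)
  moreover have "0 \<le> (a - b)\<^sup>2" by simp
  moreover have "(1 + 1/\<tau>) * (a - b)\<^sup>2 = (a - b)\<^sup>2 + (a - b)\<^sup>2 / \<tau>" by (simp add: distrib_right)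
  moreover define P Q R S where "P = (a - b)\<^sup>2" and "Q = (a - b)\<^sup>2 / \<tau>" and "R = 2 * b * (a - b)" and "S = \<tau> * b\<^sup>2"
  ultimately have "R \<le> S + Q" "- R \<le> S + Q" "a\<^sup>2 - b\<^sup>2 = P + R" "0 \<le> P" "(1 + 1/\<tau>) * (a - b)\<^sup>2 = P + Q"
    by simp_all
  then have "\<bar>a\<^sup>2 - b\<^sup>2\<bar> \<le> (1 + 1/\<tau>) * (a - b)\<^sup>2 + S" by linarith
  then show ?thesis by (simp only: S_def)
qed

lemma young_diff_norm:
  fixes a b :: "'b::real_normed_vector"
  assumes "\<tau> > 0" shows "\<bar>(norm a)\<^sup>2 - (norm b)\<^sup>2\<bar> \<le> (1 + 1/\<tau>) * (norm (a - b))\<^sup>2 + \<tau> * (norm b)\<^sup>2"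
proof -
  have "(norm a - norm b)\<^sup>2 \<le> (norm (a - b))\<^sup>2"
    using norm_triangle_ineq3[of a b] by (simp add: abs_le_square_iff[symmetric])
  then have "(1 + 1/\<tau>) * (norm a - norm b)\<^sup>2 \<le> (1 + 1/\<tau>) * (norm (a - b))\<^sup>2"
    using assms by (intro mult_left_mono) auto
  then show ?thesis using young_diff[OF assms, of "norm a" "norm b"] by linarith
qed

lemma energy_form_diff:
  fixes D E :: "'n \<Rightarrow> real^'n"
  assumes \<alpha>: "\<alpha> > 0" and \<tau>: "\<tau> > 0"
  shows "\<bar>energy_form \<alpha> D - energy_form \<alpha> E\<bar> \<le> (1 + 1/\<tau>) * energy_form \<alpha> (\<lambda>j. D j - E j) + \<tau> * energy_form \<alpha> E"
proof -
  have "\<bar>(\<Sum>j\<in>UNIV. \<Sum>k\<in>UNIV. (D j $ k)\<^sup>2) - (\<Sum>j\<in>UNIV. \<Sum>k\<in>UNIV. (E j $ k)\<^sup>2)\<bar>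
      \<le> (\<Sum>j\<in>UNIV. \<Sum>k\<in>UNIV. \<bar>(D j $ k)\<^sup>2 - (E j $ k)\<^sup>2\<bar>)"
    unfolding sum_subtractf[symmetric] by (rule order_trans[OF sum_abs sum_mono[OF sum_abs]])
  also have "\<dots> \<le> (\<Sum>j\<in>UNIV. \<Sum>k\<in>UNIV. (1 + 1/\<tau>) * (D j $ k - E j $ k)\<^sup>2 + \<tau> * (E j $ k)\<^sup>2)"
    by (intro sum_mono young_diff \<tau>)
  also have "\<dots> = (1 + 1/\<tau>) * (\<Sum>j\<in>UNIV. \<Sum>k\<in>UNIV. (D j $ k - E j $ k)\<^sup>2) + \<tau> * (\<Sum>j\<in>UNIV. \<Sum>k\<in>UNIV. (E j $ k)\<^sup>2)"
    by (simp only: sum.distrib sum_distrib_left)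
  finally have 1: "\<bar>(\<Sum>j\<in>UNIV. \<Sum>k\<in>UNIV. (D j $ k)\<^sup>2) - (\<Sum>j\<in>UNIV. \<Sum>k\<in>UNIV. (E j $ k)\<^sup>2)\<bar>
    \<le> (1 + 1/\<tau>) * (\<Sum>j\<in>UNIV. \<Sum>k\<in>UNIV. (D j $ k - E j $ k)\<^sup>2) + \<tau> * (\<Sum>j\<in>UNIV. \<Sum>k\<in>UNIV. (E j $ k)\<^sup>2)" .
  have "\<bar>(\<Sum>j\<in>UNIV. D j $ j)\<^sup>2 - (\<Sum>j\<in>UNIV. E j $ j)\<^sup>2\<bar>
    \<le> (1 + 1/\<tau>) * ((\<Sum>j\<in>UNIV. D j $ j) - (\<Sum>j\<in>UNIV. E j $ j))\<^sup>2 + \<tau> * (\<Sum>j\<in>UNIV. E j $ j)\<^sup>2"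
    by (rule young_diff[OF \<tau>])
  then have "inverse \<alpha> * \<bar>(\<Sum>j\<in>UNIV. D j $ j)\<^sup>2 - (\<Sum>j\<in>UNIV. E j $ j)\<^sup>2\<bar>
    \<le> inverse \<alpha> * ((1 + 1/\<tau>) * (\<Sum>j\<in>UNIV. D j $ j - E j $ j)\<^sup>2 + \<tau> * (\<Sum>j\<in>UNIV. E j $ j)\<^sup>2)"
    using \<alpha> by (intro mult_left_mono) (auto simp: sum_subtractf)
  moreover have "inverse \<alpha> * \<bar>(\<Sum>j\<in>UNIV. D j $ j)\<^sup>2 - (\<Sum>j\<in>UNIV. E j $ j)\<^sup>2\<bar>
    = \<bar>inverse \<alpha> * (\<Sum>j\<in>UNIV. D j $ j)\<^sup>2 - inverse \<alpha> * (\<Sum>j\<in>UNIV. E j $ j)\<^sup>2\<bar>"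
    using \<alpha> by (simp add: abs_mult flip: right_diff_distrib)
  ultimately show ?thesis using 1 unfolding energy_form_def
    by (simp add: distrib_left mult.left_commute)
qed

lemma measurable_vec_nth:
  assumes "f \<in> borel_measurable M" shows "(\<lambda>x. (f x :: real^'n) $ k) \<in> borel_measurable M"
  using measurable_compose[OF assms borel_measurable_continuous_onI[of "\<lambda>y. y $ k"]]
  by (simp add: continuous_intros)

lemma energy_form_integrable:
  fixes D :: "'n \<Rightarrow> real^'n \<Rightarrow> real^'n"
  assumes "\<alpha> > 0" "\<And>j. D j \<in> L2"
  shows "integrable lborel (\<lambda>x. energy_form \<alpha> (\<lambda>j. D j x))"
proof (rule Bochner_Integration.integrable_bound)
  have m[measurable]: "(\<lambda>x. D j x $ k) \<in> borel_measurable borel" for j k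
    using assms(2)[of j] by (intro measurable_vec_nth) (auto simp: L2_def)
  show "integrable lborel (\<lambda>x. (1 + real CARD('n) / \<alpha>) * (\<Sum>j\<in>UNIV. (norm (D j x))\<^sup>2))"
    using assms(2) by (auto simp: L2_def)
  show "(\<lambda>x. energy_form \<alpha> (\<lambda>j. D j x)) \<in> borel_measurable lborel"
    unfolding energy_form_def by measurable
  show "AE x in lborel. norm (energy_form \<alpha> (\<lambda>j. D j x)) \<le> norm ((1 + real CARD('n) / \<alpha>) * (\<Sum>j\<in>UNIV. (norm (D j x))\<^sup>2))"
  proof (rule AE_I2)
    fix x
    show "norm (energy_form \<alpha> (\<lambda>j. D j x)) \<le> norm ((1 + real CARD('n) / \<alpha>) * (\<Sum>j\<in>UNIV. (norm (D j x))\<^sup>2))"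
      using energy_form_le[OF assms(1), of "\<lambda>j. D j x"] energy_form_nonneg[OF assms(1), of "\<lambda>j. D j x"] by simp
  qed
qed

lemma weighted_diff:
  fixes f g :: "real^'n \<Rightarrow> real^'n"
  assumes f: "f \<in> L2" and g: "g \<in> L2" and \<tau>: "\<tau> > 0"
    and W[measurable]: "W \<in> borel_measurable borel" and W01: "\<And>x. 0 \<le> W x \<and> W x \<le> 1"
  shows "\<bar>wl2sq W f - wl2sq W g\<bar> \<le> (1 + 1/\<tau>) * l2sq (\<lambda>x. f x - g x) + \<tau> * l2sq g"
    and "integrable lborel (\<lambda>x. W x * (norm (f x))\<^sup>2)"
proof -
  have i: "integrable lborel (\<lambda>x. W x * (norm (f x))\<^sup>2)" if "f \<in> L2" for f :: "real^'n \<Rightarrow> real^'n"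
  proof (rule Bochner_Integration.integrable_bound)
    show "integrable lborel (\<lambda>x. (norm (f x))\<^sup>2)" "(\<lambda>x. W x * (norm (f x))\<^sup>2) \<in> borel_measurable lborel"
      using that by (auto simp: L2_def)
    show "AE x in lborel. norm (W x * (norm (f x))\<^sup>2) \<le> norm ((norm (f x))\<^sup>2)"
      using W01 by (intro AE_I2) (simp add: abs_mult mult_left_le_one_le)
  qed
  show "integrable lborel (\<lambda>x. W x * (norm (f x))\<^sup>2)" by (rule i[OF f])
  have i2: "integrable lborel (\<lambda>x. (norm (f x - g x))\<^sup>2)" "integrable lborel (\<lambda>x. (norm (g x))\<^sup>2)"
    using L2_diff[OF f g] g by (auto simp: L2_def)
  have "wl2sq W f - wl2sq W g = (LBINT x. W x * (norm (f x))\<^sup>2 - W x * (norm (g x))\<^sup>2)"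
    unfolding wl2sq_def using i f g by simp
  also have "\<bar>\<dots>\<bar> \<le> (LBINT x. \<bar>W x * (norm (f x))\<^sup>2 - W x * (norm (g x))\<^sup>2\<bar>)"
    by (rule integral_abs_bound)
  also have "\<dots> \<le> (LBINT x. (1 + 1/\<tau>) * (norm (f x - g x))\<^sup>2 + \<tau> * (norm (g x))\<^sup>2)"
  proof (rule integral_mono)
    fix x
    have "\<bar>W x * (norm (f x))\<^sup>2 - W x * (norm (g x))\<^sup>2\<bar> = W x * \<bar>(norm (f x))\<^sup>2 - (norm (g x))\<^sup>2\<bar>"
      using W01[of x] by (simp add: abs_mult flip: right_diff_distrib)
    also have "\<dots> \<le> 1 * \<bar>(norm (f x))\<^sup>2 - (norm (g x))\<^sup>2\<bar>"
      using W01[of x] by (intro mult_right_mono) auto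
    also have "\<dots> \<le> (1 + 1/\<tau>) * (norm (f x - g x))\<^sup>2 + \<tau> * (norm (g x))\<^sup>2"
      using young_diff_norm[OF \<tau>] by simp
    finally show "\<bar>W x * (norm (f x))\<^sup>2 - W x * (norm (g x))\<^sup>2\<bar>
      \<le> (1 + 1/\<tau>) * (norm (f x - g x))\<^sup>2 + \<tau> * (norm (g x))\<^sup>2" .
  qed (use i f g i2 in auto)
  also have "\<dots> = (1 + 1/\<tau>) * l2sq (\<lambda>x. f x - g x) + \<tau> * l2sq g"
    unfolding l2sq_def using i2 by simp
  finally show "\<bar>wl2sq W f - wl2sq W g\<bar> \<le> (1 + 1/\<tau>) * l2sq (\<lambda>x. f x - g x) + \<tau> * l2sq g" .
qed

lemma wl2sq_1: "wl2sq (\<lambda>_. 1) = l2sq"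
  by (simp add: fun_eq_iff wl2sq_def l2sq_def)

lemma K_energy_C1c:
  assumes "\<alpha> > 0" "C1c \<phi>" shows "K_energy \<alpha> \<phi> = energy \<alpha> \<phi>"
  unfolding K_energy_energy_form energy_def
proof (rule integral_cong_AE)
  note h = C1c_H1(1)[OF assms(2)]
  show "(\<lambda>x. energy_form \<alpha> (\<lambda>j. weak_deriv j \<phi> x)) \<in> borel_measurable lborel"
    by (rule borel_measurable_integrable[OF energy_form_integrable[OF assms(1) weak_deriv_props(1)[OF h]]])
  show "(\<lambda>x. energy_form \<alpha> (\<lambda>j. pd j \<phi> x)) \<in> borel_measurable lborel"
    by (rule borel_measurable_integrable[OF energy_form_integrable[OF assms(1) C0c_L2[OF C0c_pd[OF assms(2)]]]])
  have "AE x in lborel. \<forall>j. weak_deriv j \<phi> x = pd j \<phi> x"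
    using C1c_H1(2)[OF assms(2)] by (simp add: AE_all_countable)
  then show "AE x in lborel. energy_form \<alpha> (\<lambda>j. weak_deriv j \<phi> x) = energy_form \<alpha> (\<lambda>j. pd j \<phi> x)"
    by eventually_elim simp
qed

lemma grad_sq_integrable:
  "\<phi> \<in> H1 \<Longrightarrow> integrable lborel (grad_sq \<phi>)"
  using weak_deriv_props(1)[of \<phi>] unfolding grad_sq_def[abs_def] norm_sq_vec[symmetric]
  by (auto simp: L2_def)

lemma grad_sq_integral_nonneg: "0 \<le> (LBINT x. grad_sq \<phi> x)"
  by (simp add: integral_nonneg_AE grad_sq_def sum_nonneg)

lemma H1_norm_sq: "(H1_norm \<phi>)\<^sup>2 = l2sq \<phi> + (LBINT x. grad_sq \<phi> x)"
  unfolding H1_norm_def L2_norm_sq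
  by (rule real_sqrt_pow2) (intro add_nonneg_nonneg l2sq_nonneg grad_sq_integral_nonneg)

lemma K_energy_diff:
  fixes \<phi> \<psi> :: "real^'n \<Rightarrow> real^'n"
  assumes \<alpha>: "\<alpha> > 0" and \<tau>: "\<tau> > 0" and \<phi>: "\<phi> \<in> H1" and \<psi>: "\<psi> \<in> H1"
  shows "\<bar>K_energy \<alpha> \<psi> - K_energy \<alpha> \<phi>\<bar> \<le>
    (1 + 1/\<tau>) * ((1 + real CARD('n) / \<alpha>) * (H1_norm (\<lambda>x. \<psi> x - \<phi> x))\<^sup>2) + \<tau> * K_energy \<alpha> \<phi>"
proof -
  let ?\<chi> = "\<lambda>x. \<psi> x - \<phi> x"
  note h = H1_diff(1)[OF \<psi> \<phi>]
  note i = energy_form_integrable[OF \<alpha> weak_deriv_props(1)]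
  have ae: "AE x in lborel. \<forall>j. weak_deriv j ?\<chi> x = weak_deriv j \<psi> x - weak_deriv j \<phi> x"
    using H1_diff(2)[OF \<psi> \<phi>] by (simp add: AE_all_countable)
  have "K_energy \<alpha> \<psi> - K_energy \<alpha> \<phi> = (LBINT x. energy_form \<alpha> (\<lambda>j. weak_deriv j \<psi> x) - energy_form \<alpha> (\<lambda>j. weak_deriv j \<phi> x))"
    unfolding K_energy_energy_form using i[OF \<phi>] i[OF \<psi>] by simp
  also have "\<bar>\<dots>\<bar> \<le> (LBINT x. \<bar>energy_form \<alpha> (\<lambda>j. weak_deriv j \<psi> x) - energy_form \<alpha> (\<lambda>j. weak_deriv j \<phi> x)\<bar>)"
    by (rule integral_abs_bound)
  also have "\<dots> \<le> (LBINT x. (1 + 1/\<tau>) * ((1 + real CARD('n) / \<alpha>) * grad_sq ?\<chi> x) + \<tau> * energy_form \<alpha> (\<lambda>j. weak_deriv j \<phi> x))"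
  proof (rule integral_mono_AE)
    show "AE x in lborel. \<bar>energy_form \<alpha> (\<lambda>j. weak_deriv j \<psi> x) - energy_form \<alpha> (\<lambda>j. weak_deriv j \<phi> x)\<bar>
       \<le> (1 + 1/\<tau>) * ((1 + real CARD('n) / \<alpha>) * grad_sq ?\<chi> x) + \<tau> * energy_form \<alpha> (\<lambda>j. weak_deriv j \<phi> x)"
      using ae
    proof eventually_elim
      case (elim x)
      have "energy_form \<alpha> (\<lambda>j. weak_deriv j \<psi> x - weak_deriv j \<phi> x) \<le> (1 + real CARD('n) / \<alpha>) * grad_sq ?\<chi> x"
        using energy_form_le[OF \<alpha>, of "\<lambda>j. weak_deriv j \<psi> x - weak_deriv j \<phi> x"] elim
        unfolding grad_sq_def norm_sq_vec by simp
      then have "(1 + 1/\<tau>) * energy_form \<alpha> (\<lambda>j. weak_deriv j \<psi> x - weak_deriv j \<phi> x) \<le> (1 + 1/\<tau>) * ((1 + real CARD('n) / \<alpha>) * grad_sq ?\<chi> x)"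
        using \<tau> by (intro mult_left_mono) auto
      then show ?case using energy_form_diff[OF \<alpha> \<tau>, of "\<lambda>j. weak_deriv j \<psi> x" "\<lambda>j. weak_deriv j \<phi> x"] by linarith
    qed
  qed (use i[OF \<phi>] i[OF \<psi>] grad_sq_integrable[OF h] in auto)
  also have "\<dots> = (1 + 1/\<tau>) * ((1 + real CARD('n) / \<alpha>) * (LBINT x. grad_sq ?\<chi> x)) + \<tau> * K_energy \<alpha> \<phi>"
    unfolding K_energy_energy_form using i[OF \<phi>] grad_sq_integrable[OF h] by simp
  also have "\<dots> \<le> (1 + 1/\<tau>) * ((1 + real CARD('n) / \<alpha>) * (H1_norm ?\<chi>)\<^sup>2) + \<tau> * K_energy \<alpha> \<phi>"
    using \<tau> \<alpha> l2sq_nonneg[of ?\<chi>] unfolding H1_norm_sq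
    by (intro add_right_mono mult_left_mono) auto
  finally show ?thesis .
qed

lemma tendsto_of_young_bound:
  fixes x e :: "nat \<Rightarrow> real"
  assumes "e \<longlonglongrightarrow> 0" "\<And>m \<tau>. \<tau> > 0 \<Longrightarrow> \<bar>x m - l\<bar> \<le> (1 + 1/\<tau>) * e m + \<tau> * c" "0 \<le> c"
  shows "x \<longlonglongrightarrow> l"
proof (rule LIMSEQ_I)
  fix r :: real assume r: "r > 0"
  define \<tau> where "\<tau> = r / (2 * (c + 1))"
  have \<tau>: "\<tau> > 0" "\<tau> * c < r / 2" using r assms(3) by (auto simp: \<tau>_def field_simps)
  have "(\<lambda>m. (1 + 1/\<tau>) * e m) \<longlonglongrightarrow> (1 + 1/\<tau>) * 0" by (intro tendsto_intros assms)
  then have "\<forall>\<^sub>F m in sequentially. (1 + 1/\<tau>) * e m < r / 2" using r by (intro order_tendstoD) auto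
  then obtain m0 where m0: "\<And>m. m \<ge> m0 \<Longrightarrow> (1 + 1/\<tau>) * e m < r / 2"
    unfolding eventually_sequentially by blast
  show "\<exists>m0. \<forall>m\<ge>m0. norm (x m - l) < r"
  proof (intro exI[of _ m0] allI impI)
    fix m assume "m \<ge> m0"
    from m0[OF this] assms(2)[OF \<tau>(1), of m] \<tau>(2) have "\<bar>x m - l\<bar> < r" by linarith
    then show "norm (x m - l) < r" by simp
  qed
qed

lemma K_energy_nonneg: "\<alpha> > 0 \<Longrightarrow> 0 \<le> K_energy \<alpha> \<phi>"
  unfolding K_energy_energy_form by (intro integral_nonneg_AE AE_I2 energy_form_nonneg)

lemma energy_nonneg: "\<alpha> > 0 \<Longrightarrow> 0 \<le> energy \<alpha> \<phi>"
  unfolding energy_def by (intro integral_nonneg_AE AE_I2 energy_form_nonneg)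

lemma H1_limits:
  fixes \<phi> :: "real^'n \<Rightarrow> real^'n"
  assumes \<alpha>: "\<alpha> > 0" and \<phi>: "\<phi> \<in> H1" and \<psi>: "\<And>m. \<psi> m \<in> H1"
    and lim: "(\<lambda>m. H1_norm (\<lambda>x. \<psi> m x - \<phi> x)) \<longlonglongrightarrow> 0"
    and W: "W \<in> borel_measurable borel" and W01: "\<And>x. 0 \<le> W x \<and> W x \<le> 1"
  shows "(\<lambda>m. K_energy \<alpha> (\<psi> m)) \<longlonglongrightarrow> K_energy \<alpha> \<phi>" "(\<lambda>m. wl2sq W (\<psi> m)) \<longlonglongrightarrow> wl2sq W \<phi>"
proof -
  let ?e = "\<lambda>m. (H1_norm (\<lambda>x. \<psi> m x - \<phi> x))\<^sup>2"
  have e: "?e \<longlonglongrightarrow> 0" using tendsto_power[OF lim, of 2] by simp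
  have "(\<lambda>m. (1 + real CARD('n) / \<alpha>) * ?e m) \<longlonglongrightarrow> (1 + real CARD('n) / \<alpha>) * 0"
    by (intro tendsto_intros e)
  then have e': "(\<lambda>m. (1 + real CARD('n) / \<alpha>) * ?e m) \<longlonglongrightarrow> 0" by simp
  show "(\<lambda>m. K_energy \<alpha> (\<psi> m)) \<longlonglongrightarrow> K_energy \<alpha> \<phi>"
    by (rule tendsto_of_young_bound[OF e' K_energy_diff[OF \<alpha> _ \<phi> \<psi>] K_energy_nonneg[OF \<alpha>]])
  have L: "\<phi> \<in> L2" "\<psi> m \<in> L2" for m using \<phi> \<psi>[of m] by (auto simp: H1_def)
  show "(\<lambda>m. wl2sq W (\<psi> m)) \<longlonglongrightarrow> wl2sq W \<phi>"
  proof (rule tendsto_of_young_bound[OF e _ l2sq_nonneg])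
    fix m and \<tau> :: real assume \<tau>: "\<tau> > 0"
    have "\<bar>wl2sq W (\<psi> m) - wl2sq W \<phi>\<bar> \<le> (1 + 1/\<tau>) * l2sq (\<lambda>x. \<psi> m x - \<phi> x) + \<tau> * l2sq \<phi>"
      by (rule weighted_diff(1)[OF L(2) L(1) \<tau> W W01])
    also have "\<dots> \<le> (1 + 1/\<tau>) * ?e m + \<tau> * l2sq \<phi>"
      using \<tau> grad_sq_integral_nonneg unfolding H1_norm_sq by (intro add_right_mono mult_left_mono) auto
    finally show "\<bar>wl2sq W (\<psi> m) - wl2sq W \<phi>\<bar> \<le> (1 + 1/\<tau>) * ?e m + \<tau> * l2sq \<phi>" .
  qed
qed

lemma l2sq_pos_iff:
  assumes "\<phi> \<in> L2" shows "0 < l2sq \<phi> \<longleftrightarrow> \<not> (AE x in lborel. \<phi> x = 0)"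
proof -
  have "l2sq \<phi> = 0 \<longleftrightarrow> (AE x in lborel. (norm (\<phi> x))\<^sup>2 = 0)"
    unfolding l2sq_def using assms by (intro integral_nonneg_eq_0_iff_AE) (auto simp: L2_def)
  then show ?thesis using l2sq_nonneg[of \<phi>] by auto
qed

lemma test_functions_H1_0:
  fixes \<psi> :: "real^'n \<Rightarrow> real^'n"
  assumes "\<psi> \<in> test_functions U" shows "\<psi> \<in> H1_0 U"
proof -
  have C: "C1c \<psi>" by (rule test_functions_C1c[OF assms])
  have C0: "C1c (\<lambda>x. \<psi> x - \<psi> x)" by (rule C1c_diff[OF C C])
  have "AE x in lborel. \<forall>j. weak_deriv j (\<lambda>x. \<psi> x - \<psi> x) x = 0"
    using C1c_H1(2)[OF C0] C1c_diff(2)[OF C C] by (simp add: AE_all_countable)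
  then have "AE x in lborel. grad_sq (\<lambda>x. \<psi> x - \<psi> x) x = 0"
    by eventually_elim (simp add: grad_sq_def)
  then have "(LBINT x. grad_sq (\<lambda>x. \<psi> x - \<psi> x) x) = 0"
    by (intro integral_eq_zero_AE)
  then have "H1_norm (\<lambda>x. \<psi> x - \<psi> x) = 0"
    unfolding H1_norm_def by (simp add: L2_norm_def)
  then show ?thesis unfolding H1_0_def using C1c_H1(1)[OF C] assms
    by (auto intro!: exI[of _ "\<lambda>_. \<psi>"])
qed

lemma L2_norm_sqrt_weight:
  assumes "\<And>x. 0 \<le> W x" shows "(L2_norm (\<lambda>x. sqrt (W x) *\<^sub>R \<phi> x))\<^sup>2 = wl2sq W \<phi>"
  unfolding L2_norm_sq l2sq_def wl2sq_def using assms by (simp add: power_mult_distrib)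

lemma C_frak_less_iff:
  fixes W :: "real^'n \<Rightarrow> real"
  assumes \<alpha>: "\<alpha> > 0" and W: "W \<in> borel_measurable borel" and W01: "\<And>x. 0 \<le> W x \<and> W x \<le> 1"
  shows "C_frak W \<alpha> \<beta> t < ereal c \<longleftrightarrow> (\<exists>\<psi>\<in>test_functions (Q_hat t). 0 < l2sq \<psi> \<and>
    energy \<alpha> \<psi> + ln t powr (- 2 / real CARD('n)) * \<beta> * wl2sq W \<psi> < c * l2sq \<psi>)" (is "_ \<longleftrightarrow> ?R")
proof -
  let ?b = "ln t powr (- 2 / real CARD('n)) * \<beta>"
  have frac: "inverse p * s < c \<longleftrightarrow> s < c * p" if "p > 0" for p s :: real
    using that by (simp add: field_simps)
  have eq: "C_frak W \<alpha> \<beta> t < ereal c \<longleftrightarrow> (\<exists>\<phi>\<in>H1_0 (Q_hat t). 0 < l2sq \<phi> \<and>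
      K_energy \<alpha> \<phi> + ?b * wl2sq W \<phi> < c * l2sq \<phi>)"
  proof -
    have L: "\<phi> \<in> L2" if "\<phi> \<in> H1_0 (Q_hat t)" for \<phi> :: "real^'n \<Rightarrow> real^'n"
      using that by (auto simp: H1_0_def H1_def)
    show ?thesis unfolding C_frak_def INF_less_iff L2_norm_sqrt_weight[OF conjunct1[OF W01]] L2_norm_sq
      using l2sq_pos_iff[OF L] frac by (auto simp: Bex_def)
  qed
  show ?thesis
  proof
    assume ?R
    then obtain \<psi> where p: "\<psi> \<in> test_functions (Q_hat t)" "0 < l2sq \<psi>" "energy \<alpha> \<psi> + ?b * wl2sq W \<psi> < c * l2sq \<psi>"
      by blast
    then show "C_frak W \<alpha> \<beta> t < ereal c"
      unfolding eq using test_functions_H1_0[OF p(1)] K_energy_C1c[OF \<alpha> test_functions_C1c[OF p(1)]] by metis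
  next
    assume "C_frak W \<alpha> \<beta> t < ereal c"
    then obtain \<phi> where p: "\<phi> \<in> H1_0 (Q_hat t)" "0 < l2sq \<phi>" "K_energy \<alpha> \<phi> + ?b * wl2sq W \<phi> < c * l2sq \<phi>"
      unfolding eq by blast
    then obtain \<psi> where t: "\<And>m::nat. \<psi> m \<in> test_functions (Q_hat t)"
      and lim: "(\<lambda>m. H1_norm (\<lambda>x. \<psi> m x - \<phi> x)) \<longlonglongrightarrow> 0" and h: "\<phi> \<in> H1"
      unfolding H1_0_def by blast
    note C = test_functions_C1c[OF t]
    note l = H1_limits[OF \<alpha> h C1c_H1(1)[OF C] lim]
    have l3: "(\<lambda>m. l2sq (\<psi> m)) \<longlonglongrightarrow> l2sq \<phi>" using l(2)[of "\<lambda>_. 1"] by (simp add: wl2sq_1)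
    have "(\<lambda>m. K_energy \<alpha> (\<psi> m) + ?b * wl2sq W (\<psi> m) - c * l2sq (\<psi> m)) \<longlonglongrightarrow> K_energy \<alpha> \<phi> + ?b * wl2sq W \<phi> - c * l2sq \<phi>"
      by (intro tendsto_intros l[OF W W01] l3)
    then have "\<forall>\<^sub>F m in sequentially. K_energy \<alpha> (\<psi> m) + ?b * wl2sq W (\<psi> m) - c * l2sq (\<psi> m) < 0"
      using p(3) by (intro order_tendstoD) auto
    moreover have "\<forall>\<^sub>F m in sequentially. 0 < l2sq (\<psi> m)"
      using l3 p(2) by (intro order_tendstoD)
    ultimately have "\<forall>\<^sub>F m in sequentially. K_energy \<alpha> (\<psi> m) + ?b * wl2sq W (\<psi> m) - c * l2sq (\<psi> m) < 0 \<and> 0 < l2sq (\<psi> m)"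
      by (rule eventually_conj)
    then obtain m where "K_energy \<alpha> (\<psi> m) + ?b * wl2sq W (\<psi> m) - c * l2sq (\<psi> m) < 0" "0 < l2sq (\<psi> m)"
      using eventually_happens by force
    then show ?R using t[of m] K_energy_C1c[OF \<alpha> C, of m] by (intro bexI[of _ "\<psi> m"]) auto
  qed
qed

section \<open>Unit cells\<close>

definition cell_of :: "real^'n \<Rightarrow> int^'n" where
  "cell_of x = (\<chi> i. \<lceil>x $ i - 1 / 2\<rceil>)"

definition grid :: "nat \<Rightarrow> (int^'n) set" where
  "grid N = {w. \<forall>i. \<bar>w $ i\<bar> \<le> int N}"

definition intvec :: "int^'n \<Rightarrow> real^'n" where
  "intvec z = (\<chi> i. of_int (z $ i))"

lemma intvec_nth [simp]: "intvec z $ i = of_int (z $ i)"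
  by (simp add: intvec_def)

lemma mem_unit_cell_iff: "x \<in> unit_cell z \<longleftrightarrow> z = cell_of x"
proof -
  have "- 1 / 2 < x $ i - of_int (z $ i) \<and> x $ i - of_int (z $ i) \<le> 1 / 2 \<longleftrightarrow> \<lceil>x $ i - 1 / 2\<rceil> = z $ i" for i
    unfolding ceiling_eq_iff by auto
  then show ?thesis by (auto simp: unit_cell_def cell_of_def vec_eq_iff)
qed

lemma grid_eq_image: "grid N = vec_lambda ` (PiE UNIV (\<lambda>_. {- int N..int N}))"
proof
  show "(grid N :: (int^'a) set) \<subseteq> vec_lambda ` (PiE UNIV (\<lambda>_. {- int N..int N}))"
  proof
    fix w :: "int^'a" assume "w \<in> grid N"
    then have "vec_nth w \<in> PiE UNIV (\<lambda>_. {- int N..int N})" by (auto simp: grid_def abs_le_iff minus_le_iff)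
    then show "w \<in> vec_lambda ` (PiE UNIV (\<lambda>_. {- int N..int N}))" by (metis image_eqI vec_nth_inverse)
  qed
qed (auto simp: grid_def PiE_iff abs_le_iff minus_le_iff)

lemma finite_grid: "finite (grid N)"
  unfolding grid_eq_image by (intro finite_imageI finite_PiE) auto

lemma card_grid: "card (grid N :: (int^'n) set) = (2 * N + 1) ^ CARD('n)"
proof -
  have "card (grid N :: (int^'n) set) = card (PiE (UNIV::'n set) (\<lambda>_. {- int N..int N}))"
    unfolding grid_eq_image by (intro card_image inj_onI) (metis vec_lambda_inverse UNIV_I)
  also have "\<dots> = (2 * N + 1) ^ CARD('n)" by (subst card_PiE) (auto simp: nat_add_distrib nat_mult_distrib)
  finally show ?thesis .
qed

lemma unit_cell_measurable [measurable]: "unit_cell z \<in> sets borel"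
proof -
  have "unit_cell z = (\<Inter>i. {x. - 1 / 2 < x $ i - of_int (z $ i)} \<inter> {x. x $ i - of_int (z $ i) \<le> 1 / 2})"
    by (auto simp: unit_cell_def)
  also have "\<dots> \<in> sets borel"
    by (intro sets.finite_INT sets.Int borel_open borel_closed open_Collect_less closed_Collect_le continuous_intros) auto
  finally show ?thesis .
qed

lemma emeasure_lborel_cube:
  fixes l u :: "real^'n"
  assumes "0 \<le> c" "\<And>i. u $ i - l $ i = c"
  shows "emeasure lborel (box l u) = ennreal (c ^ CARD('n))"
    and "emeasure lborel (cbox l u) = ennreal (c ^ CARD('n))"
proof -
  have b: "(u - l) \<bullet> b = c" if "b \<in> Basis" for b
    using that assms(2) by (auto simp: Basis_vec_def inner_axis)
  have le: "l \<bullet> b \<le> u \<bullet> b" if "b \<in> Basis" for b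
    using b[OF that] assms(1) by (simp add: inner_diff_left)
  show "emeasure lborel (box l u) = ennreal (c ^ CARD('n))" "emeasure lborel (cbox l u) = ennreal (c ^ CARD('n))"
    using emeasure_lborel_box[OF le] emeasure_lborel_cbox[OF le] b by simp_all
qed

lemma emeasure_unit_cell: "emeasure lborel (unit_cell (z :: int^'n)) = 1"
proof -
  let ?l = "(\<chi> i. of_int (z $ i) - 1 / 2) :: real^'n" and ?u = "(\<chi> i. of_int (z $ i) + 1 / 2) :: real^'n"
  have "emeasure lborel (box ?l ?u) = 1" "emeasure lborel (cbox ?l ?u) = 1"
    using emeasure_lborel_cube[of 1 ?u ?l] by simp_all
  moreover have "box ?l ?u \<subseteq> unit_cell z" "unit_cell z \<subseteq> cbox ?l ?u"
  proof -
    show "box ?l ?u \<subseteq> unit_cell z"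
    proof
      fix x assume "x \<in> box ?l ?u"
      then have "real_of_int (z $ i) - 1 / 2 < x $ i" "x $ i < real_of_int (z $ i) + 1 / 2" for i
        by (auto simp: mem_box_cart)
      then have "- 1 / 2 < x $ i - real_of_int (z $ i)" "x $ i - real_of_int (z $ i) \<le> 1 / 2" for i
        by (smt (verit) field_sum_of_halves)+
      then show "x \<in> unit_cell z" by (simp add: unit_cell_def)
    qed
    show "unit_cell z \<subseteq> cbox ?l ?u"
    proof
      fix x assume "x \<in> unit_cell z"
      then have "- 1 / 2 < x $ i - real_of_int (z $ i)" "x $ i - real_of_int (z $ i) \<le> 1 / 2" for i
        unfolding unit_cell_def by auto
      then have "real_of_int (z $ i) - 1 / 2 \<le> x $ i" "x $ i \<le> real_of_int (z $ i) + 1 / 2" for i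
        by (smt (verit) field_sum_of_halves)+
      then show "x \<in> cbox ?l ?u" by (simp add: mem_box_cart)
    qed
  qed
  ultimately show ?thesis
    using emeasure_mono[of "box ?l ?u" "unit_cell z" lborel] emeasure_mono[of "unit_cell z" "cbox ?l ?u" lborel]
    by (simp add: unit_cell_measurable)
qed

lemma cell_of_in_grid:
  assumes "\<And>i. \<bar>x $ i\<bar> \<le> real N" shows "cell_of x \<in> grid N"
proof -
  have "\<bar>\<lceil>x $ i - 1 / 2\<rceil>\<bar> \<le> int N" for i
    using assms[of i] by (simp add: abs_le_iff) linarith
  then show ?thesis by (simp add: grid_def cell_of_def)
qed

lemma sum_indicator_cells:
  fixes f :: "real^'n \<Rightarrow> 'b::real_normed_vector"
  assumes "\<And>x. f x \<noteq> 0 \<Longrightarrow> cell_of x \<in> grid N"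
  shows "f x = (\<Sum>w\<in>grid N. indicator (unit_cell w) x *\<^sub>R f x)"
proof -
  have "(\<Sum>w\<in>grid N. indicator (unit_cell w) x *\<^sub>R f x) = (\<Sum>w\<in>grid N. if w = cell_of x then f x else 0)"
    by (intro sum.cong) (auto simp: mem_unit_cell_iff indicator_def)
  also have "\<dots> = f x" using assms[of x] by (auto simp: finite_grid)
  finally show ?thesis by simp
qed

lemma integral_sum_cells:
  fixes f :: "real^'n \<Rightarrow> 'b::{banach, second_countable_topology}"
  assumes "integrable lborel f" "\<And>x. f x \<noteq> 0 \<Longrightarrow> cell_of x \<in> grid N"
  shows "(LBINT x. f x) = (\<Sum>w\<in>grid N. LBINT x. indicator (unit_cell w) x *\<^sub>R f x)"
proof -
  have "(LBINT x. f x) = (LBINT x. (\<Sum>w\<in>grid N. indicator (unit_cell w) x *\<^sub>R f x))"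
    using sum_indicator_cells[OF assms(2)] by (intro Bochner_Integration.integral_cong) auto
  also have "\<dots> = (\<Sum>w\<in>grid N. LBINT x. indicator (unit_cell w) x *\<^sub>R f x)"
    by (rule Bochner_Integration.integral_sum) (intro integrable_mult_indicator assms, simp)
  finally show ?thesis .
qed

section \<open>Compactness in the style of Rellich\<close>

lemma (in prob_space) variance_identity:
  fixes f :: "'a \<Rightarrow> 'b::euclidean_space"
  assumes f[measurable]: "f \<in> borel_measurable M" and B: "\<And>x. norm (f x) \<le> B"
  shows "(\<integral>x. (norm (f x))\<^sup>2 \<partial>M) = (norm (\<integral>x. f x \<partial>M))\<^sup>2 + (\<integral>x. (\<integral>y. (norm (f x - f y))\<^sup>2 \<partial>M) \<partial>M) / 2"
    and "(norm (\<integral>x. f x \<partial>M))\<^sup>2 \<le> (\<integral>x. (norm (f x))\<^sup>2 \<partial>M)"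
proof -
  have i: "integrable M f" by (rule integrable_const_bound[of _ B]) (auto simp: B)
  have i2: "integrable M (\<lambda>x. (norm (f x))\<^sup>2)"
    by (rule integrable_const_bound[of _ "B\<^sup>2"]) (auto intro!: power_mono simp: B)
  let ?m = "\<integral>x. f x \<partial>M" and ?s = "\<integral>x. (norm (f x))\<^sup>2 \<partial>M"
  have exp: "(norm (f x - f y))\<^sup>2 = (norm (f x))\<^sup>2 + (norm (f y))\<^sup>2 - 2 * (f x \<bullet> f y)" for x y
    by (simp add: power2_norm_eq_inner inner_diff_left inner_diff_right inner_commute)
  have "(\<integral>y. (norm (f x - f y))\<^sup>2 \<partial>M) = (norm (f x))\<^sup>2 + ?s - 2 * (f x \<bullet> ?m)" for x
    unfolding exp using i i2 by (simp add: prob_space)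
  then have "(\<integral>x. (\<integral>y. (norm (f x - f y))\<^sup>2 \<partial>M) \<partial>M) = (\<integral>x. (norm (f x))\<^sup>2 + ?s - 2 * (f x \<bullet> ?m) \<partial>M)"
    by simp
  also have "\<dots> = 2 * ?s - 2 * (?m \<bullet> ?m)"
    using i i2 by (simp add: prob_space)
  finally show 1: "?s = (norm ?m)\<^sup>2 + (\<integral>x. (\<integral>y. (norm (f x - f y))\<^sup>2 \<partial>M) \<partial>M) / 2"
    by (simp add: power2_norm_eq_inner diff_divide_distrib)
  have "0 \<le> (\<integral>x. (\<integral>y. (norm (f x - f y))\<^sup>2 \<partial>M) \<partial>M)" by (intro integral_nonneg_AE AE_I2) auto
  with 1 show "(norm ?m)\<^sup>2 \<le> ?s" by linarith
qed

definition unif :: "'a::euclidean_space set \<Rightarrow> 'a measure" where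
  "unif Q = density lborel (\<lambda>x. ennreal (indicator Q x))"

lemma unif_prob:
  assumes "Q \<in> sets borel" "emeasure lborel Q = 1" shows "prob_space (unif Q)"
proof
  show "emeasure (unif Q) (space (unif Q)) = 1"
    using assms unfolding unif_def by (simp add: emeasure_density ennreal_indicator)
qed

lemma integral_unif:
  fixes f :: "'a::euclidean_space \<Rightarrow> 'b::{banach, second_countable_topology}"
  assumes "Q \<in> sets borel" "f \<in> borel_measurable borel"
  shows "(\<integral>x. f x \<partial>unif Q) = (LBINT x. indicator Q x *\<^sub>R f x)"
  unfolding unif_def using assms by (intro integral_density) auto

lemma nn_integral_unif:
  assumes "Q \<in> sets borel" "f \<in> borel_measurable borel"
  shows "(\<integral>\<^sup>+x. f x \<partial>unif Q) = (\<integral>\<^sup>+x. indicator Q x * f x \<partial>lborel)"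
  unfolding unif_def using assms by (simp add: nn_integral_density ennreal_indicator)

lemma sets_unif [simp, measurable_cong]: "sets (unif Q) = sets borel"
  by (simp add: unif_def)

lemma space_unif [simp]: "space (unif Q) = UNIV"
  by (simp add: unif_def)

definition grad_l2sq :: "(real^'n \<Rightarrow> real^'n) \<Rightarrow> real" where
  "grad_l2sq \<phi> = (LBINT x. (\<Sum>j\<in>UNIV. (norm (pd j \<phi> x))\<^sup>2))"

lemma grad_l2sq_integrable: "C1c \<phi> \<Longrightarrow> integrable lborel (\<lambda>x. (\<Sum>j\<in>UNIV. (norm (pd j \<phi> x))\<^sup>2))"
  by (intro C0c_integrable C0c_sum C0c_norm_sq C0c_pd)

lemma grad_l2sq_nonneg: "0 \<le> grad_l2sq \<phi>"
  unfolding grad_l2sq_def by (intro integral_nonneg_AE AE_I2 sum_nonneg) auto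

lemma grad_l2sq_le_energy: "\<alpha> > 0 \<Longrightarrow> C1c \<phi> \<Longrightarrow> grad_l2sq \<phi> \<le> energy \<alpha> \<phi>"
  unfolding grad_l2sq_def energy_def
  by (intro integral_mono grad_l2sq_integrable energy_form_integrable C0c_L2 C0c_pd sum_norm_sq_le_energy_form)

lemma frechet_eq_sum_pd:
  fixes f :: "real^'n \<Rightarrow> 'b::real_normed_vector"
  assumes "C1c f" shows "frechet_derivative f (at x) u = (\<Sum>j\<in>UNIV. u $ j *\<^sub>R pd j f x)"
proof -
  have lin: "linear (frechet_derivative f (at x))"
    using assms C1c_def linear_frechet_derivative by blast
  have "u = (\<Sum>j\<in>UNIV. u $ j *\<^sub>R axis j 1)"
    using basis_expansion[of u] by (simp add: scalar_mult_eq_scaleR)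
  then have "frechet_derivative f (at x) u = frechet_derivative f (at x) (\<Sum>j\<in>UNIV. u $ j *\<^sub>R axis j 1)"
    by simp
  also have "\<dots> = (\<Sum>j\<in>UNIV. u $ j *\<^sub>R pd j f x)"
    by (simp add: linear_sum[OF lin] linear_cmul[OF lin] pd_def)
  finally show ?thesis .
qed

lemma directional_sq_le:
  fixes f :: "real^'n \<Rightarrow> 'b::real_normed_vector"
  assumes "C1c f" "\<And>j. \<bar>u $ j\<bar> \<le> 1"
  shows "(norm (frechet_derivative f (at x) u))\<^sup>2 \<le> real CARD('n) * (\<Sum>j\<in>UNIV. (norm (pd j f x))\<^sup>2)"
proof -
  have "norm (frechet_derivative f (at x) u) \<le> (\<Sum>j\<in>UNIV. norm (u $ j *\<^sub>R pd j f x))"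
    unfolding frechet_eq_sum_pd[OF assms(1)] by (rule norm_sum)
  also have "\<dots> \<le> (\<Sum>j\<in>UNIV. norm (pd j f x))"
    using assms(2) by (intro sum_mono) (simp add: mult_left_le_one_le)
  finally have "(norm (frechet_derivative f (at x) u))\<^sup>2 \<le> (\<Sum>j\<in>UNIV. norm (pd j f x))\<^sup>2"
    by (intro power_mono) auto
  also have "\<dots> \<le> real CARD('n) * (\<Sum>j\<in>UNIV. (norm (pd j f x))\<^sup>2)" by (rule sum_sq_le)
  finally show ?thesis .
qed

lemma nn_integral_translate:
  fixes f :: "real^'n \<Rightarrow> ennreal"
  assumes "f \<in> borel_measurable borel"
  shows "(\<integral>\<^sup>+x. f (a + x) \<partial>lborel) = (\<integral>\<^sup>+x. f x \<partial>lborel)"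
  using nn_integral_affine[OF assms, of 1 a] by simp

lemma translation_estimate:
  fixes \<phi> :: "real^'n \<Rightarrow> real^'n"
  assumes C: "C1c \<phi>" and u: "\<And>j. \<bar>u $ j\<bar> \<le> 1"
  shows "(\<integral>\<^sup>+x. ennreal ((norm (\<phi> (x + u) - \<phi> x))\<^sup>2) \<partial>lborel) \<le> ennreal (real CARD('n) * grad_l2sq \<phi>)"
proof -
  let ?F = "\<lambda>x. frechet_derivative \<phi> (at x) u"
  let ?E = "\<lambda>x. ennreal ((norm (\<phi> (x + u) - \<phi> x))\<^sup>2)" and ?H = "\<lambda>x s. indicator {0..1} s * ennreal ((norm (?F (x + s *\<^sub>R u)))\<^sup>2)"
  have ccF: "C0c ?F" by (rule C1c_C0c_derivative[OF C])
  have F[measurable]: "?F \<in> borel_measurable borel" by (rule C0c_measurable[OF ccF])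
  have cF: "continuous_on UNIV ?F" using ccF by (simp add: C0c_def)
  obtain B where B: "\<And>x. norm (?F x) \<le> B" using C0c_bounded[OF ccF] by blast
  interpret u: prob_space "unif {0..1::real}" by (rule unif_prob) auto
  have point: "?E x
      \<le> (\<integral>\<^sup>+s. ?H x s \<partial>lborel)" for x
  proof -
    have cs: "continuous_on UNIV (\<lambda>s. ?F (x + s *\<^sub>R u))"
      by (rule continuous_on_compose2[OF cF]) (auto intro!: continuous_intros)
    have ms[measurable]: "(\<lambda>s. ?F (x + s *\<^sub>R u)) \<in> borel_measurable borel"
      using cs by (rule borel_measurable_continuous_onI)
    have "(LBINT s. indicator {0..1} s *\<^sub>R ?F (x + s *\<^sub>R u)) = \<phi> (x + 1 *\<^sub>R u) - \<phi> (x + 0 *\<^sub>R u)"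
      by (rule integral_FTC_Icc) (auto intro: derivative_along_line[OF C] continuous_on_subset[OF cs])
    then have "\<phi> (x + u) - \<phi> x = (\<integral>s. ?F (x + s *\<^sub>R u) \<partial>unif {0..1})"
      by (simp add: integral_unif)
    then have "(norm (\<phi> (x + u) - \<phi> x))\<^sup>2 \<le> (\<integral>s. (norm (?F (x + s *\<^sub>R u)))\<^sup>2 \<partial>unif {0..1})"
      using u.variance_identity(2)[of "\<lambda>s. ?F (x + s *\<^sub>R u)" B] B by simp
    then have "?E x \<le> ennreal (\<integral>s. (norm (?F (x + s *\<^sub>R u)))\<^sup>2 \<partial>unif {0..1})"
      by (rule ennreal_leI)
    also have "\<dots> = (\<integral>\<^sup>+s. ennreal ((norm (?F (x + s *\<^sub>R u)))\<^sup>2) \<partial>unif {0..1})"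
    proof (rule nn_integral_eq_integral[symmetric])
      show "integrable (unif {0..1}) (\<lambda>s. (norm (?F (x + s *\<^sub>R u)))\<^sup>2)"
        using B by (intro u.integrable_const_bound[of _ "B\<^sup>2"]) (auto intro!: power_mono)
    qed auto
    also have "\<dots> = (\<integral>\<^sup>+s. ?H x s \<partial>lborel)"
      by (rule nn_integral_unif) auto
    finally show ?thesis .
  qed
  have "(\<integral>\<^sup>+x. ?E x \<partial>lborel)
    \<le> (\<integral>\<^sup>+x. (\<integral>\<^sup>+s. ?H x s \<partial>lborel) \<partial>lborel)"
    by (intro nn_integral_mono point)
  also have "\<dots> = (\<integral>\<^sup>+s. (\<integral>\<^sup>+x. ?H x s \<partial>lborel) \<partial>lborel)"
    by (rule lborel_pair.Fubini') measurable
  also have "\<dots> = (\<integral>\<^sup>+s. indicator {0..1::real} s * (\<integral>\<^sup>+x. ennreal ((norm (?F x))\<^sup>2) \<partial>lborel) \<partial>lborel)"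
  proof (intro nn_integral_cong)
    fix s :: real
    have "(\<integral>\<^sup>+x. ?H x s \<partial>lborel)
      = indicator {0..1} s * (\<integral>\<^sup>+x. ennreal ((norm (?F (s *\<^sub>R u + x)))\<^sup>2) \<partial>lborel)"
      by (subst nn_integral_cmult) (auto simp: add.commute)
    also have "(\<integral>\<^sup>+x. ennreal ((norm (?F (s *\<^sub>R u + x)))\<^sup>2) \<partial>lborel) = (\<integral>\<^sup>+x. ennreal ((norm (?F x))\<^sup>2) \<partial>lborel)"
      by (rule nn_integral_translate[of "\<lambda>x. ennreal ((norm (?F x))\<^sup>2)"]) auto
    finally show "(\<integral>\<^sup>+x. ?H x s \<partial>lborel)
      = indicator {0..1} s * (\<integral>\<^sup>+x. ennreal ((norm (?F x))\<^sup>2) \<partial>lborel)" .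
  qed
  also have "\<dots> = (\<integral>\<^sup>+x. ennreal ((norm (?F x))\<^sup>2) \<partial>lborel)"
    by (subst nn_integral_multc) auto
  also have "\<dots> \<le> (\<integral>\<^sup>+x. ennreal (real CARD('n) * (\<Sum>j\<in>UNIV. (norm (pd j \<phi> x))\<^sup>2)) \<partial>lborel)"
    by (intro nn_integral_mono ennreal_leI directional_sq_le[OF C u])
  also have "\<dots> = ennreal (real CARD('n) * grad_l2sq \<phi>)"
    unfolding grad_l2sq_def using grad_l2sq_integrable[OF C]
    by (subst nn_integral_eq_integral) (auto simp: sum_nonneg)
  finally show ?thesis .
qed

lemma emeasure_cube: "emeasure lborel {u :: real^'n. \<forall>j. \<bar>u $ j\<bar> \<le> 1} = ennreal (2 ^ CARD('n))"
proof -
  have eq: "{u :: real^'n. \<forall>j. \<bar>u $ j\<bar> \<le> 1} = cbox (\<chi> i. - 1) (\<chi> i. 1)"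
    by (auto simp: mem_box_cart abs_le_iff minus_le_iff)
  show ?thesis unfolding eq by (rule emeasure_lborel_cube(2)) auto
qed

lemma poincare_cells:
  fixes \<phi> :: "real^'n \<Rightarrow> real^'n"
  assumes C: "C1c \<phi>" and supp: "\<And>x. \<phi> x \<noteq> 0 \<Longrightarrow> cell_of x \<in> grid N"
  shows "l2sq \<phi> \<le> (\<Sum>w\<in>grid N. (norm (LBINT x. indicator (unit_cell w) x *\<^sub>R \<phi> x))\<^sup>2)
    + 2 ^ CARD('n) * real CARD('n) * grad_l2sq \<phi>"
proof -
  let ?D = "\<lambda>x y. ennreal ((norm (\<phi> x - \<phi> y))\<^sup>2)" and ?E = "\<lambda>u x. ennreal ((norm (\<phi> (x + u) - \<phi> x))\<^sup>2)"
    and ?S = "\<lambda>x y. \<Sum>w\<in>grid N. indicator (unit_cell w) x * (indicator (unit_cell w) y * ennreal ((norm (\<phi> x - \<phi> y))\<^sup>2))"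
  have cphi: "C0c \<phi>" by (rule C1c_C0c[OF C])
  have m[measurable]: "\<phi> \<in> borel_measurable borel" by (rule C0c_measurable[OF cphi])
  obtain B where B: "\<And>x. norm (\<phi> x) \<le> B" using C0c_bounded[OF cphi] by blast
  let ?U = "\<lambda>w. unif (unit_cell w :: (real^'n) set)"
  have P: "prob_space (?U w)" for w by (rule unif_prob[OF unit_cell_measurable emeasure_unit_cell])
  define I where "I w = (\<integral>x. (\<integral>y. (norm (\<phi> x - \<phi> y))\<^sup>2 \<partial>?U w) \<partial>?U w)" for w
  have var: "(LBINT x. indicator (unit_cell w) x *\<^sub>R (norm (\<phi> x))\<^sup>2)
    = (norm (LBINT x. indicator (unit_cell w) x *\<^sub>R \<phi> x))\<^sup>2 + I w / 2" for w
    using prob_space.variance_identity(1)[OF P, of \<phi> w B] B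
    unfolding I_def by (simp add: integral_unif)
  have l2sq: "l2sq \<phi> = (\<Sum>w\<in>grid N. (norm (LBINT x. indicator (unit_cell w) x *\<^sub>R \<phi> x))\<^sup>2) + (\<Sum>w\<in>grid N. I w) / 2"
    unfolding l2sq_def integral_sum_cells[OF C0c_integrable[OF C0c_norm_sq[OF cphi]] supp, simplified]
    using var by (simp add: sum.distrib sum_divide_distrib)
  let ?C = "{u :: real^'n. \<forall>j. \<bar>u $ j\<bar> \<le> 1}"
  have Cm[measurable]: "?C \<in> sets borel"
  proof -
    have "?C = (\<Inter>j. {u. \<bar>u $ j\<bar> \<le> 1})" by auto
    also have "\<dots> \<in> sets borel" by (intro sets.finite_INT borel_closed closed_Collect_le continuous_intros) auto
    finally show ?thesis .
  qed
  have nnI: "ennreal (I w) = (\<integral>\<^sup>+x. (\<integral>\<^sup>+y. indicator (unit_cell w) x * (indicator (unit_cell w) y * ?D x y) \<partial>lborel) \<partial>lborel)" for w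
  proof -
    interpret prob_space "?U w" by (rule P)
    have b: "(norm (\<phi> x - \<phi> y))\<^sup>2 \<le> (2 * B)\<^sup>2" for x y
    proof (rule power_mono)
      show "norm (\<phi> x - \<phi> y) \<le> 2 * B" using norm_triangle_ineq4[of "\<phi> x" "\<phi> y"] B[of x] B[of y] by linarith
    qed simp
    have i: "integrable (?U w) (\<lambda>y. (norm (\<phi> x - \<phi> y))\<^sup>2)" for x
      using b by (intro integrable_const_bound[of _ "(2*B)\<^sup>2"]) auto
    have i2: "integrable (?U w) (\<lambda>x. \<integral>y. (norm (\<phi> x - \<phi> y))\<^sup>2 \<partial>?U w)"
    proof (rule integrable_const_bound[of _ "(2*B)\<^sup>2"])
      show "AE x in ?U w. norm (\<integral>y. (norm (\<phi> x - \<phi> y))\<^sup>2 \<partial>?U w) \<le> (2*B)\<^sup>2"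
      proof (rule AE_I2)
        fix x
        have "(\<integral>y. (norm (\<phi> x - \<phi> y))\<^sup>2 \<partial>?U w) \<le> (\<integral>y. (2*B)\<^sup>2 \<partial>?U w)"
          by (intro integral_mono i b) auto
        then show "norm (\<integral>y. (norm (\<phi> x - \<phi> y))\<^sup>2 \<partial>?U w) \<le> (2*B)\<^sup>2"
          using prob_space by simp
      qed
    qed measurable
    have "ennreal (I w) = (\<integral>\<^sup>+x. ennreal (\<integral>y. (norm (\<phi> x - \<phi> y))\<^sup>2 \<partial>?U w) \<partial>?U w)"
      unfolding I_def by (rule nn_integral_eq_integral[OF i2, symmetric]) auto
    also have "\<dots> = (\<integral>\<^sup>+x. (\<integral>\<^sup>+y. ?D x y \<partial>?U w) \<partial>?U w)"
      by (intro nn_integral_cong nn_integral_eq_integral[OF i, symmetric]) auto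
    also have "\<dots> = (\<integral>\<^sup>+x. indicator (unit_cell w) x * (\<integral>\<^sup>+y. ?D x y \<partial>?U w) \<partial>lborel)"
      by (rule nn_integral_unif) measurable
    also have "\<dots> = (\<integral>\<^sup>+x. (\<integral>\<^sup>+y. indicator (unit_cell w) x * (indicator (unit_cell w) y * ?D x y) \<partial>lborel) \<partial>lborel)"
      by (intro nn_integral_cong) (simp add: nn_integral_unif nn_integral_cmult)
    finally show ?thesis .
  qed
  have Inn: "0 \<le> I w" for w unfolding I_def by (intro integral_nonneg_AE AE_I2) auto
  have "ennreal (\<Sum>w\<in>grid N. I w) = (\<Sum>w\<in>grid N. ennreal (I w))"
    by (rule sum_ennreal[symmetric]) (rule Inn)
  also have "\<dots> = (\<integral>\<^sup>+x. (\<Sum>w\<in>grid N. \<integral>\<^sup>+y. indicator (unit_cell w) x * (indicator (unit_cell w) y * ?D x y) \<partial>lborel) \<partial>lborel)"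
    unfolding nnI by (rule nn_integral_sum[symmetric]) measurable
  also have "\<dots> = (\<integral>\<^sup>+x. (\<integral>\<^sup>+y. ?S x y \<partial>lborel) \<partial>lborel)"
    by (intro nn_integral_cong nn_integral_sum[symmetric]) measurable
  also have "\<dots> \<le> (\<integral>\<^sup>+x. (\<integral>\<^sup>+y. indicator ?C (y - x) * ennreal ((norm (\<phi> y - \<phi> x))\<^sup>2) \<partial>lborel) \<partial>lborel)"
  proof (intro nn_integral_mono)
    fix x y :: "real^'n"
    have "?S x y
      = (\<Sum>w\<in>grid N. if w = cell_of x then (if w = cell_of y then ?D x y else 0) else 0)"
      by (intro sum.cong) (auto simp: mem_unit_cell_iff indicator_def)
    also have "\<dots> \<le> (if cell_of x = cell_of y then ?D x y else 0)"
      by (simp add: finite_grid)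
    also have "\<dots> \<le> indicator ?C (y - x) * ennreal ((norm (\<phi> y - \<phi> x))\<^sup>2)"
    proof (cases "cell_of x = cell_of y")
      case True
      then have "x \<in> unit_cell (cell_of x)" "y \<in> unit_cell (cell_of x)" by (auto simp: mem_unit_cell_iff)
      then have "y - x \<in> ?C" unfolding unit_cell_def mem_Collect_eq vector_minus_component
        by (smt (verit) field_sum_of_halves)
      then show ?thesis using True by (simp add: norm_minus_commute)
    qed auto
    finally show "?S x y
      \<le> indicator ?C (y - x) * ennreal ((norm (\<phi> y - \<phi> x))\<^sup>2)" .
  qed
  also have "\<dots> = (\<integral>\<^sup>+x. (\<integral>\<^sup>+u. indicator ?C u * ?E u x \<partial>lborel) \<partial>lborel)"
  proof (rule nn_integral_cong)
    fix x :: "real^'n"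
    show "(\<integral>\<^sup>+y. indicator ?C (y - x) * ennreal ((norm (\<phi> y - \<phi> x))\<^sup>2) \<partial>lborel)
      = (\<integral>\<^sup>+u. indicator ?C u * ?E u x \<partial>lborel)"
      using nn_integral_translate[of "\<lambda>y. indicator ?C (y - x) * ennreal ((norm (\<phi> y - \<phi> x))\<^sup>2)" x, symmetric]
      by simp
  qed
  also have "\<dots> = (\<integral>\<^sup>+u. (\<integral>\<^sup>+x. indicator ?C u * ?E u x \<partial>lborel) \<partial>lborel)"
    by (rule lborel_pair.Fubini') measurable
  also have "\<dots> \<le> (\<integral>\<^sup>+u. indicator ?C u * ennreal (real CARD('n) * grad_l2sq \<phi>) \<partial>lborel)"
  proof (intro nn_integral_mono)
    fix u :: "real^'n"
    have "(\<integral>\<^sup>+x. indicator ?C u * ?E u x \<partial>lborel)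
      = indicator ?C u * (\<integral>\<^sup>+x. ?E u x \<partial>lborel)"
      by (subst nn_integral_cmult) auto
    also have "\<dots> \<le> indicator ?C u * ennreal (real CARD('n) * grad_l2sq \<phi>)"
      using translation_estimate[OF C, of u] by (cases "u \<in> ?C") auto
    finally show "(\<integral>\<^sup>+x. indicator ?C u * ?E u x \<partial>lborel)
      \<le> indicator ?C u * ennreal (real CARD('n) * grad_l2sq \<phi>)" .
  qed
  also have "\<dots> = ennreal (2 ^ CARD('n)) * ennreal (real CARD('n) * grad_l2sq \<phi>)"
    by (subst nn_integral_multc) (auto simp: emeasure_cube)
  also have "\<dots> = ennreal (2 ^ CARD('n) * real CARD('n) * grad_l2sq \<phi>)"
    by (subst ennreal_mult'[symmetric]) (auto simp: mult.assoc)
  finally have le: "(\<Sum>w\<in>grid N. I w) \<le> 2 ^ CARD('n) * real CARD('n) * grad_l2sq \<phi>"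
    by (subst (asm) ennreal_le_iff) (auto intro!: mult_nonneg_nonneg grad_l2sq_nonneg)
  have "0 \<le> (\<Sum>w\<in>grid N. I w)" by (intro sum_nonneg Inn)
  then show ?thesis using l2sq le by linarith
qed

lemma Q_hat_iff: "x \<in> Q_hat t \<longleftrightarrow> (\<forall>i. \<bar>x $ i\<bar> < t / 2)"
proof -
  have "- t / 2 < a \<and> a < t / 2 \<longleftrightarrow> \<bar>a\<bar> < t / 2" for a :: real by linarith
  then show ?thesis by (simp add: Q_hat_def)
qed

lemma l2sq_scale:
  fixes \<phi> :: "real^'n \<Rightarrow> real^'n"
  assumes "C0c \<phi>" "c \<noteq> 0"
  shows "l2sq (\<lambda>x. \<phi> (a + c *\<^sub>R x)) = inverse (\<bar>c\<bar> ^ CARD('n)) * l2sq \<phi>"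
  unfolding l2sq_def using integral_affine[OF C0c_integrable[OF C0c_norm_sq[OF assms(1)]] assms(2)] by simp

lemma wl2sq_scale:
  fixes \<phi> :: "real^'n \<Rightarrow> real^'n"
  assumes "C0c \<phi>" "c \<noteq> 0" "W \<in> borel_measurable borel" "\<And>x. 0 \<le> W x \<and> W x \<le> 1"
  shows "wl2sq (\<lambda>x. W (a + c *\<^sub>R x)) (\<lambda>x. \<phi> (a + c *\<^sub>R x)) = inverse (\<bar>c\<bar> ^ CARD('n)) * wl2sq W \<phi>"
proof -
  have "integrable lborel (\<lambda>x. W x * (norm (\<phi> x))\<^sup>2)"
    using weighted_diff(2)[OF C0c_L2[OF assms(1)] C0c_L2[OF assms(1)] zero_less_one assms(3,4)] .
  from integral_affine[OF this assms(2), of a] show ?thesis unfolding wl2sq_def by simp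
qed

lemma grad_l2sq_scale:
  fixes \<phi> :: "real^'n \<Rightarrow> real^'n"
  assumes "C1c \<phi>" "c \<noteq> 0"
  shows "grad_l2sq (\<lambda>x. \<phi> (a + c *\<^sub>R x)) = c\<^sup>2 / \<bar>c\<bar> ^ CARD('n) * grad_l2sq \<phi>"
proof -
  have "grad_l2sq (\<lambda>x. \<phi> (a + c *\<^sub>R x)) = (LBINT x. c\<^sup>2 * (\<Sum>j\<in>UNIV. (norm (pd j \<phi> (a + c *\<^sub>R x)))\<^sup>2))"
    unfolding grad_l2sq_def C1c_affine(2)[OF assms] by (simp add: power_mult_distrib sum_distrib_left)
  also have "\<dots> = c\<^sup>2 * (inverse (\<bar>c\<bar> ^ CARD('n)) * grad_l2sq \<phi>)"
    unfolding grad_l2sq_def using integral_affine[OF grad_l2sq_integrable[OF assms(1)] assms(2), of a]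
    by simp
  finally show ?thesis by (simp add: divide_inverse)
qed

lemma energy_form_scale: "energy_form \<alpha> (\<lambda>j. c *\<^sub>R D j) = c\<^sup>2 * energy_form \<alpha> D"
  unfolding energy_form_def
  by (simp add: power_mult_distrib sum_distrib_left[symmetric] algebra_simps)

lemma energy_integrable: "\<alpha> > 0 \<Longrightarrow> C1c \<phi> \<Longrightarrow> integrable lborel (\<lambda>x. energy_form \<alpha> (\<lambda>j. pd j \<phi> x))"
  by (intro energy_form_integrable C0c_L2 C0c_pd)

lemma energy_scale:
  fixes \<phi> :: "real^'n \<Rightarrow> real^'n"
  assumes "\<alpha> > 0" "C1c \<phi>" "c \<noteq> 0"
  shows "energy \<alpha> (\<lambda>x. \<phi> (a + c *\<^sub>R x)) = c\<^sup>2 / \<bar>c\<bar> ^ CARD('n) * energy \<alpha> \<phi>"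
proof -
  have "energy \<alpha> (\<lambda>x. \<phi> (a + c *\<^sub>R x)) = (LBINT x. c\<^sup>2 * energy_form \<alpha> (\<lambda>j. pd j \<phi> (a + c *\<^sub>R x)))"
    unfolding energy_def C1c_affine(2)[OF assms(2,3)] energy_form_scale ..
  also have "\<dots> = c\<^sup>2 * (inverse (\<bar>c\<bar> ^ CARD('n)) * energy \<alpha> \<phi>)"
    unfolding energy_def using integral_affine[OF energy_integrable[OF assms(1,2)] assms(3), of a] by simp
  finally show ?thesis by (simp add: divide_inverse)
qed

lemma finite_net:
  fixes g :: "'a \<Rightarrow> 'i \<Rightarrow> real"
  assumes "finite I" "\<rho> > 0" "\<And>x i. x \<in> S \<Longrightarrow> i \<in> I \<Longrightarrow> \<bar>g x i\<bar> \<le> B"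
  shows "\<exists>N\<subseteq>S. finite N \<and> (\<forall>x\<in>S. \<exists>y\<in>N. \<forall>i\<in>I. \<bar>g x i - g y i\<bar> \<le> \<rho>)"
proof -
  define key where "key x = restrict (\<lambda>i. \<lfloor>g x i / \<rho>\<rfloor>) I" for x
  have "key ` S \<subseteq> PiE I (\<lambda>_. {\<lfloor>- B / \<rho>\<rfloor>..\<lfloor>B / \<rho>\<rfloor>})"
  proof
    fix f assume "f \<in> key ` S"
    then obtain x where x: "x \<in> S" "f = key x" by blast
    have "\<lfloor>g x i / \<rho>\<rfloor> \<in> {\<lfloor>- B / \<rho>\<rfloor>..\<lfloor>B / \<rho>\<rfloor>}" if "i \<in> I" for i
    proof -
      have "- B \<le> g x i" "g x i \<le> B" using assms(3)[OF x(1) that] by (auto simp: abs_le_iff)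
      then have "- B / \<rho> \<le> g x i / \<rho>" "g x i / \<rho> \<le> B / \<rho>"
        using assms(2) by (auto intro!: divide_right_mono simp del: minus_divide_left[symmetric])
      then show ?thesis using floor_mono by (metis atLeastAtMost_iff)
    qed
    then show "f \<in> PiE I (\<lambda>_. {\<lfloor>- B / \<rho>\<rfloor>..\<lfloor>B / \<rho>\<rfloor>})" unfolding x(2) key_def by auto
  qed
  then have fin: "finite (key ` S)" by (rule finite_subset) (auto intro!: finite_PiE assms)
  then obtain N where N: "N \<subseteq> S" "finite N" "key ` S = key ` N"
    using finite_subset_image[of "key ` S" key S] by auto
  show ?thesis
  proof (intro exI[of _ N] conjI ballI N)
    fix x assume "x \<in> S"
    then obtain y where y: "y \<in> N" "key x = key y" using N(3) by (metis image_iff)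
    show "\<exists>y\<in>N. \<forall>i\<in>I. \<bar>g x i - g y i\<bar> \<le> \<rho>"
    proof (intro bexI[OF _ y(1)] ballI)
      fix i assume i: "i \<in> I"
      then have "\<lfloor>g x i / \<rho>\<rfloor> = \<lfloor>g y i / \<rho>\<rfloor>" using fun_cong[OF y(2), of i] by (simp add: key_def)
      then have "\<bar>g x i / \<rho> - g y i / \<rho>\<bar> \<le> 1" by linarith
      then show "\<bar>g x i - g y i\<bar> \<le> \<rho>" using assms(2) by (simp add: field_simps abs_le_iff)
    qed
  qed
qed

lemma norm_cell_average_le:
  fixes \<phi> :: "real^'n \<Rightarrow> real^'n"
  assumes "C0c \<phi>"
  shows "(norm (LBINT x. indicator (unit_cell w) x *\<^sub>R \<phi> x))\<^sup>2 \<le> l2sq \<phi>"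
proof -
  have m[measurable]: "\<phi> \<in> borel_measurable borel" by (rule C0c_measurable[OF assms])
  obtain B where B: "\<And>x. norm (\<phi> x) \<le> B" using C0c_bounded[OF assms] by blast
  have "prob_space (unif (unit_cell w :: (real^'n) set))"
    by (rule unif_prob[OF unit_cell_measurable emeasure_unit_cell])
  from prob_space.variance_identity(2)[OF this, of \<phi> B] B
  have "(norm (LBINT x. indicator (unit_cell w) x *\<^sub>R \<phi> x))\<^sup>2
    \<le> (LBINT x. indicator (unit_cell w) x *\<^sub>R (norm (\<phi> x))\<^sup>2)"
    by (simp add: integral_unif)
  also have "\<dots> \<le> l2sq \<phi>"
    unfolding l2sq_def using C0c_integrable[OF C0c_norm_sq[OF assms]]
    by (intro integral_mono integrable_mult_indicator) (auto simp: indicator_def)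
  finally show ?thesis .
qed

lemma grad_l2sq_diff_le:
  fixes \<phi> \<psi> :: "real^'n \<Rightarrow> real^'n"
  assumes "C1c \<phi>" "C1c \<psi>" shows "grad_l2sq (\<lambda>x. \<phi> x - \<psi> x) \<le> 2 * grad_l2sq \<phi> + 2 * grad_l2sq \<psi>"
proof -
  have sq: "(norm (a - b))\<^sup>2 \<le> 2 * (norm a)\<^sup>2 + 2 * (norm b)\<^sup>2" for a b :: "real^'n"
  proof -
    have "(norm (a - b))\<^sup>2 + (norm (a + b))\<^sup>2 = 2 * (norm a)\<^sup>2 + 2 * (norm b)\<^sup>2"
      by (simp add: power2_norm_eq_inner inner_diff_left inner_diff_right inner_add_left inner_add_right inner_commute)
    then show ?thesis using zero_le_power2[of "norm (a + b)"] by linarith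
  qed
  have "grad_l2sq (\<lambda>x. \<phi> x - \<psi> x) \<le> (LBINT x. 2 * (\<Sum>j\<in>UNIV. (norm (pd j \<phi> x))\<^sup>2) + 2 * (\<Sum>j\<in>UNIV. (norm (pd j \<psi> x))\<^sup>2))"
    unfolding grad_l2sq_def
  proof (rule integral_mono)
    fix x
    show "(\<Sum>j\<in>UNIV. (norm (pd j (\<lambda>x. \<phi> x - \<psi> x) x))\<^sup>2)
      \<le> 2 * (\<Sum>j\<in>UNIV. (norm (pd j \<phi> x))\<^sup>2) + 2 * (\<Sum>j\<in>UNIV. (norm (pd j \<psi> x))\<^sup>2)"
      unfolding C1c_diff(2)[OF assms] sum_distrib_left sum.distrib[symmetric] by (intro sum_mono sq)
  qed (use grad_l2sq_integrable[OF C1c_diff(1)[OF assms]] grad_l2sq_integrable[OF assms(1)] grad_l2sq_integrable[OF assms(2)] in auto)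
  also have "\<dots> = 2 * grad_l2sq \<phi> + 2 * grad_l2sq \<psi>"
    unfolding grad_l2sq_def using grad_l2sq_integrable[OF assms(1)] grad_l2sq_integrable[OF assms(2)] by simp
  finally show ?thesis .
qed

text \<open>The energy is part of the notion of nearness, so that no semicontinuity of it is needed.\<close>

abbreviation near :: "real \<Rightarrow> real \<Rightarrow> (real^'n \<Rightarrow> real^'n) \<Rightarrow> (real^'n \<Rightarrow> real^'n) \<Rightarrow> bool" where
  "near \<alpha> e \<psi> \<psi>' \<equiv> l2sq (\<lambda>x. \<psi> x - \<psi>' x) \<le> e\<^sup>2 \<and> \<bar>energy \<alpha> \<psi> - energy \<alpha> \<psi>'\<bar> \<le> e"

lemma rellich_net:
  fixes S :: "(real^'n \<Rightarrow> real^'n) set"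
  assumes \<alpha>: "\<alpha> > 0" and e: "e > 0"
    and S: "\<And>\<psi>. \<psi> \<in> S \<Longrightarrow> C1c \<psi> \<and> {x. \<psi> x \<noteq> 0} \<subseteq> Q_hat r \<and> l2sq \<psi> \<le> B \<and> energy \<alpha> \<psi> \<le> B"
  shows "\<exists>N\<subseteq>S. finite N \<and> (\<forall>\<psi>\<in>S. \<exists>\<psi>'\<in>N. near \<alpha> e \<psi> \<psi>')"
proof (cases "S = {}")
  case False
  then have B: "0 \<le> B" using S l2sq_nonneg by (meson all_not_in_conv order_trans)
  define d where "d = real CARD('n)"
  define K where "K = 2 ^ CARD('n) * d * (4 * B) + 1"
  have K: "K > 0" "2 ^ CARD('n) * d * (4 * B) \<le> K" using B by (auto simp: K_def d_def add_nonneg_pos)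
  define s where "s = e / sqrt (2 * K)"
  have s: "s > 0" "s\<^sup>2 * K = e\<^sup>2 / 2" using e K(1) by (auto simp: s_def power_divide)
  obtain N0 :: nat where N0: "r / (2 * s) \<le> real N0" using real_arch_simple by blast
  define \<rho> where "\<rho> = min e (e / sqrt (2 * (s ^ CARD('n) * real (card (grid N0 :: (int^'n) set)) * d)))"
  have cpos: "0 < s ^ CARD('n) * real (card (grid N0 :: (int^'n) set)) * d"
    using s by (simp add: d_def card_grid)
  have \<rho>: "\<rho> > 0" "\<rho> \<le> e" "s ^ CARD('n) * (real (card (grid N0 :: (int^'n) set)) * (d * \<rho>\<^sup>2)) \<le> e\<^sup>2 / 2"
  proof -
    let ?c = "s ^ CARD('n) * real (card (grid N0 :: (int^'n) set)) * d"
    show "\<rho> > 0" "\<rho> \<le> e" using e cpos by (auto simp: \<rho>_def)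
    then have "\<rho>\<^sup>2 \<le> (e / sqrt (2 * ?c))\<^sup>2" by (intro power_mono) (auto simp: \<rho>_def)
    also have "\<dots> = e\<^sup>2 / (2 * ?c)" using cpos by (simp add: power_divide)
    finally have "?c * \<rho>\<^sup>2 \<le> ?c * (e\<^sup>2 / (2 * ?c))" using cpos by (intro mult_left_mono) auto
    also have "\<dots> = e\<^sup>2 / 2"
    proof -
      have "c * (e\<^sup>2 / (2 * c)) = e\<^sup>2 / 2" if "c > 0" for c :: real using that by simp
      then show ?thesis using cpos .
    qed
    finally show "s ^ CARD('n) * (real (card (grid N0 :: (int^'n) set)) * (d * \<rho>\<^sup>2)) \<le> e\<^sup>2 / 2"
      by (simp add: mult.assoc)
  qed
  define sc where "sc \<psi> = (\<lambda>x. \<psi> (s *\<^sub>R x))" for \<psi> :: "real^'n \<Rightarrow> real^'n"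
  define av where "av \<psi> w = (LBINT x. indicator (unit_cell w) x *\<^sub>R sc \<psi> x)" for \<psi> w
  define g where "g \<psi> = case_option (energy \<alpha> \<psi>) (\<lambda>(w, k). av \<psi> w $ k)" for \<psi>
  define I where "I = insert None (Some ` ((grid N0 :: (int^'n) set) \<times> (UNIV :: 'n set)))"
  have Csc: "C1c (sc \<psi>)" if "C1c \<psi>" for \<psi>
    unfolding sc_def using C1c_affine(1)[OF that, of s 0] s by simp
  have nsc: "l2sq (sc \<psi>) = inverse (s ^ CARD('n)) * l2sq \<psi>" if "C1c \<psi>" for \<psi>
    unfolding sc_def using l2sq_scale[OF C1c_C0c[OF that], of s 0] s by simp
  have gsc: "grad_l2sq (sc \<psi>) = s\<^sup>2 / s ^ CARD('n) * grad_l2sq \<psi>" if "C1c \<psi>" for \<psi>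
    unfolding sc_def using grad_l2sq_scale[OF that, of s 0] s by simp
  have bound: "\<bar>g \<psi> i\<bar> \<le> B + (1 + inverse (s ^ CARD('n)) * B)" if "\<psi> \<in> S" "i \<in> I" for \<psi> i
  proof (cases i)
    case None
    have "\<bar>energy \<alpha> \<psi>\<bar> \<le> B" using S[OF that(1)] energy_nonneg[OF \<alpha>, of \<psi>] by simp
    moreover have "0 \<le> 1 + inverse (s ^ CARD('n)) * B" using B s by simp
    ultimately show ?thesis using None by (simp add: g_def)
  next
    case (Some p)
    then obtain w k where i: "i = Some (w, k)" by (cases p) auto
    have "(norm (av \<psi> w))\<^sup>2 \<le> l2sq (sc \<psi>)"
      unfolding av_def by (intro norm_cell_average_le C1c_C0c Csc) (use S[OF that(1)] in simp)
    also have "\<dots> = inverse (s ^ CARD('n)) * l2sq \<psi>" by (rule nsc) (use S[OF that(1)] in simp)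
    also have "\<dots> \<le> inverse (s ^ CARD('n)) * B" using S[OF that(1)] s by (intro mult_left_mono) auto
    finally have "(norm (av \<psi> w))\<^sup>2 \<le> inverse (s ^ CARD('n)) * B" .
    moreover have "norm (av \<psi> w) \<le> 1 + (norm (av \<psi> w))\<^sup>2"
      using zero_le_power2[of "norm (av \<psi> w) - 1/2"] by (simp add: power2_eq_square algebra_simps)
    moreover have "\<bar>av \<psi> w $ k\<bar> \<le> norm (av \<psi> w)" by (rule component_le_norm_cart)
    ultimately show ?thesis using B unfolding i g_def by simp
  qed
  have "finite I" by (simp add: I_def finite_grid)
  then have "\<exists>N\<subseteq>S. finite N \<and> (\<forall>\<psi>\<in>S. \<exists>\<psi>'\<in>N. \<forall>i\<in>I. \<bar>g \<psi> i - g \<psi>' i\<bar> \<le> \<rho>)"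
    by (rule finite_net[OF _ \<rho>(1) bound])
  then obtain N where N: "N \<subseteq> S" "finite N" "\<forall>\<psi>\<in>S. \<exists>\<psi>'\<in>N. \<forall>i\<in>I. \<bar>g \<psi> i - g \<psi>' i\<bar> \<le> \<rho>"
    by (elim exE conjE)
  show ?thesis
  proof (intro exI[of _ N] conjI ballI N)
    fix \<psi> assume p: "\<psi> \<in> S"
    then obtain \<psi>' where p': "\<psi>' \<in> N" and close: "\<And>i. i \<in> I \<Longrightarrow> \<bar>g \<psi> i - g \<psi>' i\<bar> \<le> \<rho>" using bspec[OF N(3) p] by (elim bexE) simp
    note Sp = S[OF p] and Sp' = S[OF subsetD[OF N(1) p']]
    have C: "C1c \<psi>" "C1c \<psi>'" using Sp Sp' by auto
    let ?\<chi> = "\<lambda>x. \<psi> x - \<psi>' x"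
    have C\<chi>: "C1c ?\<chi>" by (rule C1c_diff(1)[OF C])
    have Kcl: "\<bar>energy \<alpha> \<psi> - energy \<alpha> \<psi>'\<bar> \<le> e" using close[of None] \<rho>(2) by (simp add: g_def I_def)
    have av\<chi>: "av ?\<chi> w = av \<psi> w - av \<psi>' w" for w
    proof -
      have i: "integrable lborel (\<lambda>x. indicator (unit_cell w) x *\<^sub>R sc \<theta> x)" if "C1c \<theta>" for \<theta>
        by (intro integrable_mult_indicator C0c_integrable C1c_C0c Csc that) simp
      show ?thesis unfolding av_def
        by (subst Bochner_Integration.integral_diff[symmetric, OF i[OF C(1)] i[OF C(2)]])
           (simp add: sc_def scaleR_diff_right)
    qed
    have avs: "(norm (av ?\<chi> w))\<^sup>2 \<le> d * \<rho>\<^sup>2" if "w \<in> grid N0" for w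
    proof -
      have "(norm (av ?\<chi> w))\<^sup>2 = (\<Sum>k\<in>UNIV. (av ?\<chi> w $ k)\<^sup>2)" by (rule norm_sq_vec)
      also have "\<dots> \<le> (\<Sum>k\<in>(UNIV::'n set). \<rho>\<^sup>2)"
      proof (rule sum_mono)
        fix k
        have "\<bar>av ?\<chi> w $ k\<bar> \<le> \<bar>\<rho>\<bar>" using close[of "Some (w, k)"] that \<rho>(1) unfolding av\<chi> by (simp add: g_def I_def)
        then show "(av ?\<chi> w $ k)\<^sup>2 \<le> \<rho>\<^sup>2" by (simp add: abs_le_square_iff)
      qed
      finally show ?thesis by (simp add: d_def)
    qed
    have supp: "cell_of x \<in> grid N0" if "sc ?\<chi> x \<noteq> 0" for x
    proof (rule cell_of_in_grid)
      fix i
      have "\<psi> (s *\<^sub>R x) \<noteq> 0 \<or> \<psi>' (s *\<^sub>R x) \<noteq> 0" using that unfolding sc_def by auto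
      then have "s *\<^sub>R x \<in> Q_hat r" using Sp Sp' by blast
      then have "\<bar>s * x $ i\<bar> \<le> r / 2" by (auto simp: Q_hat_iff less_imp_le)
      then have "s * \<bar>x $ i\<bar> \<le> r / 2" using s by (simp add: abs_mult)
      then have "\<bar>x $ i\<bar> \<le> r / (2 * s)" using s by (simp add: field_simps)
      then show "\<bar>x $ i\<bar> \<le> real N0" using N0 by linarith
    qed
    have "l2sq ?\<chi> = s ^ CARD('n) * l2sq (sc ?\<chi>)" using nsc[OF C\<chi>] s by simp
    also have "\<dots> \<le> s ^ CARD('n) * ((\<Sum>w\<in>grid N0. (norm (av ?\<chi> w))\<^sup>2) + 2 ^ CARD('n) * d * grad_l2sq (sc ?\<chi>))"
      using poincare_cells[OF Csc[OF C\<chi>] supp] s unfolding av_def d_def by (intro mult_left_mono) auto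
    also have "\<dots> = s ^ CARD('n) * (\<Sum>w\<in>grid N0. (norm (av ?\<chi> w))\<^sup>2) + s\<^sup>2 * (2 ^ CARD('n) * d * grad_l2sq ?\<chi>)"
      unfolding gsc[OF C\<chi>] using s by (simp add: field_simps)
    also have "s ^ CARD('n) * (\<Sum>w\<in>grid N0. (norm (av ?\<chi> w))\<^sup>2) \<le> s ^ CARD('n) * (\<Sum>w\<in>(grid N0 :: (int^'n) set). d * \<rho>\<^sup>2)"
      using s by (intro mult_left_mono sum_mono avs) auto
    also have "\<dots> \<le> e\<^sup>2 / 2" using \<rho>(3) by simp
    also have "s\<^sup>2 * (2 ^ CARD('n) * d * grad_l2sq ?\<chi>) \<le> s\<^sup>2 * (2 ^ CARD('n) * d * (4 * B))"
    proof -
      have "grad_l2sq ?\<chi> \<le> 4 * B"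
        using grad_l2sq_diff_le[OF C] grad_l2sq_le_energy[OF \<alpha> C(1)] grad_l2sq_le_energy[OF \<alpha> C(2)] Sp Sp' by linarith
      then show ?thesis by (intro mult_left_mono) (auto simp: d_def)
    qed
    also have "\<dots> \<le> s\<^sup>2 * K" by (intro mult_left_mono K) auto
    also have "\<dots> = e\<^sup>2 / 2" by (rule s)
    finally have "l2sq ?\<chi> \<le> e\<^sup>2" by simp
    then show "\<exists>\<psi>'\<in>N. near \<alpha> e \<psi> \<psi>'"
      using p' Kcl by blast
  qed
qed auto

lemma l2sq_commute: "l2sq (\<lambda>x. f x - g x) = l2sq (\<lambda>x. g x - f x)"
  by (simp add: l2sq_def norm_minus_commute)

lemma wl2sq_close:
  fixes f g :: "real^'n \<Rightarrow> real^'n"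
  assumes "f \<in> L2" "g \<in> L2" and e: "0 < e" "e \<le> 1" and c: "l2sq (\<lambda>x. f x - g x) \<le> e\<^sup>2"
    and "W \<in> borel_measurable borel" "\<And>x. 0 \<le> W x \<and> W x \<le> 1"
  shows "\<bar>wl2sq W f - wl2sq W g\<bar> \<le> e * (2 + l2sq g)"
proof -
  have "\<bar>wl2sq W f - wl2sq W g\<bar> \<le> (1 + 1/e) * l2sq (\<lambda>x. f x - g x) + e * l2sq g"
    by (rule weighted_diff(1)) fact+
  also have "\<dots> \<le> (1 + 1/e) * e\<^sup>2 + e * l2sq g"
    using e c by (intro add_right_mono mult_left_mono) auto
  also have "(1 + 1/e) * e\<^sup>2 = e * e + e" using e by (simp add: field_simps power2_eq_square)
  also have "e * e + e + e * l2sq g \<le> e * (2 + l2sq g)"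
    using e mult_left_le[of e e] by (simp add: algebra_simps)
  finally show ?thesis by simp
qed

lemma rayleigh_stable:
  fixes \<psi> :: "real^'n \<Rightarrow> real^'n"
  assumes \<psi>: "\<psi> \<in> L2" "0 < l2sq \<psi>" and b: "0 \<le> b"
    and W: "W \<in> borel_measurable borel" "\<And>x. 0 \<le> W x \<and> W x \<le> 1"
    and less: "energy \<alpha> \<psi> + b * wl2sq W \<psi> < c * l2sq \<psi>"
  shows "\<exists>e>0. \<forall>\<psi>'\<in>L2. l2sq (\<lambda>x. \<psi> x - \<psi>' x) \<le> e\<^sup>2 \<longrightarrow> \<bar>energy \<alpha> \<psi> - energy \<alpha> \<psi>'\<bar> \<le> e \<longrightarrow>
    0 < l2sq \<psi>' \<and> energy \<alpha> \<psi>' + b * wl2sq W \<psi>' < c * l2sq \<psi>'"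
proof -
  define P where "P = l2sq \<psi>"
  define g where "g = c * P - energy \<alpha> \<psi> - b * wl2sq W \<psi>"
  define m where "m = 1 + (b + \<bar>c\<bar>) * (2 + P)"
  have pos: "P > 0" "g > 0" using \<psi>(2) less by (auto simp: P_def g_def)
  have pos: "P > 0" "g > 0" "m > 0" using pos b
    unfolding m_def by (auto intro!: add_pos_nonneg mult_nonneg_nonneg)
  have half: "p / (2 * q) * q = p / 2" if "q > 0" for p q :: real using that by simp
  define e where "e = min 1 (min (P / (2 * (2 + P))) (g / (2 * m)))"
  have e: "e > 0" "e \<le> 1" "e \<le> P / (2 * (2 + P))" "e \<le> g / (2 * m)"
    using pos by (auto simp: e_def)
  have e2: "e * (2 + P) < P" "e * m < g"
  proof -
    have "e * (2 + P) \<le> P / (2 * (2 + P)) * (2 + P)" using e pos by (intro mult_right_mono) auto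
    also have "\<dots> = P / 2" by (rule half) (use pos in simp)
    finally show "e * (2 + P) < P" using pos by simp
    have "e * m \<le> g / (2 * m) * m" using e pos by (intro mult_right_mono) auto
    also have "\<dots> = g / 2" using pos by simp
    finally show "e * m < g" using pos by simp
  qed
  show ?thesis
  proof (intro exI[of _ e] conjI ballI impI)
    fix \<psi>' :: "real^'n \<Rightarrow> real^'n"
    assume L: "\<psi>' \<in> L2" and n: "l2sq (\<lambda>x. \<psi> x - \<psi>' x) \<le> e\<^sup>2" and k: "\<bar>energy \<alpha> \<psi> - energy \<alpha> \<psi>'\<bar> \<le> e"
    note n' = n[unfolded l2sq_commute[of \<psi>]]
    have w: "\<bar>wl2sq W \<psi>' - wl2sq W \<psi>\<bar> \<le> e * (2 + P)"
      unfolding P_def by (rule wl2sq_close[OF L \<psi>(1) e(1,2) n' W])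
    have p: "\<bar>l2sq \<psi>' - P\<bar> \<le> e * (2 + P)"
      using wl2sq_close[OF L \<psi>(1) e(1,2) n', of "\<lambda>_. 1"] by (simp add: wl2sq_1 P_def)
    show "0 < l2sq \<psi>'" using p e2(1) by linarith
    have "b * (wl2sq W \<psi>' - wl2sq W \<psi>) \<le> b * (e * (2 + P))"
      using w b by (intro mult_left_mono) auto
    moreover have "c * (P - l2sq \<psi>') \<le> \<bar>c\<bar> * (e * (2 + P))"
    proof -
      have "c * (P - l2sq \<psi>') \<le> \<bar>c\<bar> * \<bar>P - l2sq \<psi>'\<bar>" by (metis abs_ge_self abs_mult)
      also have "\<dots> \<le> \<bar>c\<bar> * (e * (2 + P))" using p by (intro mult_left_mono) auto
      finally show ?thesis .
    qed
    moreover have "e + b * (e * (2 + P)) + \<bar>c\<bar> * (e * (2 + P)) = e * m" by (simp add: m_def algebra_simps)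
    ultimately show "energy \<alpha> \<psi>' + b * wl2sq W \<psi>' < c * l2sq \<psi>'"
      using k e2(2) unfolding g_def right_diff_distrib by linarith
  qed (rule e(1))
qed

lemma Q_hat_test_functions:
  "\<psi> \<in> test_functions (Q_hat t) \<Longrightarrow> {x. \<psi> x \<noteq> 0} \<subseteq> Q_hat t"
  using closure_subset by (force simp: test_functions_def)

lemma countable_test_functions:
  assumes \<alpha>: "\<alpha> > 0"
  shows "\<exists>D. countable D \<and> D \<subseteq> test_functions (Q_hat t) \<and> (\<forall>\<psi>\<in>test_functions (Q_hat t). \<forall>e>0. \<exists>\<psi>'\<in>D.
    near \<alpha> e \<psi> (\<psi>' :: real^'n \<Rightarrow> real^'n))"
proof -
  define S where "S n = {\<psi> \<in> test_functions (Q_hat t) :: (real^'n \<Rightarrow> real^'n) set. l2sq \<psi> \<le> real n \<and> energy \<alpha> \<psi> \<le> real n}" for n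
  define Q where "Q n m N \<longleftrightarrow> N \<subseteq> S n \<and> finite N \<and> (\<forall>\<psi>\<in>S n. \<exists>\<psi>'\<in>N.
    near \<alpha> (1 / real (Suc m)) \<psi> \<psi>')" for n m N
  have "\<exists>N. Q n m N" for n m
    unfolding Q_def by (rule rellich_net[OF \<alpha>, where r=t and B="real n"])
       (auto simp: S_def intro: test_functions_C1c dest: subsetD[OF Q_hat_test_functions])
  then have Q: "Q n m (SOME N. Q n m N)" for n m by (rule someI_ex)
  define N where "N n m = (SOME N. Q n m N)" for n m
  have N: "N n m \<subseteq> S n" "finite (N n m)"
    "\<psi> \<in> S n \<Longrightarrow> \<exists>\<psi>'\<in>N n m. near \<alpha> (1 / real (Suc m)) \<psi> \<psi>'" for n m \<psi>
    using Q[of n m] unfolding N_def[symmetric] unfolding Q_def by blast+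
  show ?thesis
  proof (intro exI[of _ "\<Union>n m. N n m"] conjI ballI allI impI)
    show "countable (\<Union>n m. N n m)" by (auto intro: countable_finite[OF N(2)])
    show "(\<Union>n m. N n m) \<subseteq> test_functions (Q_hat t)" using N(1) by (force simp: S_def)
    fix \<psi> :: "real^'n \<Rightarrow> real^'n" and e :: real
    assume p: "\<psi> \<in> test_functions (Q_hat t)" and e: "e > 0"
    obtain n :: nat where "max (l2sq \<psi>) (energy \<alpha> \<psi>) \<le> real n" using real_arch_simple by blast
    then have "\<psi> \<in> S n" using p by (simp add: S_def)
    moreover obtain m where m: "1 / real (Suc m) < e" using nat_approx_posE[OF e] by metis
    ultimately obtain \<psi>' where p': "\<psi>' \<in> N n m" "l2sq (\<lambda>x. \<psi> x - \<psi>' x) \<le> (1 / real (Suc m))\<^sup>2" "\<bar>energy \<alpha> \<psi> - energy \<alpha> \<psi>'\<bar> \<le> 1 / real (Suc m)"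
      using N(3)[of \<psi> n m] by blast
    have "(1 / real (Suc m))\<^sup>2 \<le> e\<^sup>2" using m by (intro power_mono) auto
    then have "near \<alpha> e \<psi> \<psi>'" using p' m by linarith
    then show "\<exists>\<psi>'\<in>\<Union>n m. N n m. near \<alpha> e \<psi> \<psi>'"
      using p'(1) by blast
  qed
qed

section \<open>Measurability of the principal eigenvalue\<close>

locale random_field =
  fixes M :: "'w measure" and V :: "real^'n \<Rightarrow> 'w \<Rightarrow> real"
  assumes V_meas: "(\<lambda>(x, \<omega>). V x \<omega>) \<in> borel_measurable (borel \<Otimes>\<^sub>M M)"
    and V_01: "\<And>x \<omega>. \<omega> \<in> space M \<Longrightarrow> V x \<omega> \<in> {0, 1}"
begin

lemma V_section: "\<omega> \<in> space M \<Longrightarrow> (\<lambda>x. V x \<omega>) \<in> borel_measurable borel"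
  using measurable_compose[OF measurable_Pair2' V_meas] by fastforce

lemma V_bounds: "\<omega> \<in> space M \<Longrightarrow> 0 \<le> V x \<omega> \<and> V x \<omega> \<le> 1"
  using V_01[of \<omega> x] by auto

lemma wl2sq_measurable:
  assumes "C0c \<psi>" shows "(\<lambda>\<omega>. wl2sq (\<lambda>x. V (a + c *\<^sub>R x) \<omega>) \<psi>) \<in> borel_measurable M"
proof -
  have m[measurable]: "\<psi> \<in> borel_measurable borel" by (rule C0c_measurable[OF assms])
  have "(\<lambda>p. (a + c *\<^sub>R snd p, fst p)) \<in> measurable (M \<Otimes>\<^sub>M lborel) (borel \<Otimes>\<^sub>M M)" by measurable
  from measurable_compose[OF this V_meas]
  have [measurable]: "(\<lambda>(\<omega>, x). V (a + c *\<^sub>R x) \<omega>) \<in> borel_measurable (M \<Otimes>\<^sub>M lborel)"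
    by (simp add: case_prod_beta)
  show ?thesis unfolding wl2sq_def by measurable
qed

text \<open>
  The measure of a non-measurable set is \<open>0\<close> in HOL, so the limit is false unless the event is
  measurable; this is why the uncountable infimum is reduced to a countable one.
\<close>

lemma C_frak_le_sets:
  assumes \<alpha>: "\<alpha> > 0" and \<beta>: "\<beta> \<ge> 0"
  shows "{\<omega> \<in> space M. C_frak (\<lambda>x. V x \<omega>) \<alpha> \<beta> t \<le> ereal c} \<in> sets M"
proof -
  let ?b = "ln t powr (- 2 / real CARD('n)) * \<beta>"
  have b: "0 \<le> ?b" using \<beta> by simp
  obtain D :: "(real^'n \<Rightarrow> real^'n) set" where D: "countable D" "D \<subseteq> test_functions (Q_hat t)"
    and dense: "\<forall>\<psi>\<in>test_functions (Q_hat t). \<forall>e>0. \<exists>\<psi>'\<in>D. near \<alpha> e \<psi> \<psi>'"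
    using countable_test_functions[OF \<alpha>, of t] by (elim exE conjE)
  have LD: "\<psi> \<in> test_functions (Q_hat t) \<Longrightarrow> \<psi> \<in> L2" for \<psi> :: "real^'n \<Rightarrow> real^'n"
    by (intro C0c_L2 C1c_C0c test_functions_C1c)
  have less: "{\<omega> \<in> space M. C_frak (\<lambda>x. V x \<omega>) \<alpha> \<beta> t < ereal c} =
    (\<Union>\<psi>\<in>{\<psi>\<in>D. 0 < l2sq \<psi>}. {\<omega> \<in> space M. energy \<alpha> \<psi> + ?b * wl2sq (\<lambda>x. V (0 + 1 *\<^sub>R x) \<omega>) \<psi> < c * l2sq \<psi>})" for c
  proof -
    have "C_frak (\<lambda>x. V x \<omega>) \<alpha> \<beta> t < ereal c \<longleftrightarrow>
      (\<exists>\<psi>\<in>D. 0 < l2sq \<psi> \<and> energy \<alpha> \<psi> + ?b * wl2sq (\<lambda>x. V x \<omega>) \<psi> < c * l2sq \<psi>)" if w: "\<omega> \<in> space M" for \<omega>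
      unfolding C_frak_less_iff[OF \<alpha> V_section[OF w] V_bounds[OF w]]
    proof
      assume "\<exists>\<psi>\<in>test_functions (Q_hat t). 0 < l2sq \<psi> \<and> energy \<alpha> \<psi> + ?b * wl2sq (\<lambda>x. V x \<omega>) \<psi> < c * l2sq \<psi>"
      then obtain \<psi> where p: "\<psi> \<in> test_functions (Q_hat t)" "0 < l2sq \<psi>" "energy \<alpha> \<psi> + ?b * wl2sq (\<lambda>x. V x \<omega>) \<psi> < c * l2sq \<psi>"
        by blast
      obtain e where e: "e > 0" "\<forall>\<psi>'\<in>L2. l2sq (\<lambda>x. \<psi> x - \<psi>' x) \<le> e\<^sup>2 \<longrightarrow> \<bar>energy \<alpha> \<psi> - energy \<alpha> \<psi>'\<bar> \<le> e \<longrightarrow>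
        0 < l2sq \<psi>' \<and> energy \<alpha> \<psi>' + ?b * wl2sq (\<lambda>x. V x \<omega>) \<psi>' < c * l2sq \<psi>'"
        using rayleigh_stable[OF LD[OF p(1)] p(2) b V_section[OF w] V_bounds[OF w] p(3)] by blast
      obtain \<psi>' where p': "\<psi>' \<in> D" "l2sq (\<lambda>x. \<psi> x - \<psi>' x) \<le> e\<^sup>2" "\<bar>energy \<alpha> \<psi> - energy \<alpha> \<psi>'\<bar> \<le> e"
        using dense[rule_format, OF p(1) e(1)] by blast
      have "\<psi>' \<in> L2" using LD p'(1) D(2) by blast
      then show "\<exists>\<psi>\<in>D. 0 < l2sq \<psi> \<and> energy \<alpha> \<psi> + ?b * wl2sq (\<lambda>x. V x \<omega>) \<psi> < c * l2sq \<psi>"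
        using e(2) p' by blast
    qed (use D(2) in blast)
    then show ?thesis by auto
  qed
  have sets: "{\<omega> \<in> space M. C_frak (\<lambda>x. V x \<omega>) \<alpha> \<beta> t < ereal c} \<in> sets M" for c
    unfolding less
  proof (intro sets.countable_UN'')
    show "countable {\<psi> \<in> D. 0 < l2sq \<psi>}" using D(1) by (rule countable_subset[rotated]) auto
    fix \<psi> assume "\<psi> \<in> {\<psi> \<in> D. 0 < l2sq \<psi>}"
    then have "C0c \<psi>" using D(2) test_functions_C1c C1c_C0c by blast
    from wl2sq_measurable[OF this, of 0 1]
    have [measurable]: "(\<lambda>\<omega>. wl2sq (\<lambda>x. V (0 + 1 *\<^sub>R x) \<omega>) \<psi>) \<in> borel_measurable M" .
    show "{\<omega> \<in> space M. energy \<alpha> \<psi> + ?b * wl2sq (\<lambda>x. V (0 + 1 *\<^sub>R x) \<omega>) \<psi> < c * l2sq \<psi>} \<in> sets M"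
      by measurable
  qed
  have "{\<omega> \<in> space M. C_frak (\<lambda>x. V x \<omega>) \<alpha> \<beta> t \<le> ereal c}
    = (\<Inter>k. {\<omega> \<in> space M. C_frak (\<lambda>x. V x \<omega>) \<alpha> \<beta> t < ereal (c + 1 / real (Suc k))})"
  proof -
    have "y \<le> ereal c \<longleftrightarrow> (\<forall>k. y < ereal (c + 1 / real (Suc k)))" for y
    proof
      assume "y \<le> ereal c"
      then show "\<forall>k. y < ereal (c + 1 / real (Suc k))" by (auto intro: le_less_trans)
    next
      assume a: "\<forall>k. y < ereal (c + 1 / real (Suc k))"
      have "(\<lambda>k. c + 1 / real (Suc k)) \<longlonglongrightarrow> c + 0" by (intro tendsto_intros LIMSEQ_Suc lim_1_over_n)
      then have "(\<lambda>k. ereal (c + 1 / real (Suc k))) \<longlonglongrightarrow> ereal c" by simp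
      then show "y \<le> ereal c" by (rule LIMSEQ_le_const) (use a in \<open>auto intro: less_imp_le\<close>)
    qed
    then show ?thesis by auto
  qed
  also have "\<dots> \<in> sets M" using sets by (intro sets.countable_INT) auto
  finally show ?thesis .
qed

end

section \<open>Localization\<close>

lemma convolution_integral:
  fixes f g :: "real^'n \<Rightarrow> real"
  assumes f: "C0c f" and g: "integrable lborel g"
  shows "integrable lborel (\<lambda>x. f (x - y) * g x)"
    and "integrable lborel (\<lambda>y. LBINT x. f (x - y) * g x)"
    and "(LBINT y. (LBINT x. f (x - y) * g x)) = (LBINT x. f x) * (LBINT x. g x)"
proof -
  have fm[measurable]: "f \<in> borel_measurable borel" by (rule C0c_measurable[OF f])
  have gm[measurable]: "g \<in> borel_measurable borel" using g by auto
  have fi: "integrable lborel f" by (rule C0c_integrable[OF f])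
  obtain B where B: "\<And>x. norm (f x) \<le> B" using C0c_bounded[OF f] by blast
  show "integrable lborel (\<lambda>x. f (x - y) * g x)"
  proof (rule Bochner_Integration.integrable_bound)
    show "integrable lborel (\<lambda>x. B * g x)" using g by simp
    have "B \<ge> 0" using B[of 0] norm_ge_zero[of "f 0"] by linarith
    then show "AE x in lborel. norm (f (x - y) * g x) \<le> norm (B * g x)"
      using B by (intro AE_I2) (simp add: abs_mult mult_right_mono)
  qed auto
  have refl: "has_bochner_integral lborel (\<lambda>y. h (x - y)) (LBINT x. h x)" if "integrable lborel h" for x and h :: "real^'n \<Rightarrow> real"
    using has_bochner_integral_affine[OF that, of "-1" x] by simp
  note ri = refl[THEN has_bochner_integral_integral_eq] refl[THEN integrable.intros]
  have int: "integrable (lborel \<Otimes>\<^sub>M lborel) (\<lambda>(x, y). f (x - y) * g x)"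
  proof (rule lborel_pair.Fubini_integrable)
    show "(\<lambda>(x, y). f (x - y) * g x) \<in> borel_measurable (lborel \<Otimes>\<^sub>M lborel)" by measurable
    have "(LBINT y. norm (case (x, y) of (x, y) \<Rightarrow> f (x - y) * g x)) = (LBINT x. \<bar>f x\<bar>) * \<bar>g x\<bar>" for x
      using ri(1)[OF integrable_abs[OF fi], of x] by (simp add: abs_mult)
    then show "integrable lborel (\<lambda>x. LBINT y. norm (case (x, y) of (x, y) \<Rightarrow> f (x - y) * g x))"
      using g by simp
    show "AE x in lborel. integrable lborel (\<lambda>y. case (x, y) of (x, y) \<Rightarrow> f (x - y) * g x)"
      using ri(2)[OF fi] by simp
  qed
  show "integrable lborel (\<lambda>y. LBINT x. f (x - y) * g x)"
    using lborel_pair.integrable_snd[OF int] by simp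
  have "(LBINT y. (LBINT x. f (x - y) * g x)) = (LBINT x. (LBINT y. f (x - y) * g x))"
    by (rule lborel_pair.Fubini_integral[OF int])
  also have "\<dots> = (LBINT x. (LBINT x. f x) * g x)"
    using ri(1)[OF fi] by simp
  finally show "(LBINT y. (LBINT x. f (x - y) * g x)) = (LBINT x. f x) * (LBINT x. g x)"
    by simp
qed

lemma energy_form_product_le:
  fixes D :: "'n \<Rightarrow> real^'n" and v :: "real^'n"
  assumes \<alpha>: "\<alpha> > 0"
  shows "energy_form \<alpha> (\<lambda>j. b j *\<^sub>R v + s *\<^sub>R D j) \<le> s\<^sup>2 * energy_form \<alpha> D
    + (\<Sum>j\<in>UNIV. (s * b j) * (2 * ((\<Sum>k\<in>UNIV. D j $ k * v $ k) + inverse \<alpha> * (\<Sum>i\<in>UNIV. D i $ i) * v $ j)))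
    + (1 + inverse \<alpha>) * (\<Sum>j\<in>UNIV. (b j)\<^sup>2) * (norm v)\<^sup>2"
proof -
  let ?tr = "\<Sum>i\<in>UNIV. D i $ i" and ?bv = "\<Sum>j\<in>UNIV. b j * v $ j"
  have 1: "(\<Sum>j\<in>UNIV. \<Sum>k\<in>UNIV. ((b j *\<^sub>R v + s *\<^sub>R D j) $ k)\<^sup>2)
    = s\<^sup>2 * (\<Sum>j\<in>UNIV. \<Sum>k\<in>UNIV. (D j $ k)\<^sup>2) + (\<Sum>j\<in>UNIV. (s * b j) * (2 * (\<Sum>k\<in>UNIV. D j $ k * v $ k)))
      + (\<Sum>j\<in>UNIV. (b j)\<^sup>2) * (norm v)\<^sup>2"
  proof -
    have "((b j *\<^sub>R v + s *\<^sub>R D j) $ k)\<^sup>2 = s\<^sup>2 * (D j $ k)\<^sup>2 + (s * b j) * (2 * (D j $ k * v $ k)) + (b j)\<^sup>2 * (v $ k)\<^sup>2" for j k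
      by (simp add: power2_eq_square algebra_simps)
    then show ?thesis
      by (simp add: norm_sq_vec sum.distrib sum_product) (simp add: sum_distrib_left)
  qed
  have 2: "(\<Sum>j\<in>UNIV. (b j *\<^sub>R v + s *\<^sub>R D j) $ j)\<^sup>2 = s\<^sup>2 * ?tr\<^sup>2 + 2 * s * ?bv * ?tr + ?bv\<^sup>2"
  proof -
    have "(\<Sum>j\<in>UNIV. (b j *\<^sub>R v + s *\<^sub>R D j) $ j) = ?bv + s * ?tr"
      by (simp add: sum.distrib sum_distrib_left)
    then show ?thesis by (simp add: power2_eq_square algebra_simps)
  qed
  have 3: "?bv\<^sup>2 \<le> (\<Sum>j\<in>UNIV. (b j)\<^sup>2) * (norm v)\<^sup>2"
    unfolding norm_sq_vec by (rule Cauchy_Schwarz_ineq_sum)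
  have 4: "(\<Sum>j\<in>UNIV. (s * b j) * (2 * ((\<Sum>k\<in>UNIV. D j $ k * v $ k) + inverse \<alpha> * ?tr * v $ j)))
    = (\<Sum>j\<in>UNIV. (s * b j) * (2 * (\<Sum>k\<in>UNIV. D j $ k * v $ k))) + inverse \<alpha> * (2 * s * ?bv * ?tr)"
  proof -
    have "(s * b j) * (2 * ((\<Sum>k\<in>UNIV. D j $ k * v $ k) + inverse \<alpha> * ?tr * v $ j))
      = (s * b j) * (2 * (\<Sum>k\<in>UNIV. D j $ k * v $ k)) + (inverse \<alpha> * 2 * s * ?tr) * (b j * v $ j)" for j
      by (simp add: algebra_simps)
    then have "(\<Sum>j\<in>UNIV. (s * b j) * (2 * ((\<Sum>k\<in>UNIV. D j $ k * v $ k) + inverse \<alpha> * ?tr * v $ j)))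
      = (\<Sum>j\<in>UNIV. (s * b j) * (2 * (\<Sum>k\<in>UNIV. D j $ k * v $ k))) + (inverse \<alpha> * 2 * s * ?tr) * ?bv"
      by (simp only: sum.distrib sum_distrib_left[symmetric])
    moreover have "(inverse \<alpha> * 2 * s * ?tr) * ?bv = inverse \<alpha> * (2 * s * ?bv * ?tr)" by (simp only: mult_ac)
    ultimately show ?thesis by (rule trans[OF _ arg_cong2[where f="(+)", OF refl]])
  qed
  have "inverse \<alpha> * ?bv\<^sup>2 \<le> inverse \<alpha> * ((\<Sum>j\<in>UNIV. (b j)\<^sup>2) * (norm v)\<^sup>2)"
    using 3 \<alpha> by (intro mult_left_mono) auto
  then show ?thesis unfolding energy_form_def 1 2 4 by (simp add: algebra_simps)
qed

text \<open>
  Averaging over \<open>y\<close> replaces a partition of unity: the cross terms carry the factor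
  \<open>\<eta> (x - y) * pd j \<eta> (x - y)\<close>, half of a derivative, which integrates to \<open>0\<close>.
\<close>

lemma ims_localization:
  fixes \<phi> :: "real^'n \<Rightarrow> real^'n" and \<eta> :: "real^'n \<Rightarrow> real"
  assumes \<alpha>: "\<alpha> > 0" and \<eta>: "C1c \<eta>" "(LBINT x. (\<eta> x)\<^sup>2) = 1"
    and \<phi>: "C1c \<phi>" and W: "W \<in> borel_measurable borel" "\<And>x. 0 \<le> W x \<and> W x \<le> 1"
    and less: "energy \<alpha> \<phi> + b * wl2sq W \<phi> + (1 + inverse \<alpha>) * (LBINT x. (\<Sum>j\<in>UNIV. (pd j \<eta> x)\<^sup>2)) * l2sq \<phi> < c * l2sq \<phi>"
  shows "\<exists>y. C1c (\<lambda>x. \<eta> (x - y) *\<^sub>R \<phi> x) \<and>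
    energy \<alpha> (\<lambda>x. \<eta> (x - y) *\<^sub>R \<phi> x) + b * wl2sq W (\<lambda>x. \<eta> (x - y) *\<^sub>R \<phi> x) < c * l2sq (\<lambda>x. \<eta> (x - y) *\<^sub>R \<phi> x)"
proof -
  let ?g = "\<lambda>y x. \<eta> (x - y) *\<^sub>R \<phi> x"
  have \<eta>y: "C1c (\<lambda>x. \<eta> (x - y))" "pd j (\<lambda>x. \<eta> (x - y)) x = pd j \<eta> (x - y)" for j x y
    using C1c_affine[OF \<eta>(1), where c=1 and a="- y"] by simp_all
  have Cg: "C1c (?g y)" for y by (rule C1c_scaleR(1)[OF \<eta>y(1) \<phi>])
  have pdg: "pd j (?g y) x = pd j \<eta> (x - y) *\<^sub>R \<phi> x + \<eta> (x - y) *\<^sub>R pd j \<phi> x" for j x y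
    using C1c_scaleR(2)[OF \<eta>y(1)[of y] \<phi>] by (simp add: \<eta>y(2))
  note cphi = C1c_C0c[OF \<phi>] and ceta = C1c_C0c[OF \<eta>(1)]
  define A where "A x = energy_form \<alpha> (\<lambda>j. pd j \<phi> x) + b * (W x * (norm (\<phi> x))\<^sup>2) - c * (norm (\<phi> x))\<^sup>2" for x
  define Bj where "Bj j x = 2 * ((\<Sum>k\<in>UNIV. pd j \<phi> x $ k * \<phi> x $ k) + inverse \<alpha> * (\<Sum>i\<in>UNIV. pd i \<phi> x $ i) * \<phi> x $ j)" for j x
  define P where "P x = (1 + inverse \<alpha>) * (norm (\<phi> x))\<^sup>2" for x
  define f1 where "f1 x = (\<eta> x)\<^sup>2" for x
  define f2 where "f2 j x = \<eta> x * pd j \<eta> x" for j x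
  define f3 where "f3 x = (\<Sum>j\<in>UNIV. (pd j \<eta> x)\<^sup>2)" for x
  have iW: "integrable lborel (\<lambda>x. W x * (norm (f x))\<^sup>2)" if "C0c f" for f :: "real^'n \<Rightarrow> real^'n"
    using weighted_diff(2)[OF C0c_L2[OF that] C0c_L2[OF that] zero_less_one W] .
  have iA: "integrable lborel A" unfolding A_def
    using energy_integrable[OF \<alpha> \<phi>] iW[OF cphi] C0c_integrable[OF C0c_norm_sq[OF cphi]] by auto
  have iP: "integrable lborel P" unfolding P_def using C0c_integrable[OF C0c_norm_sq[OF cphi]] by auto
  have iB: "integrable lborel (Bj j)" for j
  proof -
    have "C0c (\<lambda>x. 2 *\<^sub>R ((\<Sum>k\<in>UNIV. pd j \<phi> x $ k * \<phi> x $ k) + inverse \<alpha> *\<^sub>R ((\<Sum>i\<in>UNIV. pd i \<phi> x $ i) * \<phi> x $ j)))"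
      by (intro C0c_scaleR[OF continuous_on_const] C0c_add C0c_sum C0c_mult C0c_nth C0c_pd \<phi> cphi)
    then show ?thesis using C0c_integrable by (simp add: Bj_def[abs_def] mult.assoc)
  qed
  have cf: "C0c f1" "C0c (f2 j)" "C0c f3" for j
    unfolding f1_def[abs_def] f2_def[abs_def] f3_def[abs_def]
    by (intro C0c_sq C0c_mult C0c_sum ceta C0c_pd \<eta>(1))+
  have int2: "(LBINT x. f2 j x) = 0" for j
  proof -
    have "pd j (\<lambda>x. \<eta> x *\<^sub>R \<eta> x) x = 2 * f2 j x" for x
      unfolding C1c_scaleR(2)[OF \<eta>(1) \<eta>(1)] f2_def by simp
    then show ?thesis using integral_pd_zero[OF C1c_scaleR(1)[OF \<eta>(1) \<eta>(1)], of j] by simp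
  qed
  define R where "R y = (LBINT x. f1 (x - y) * A x) + (\<Sum>j\<in>UNIV. LBINT x. f2 j (x - y) * Bj j x) + (LBINT x. f3 (x - y) * P x)" for y
  have intR: "(LBINT y. R y) = energy \<alpha> \<phi> + b * wl2sq W \<phi> - c * l2sq \<phi> + (1 + inverse \<alpha>) * (LBINT x. f3 x) * l2sq \<phi>"
  proof -
    have "(LBINT y. R y) = (LBINT x. f1 x) * (LBINT x. A x)
      + (\<Sum>j\<in>UNIV. (LBINT x. f2 j x) * (LBINT x. Bj j x)) + (LBINT x. f3 x) * (LBINT x. P x)"
      unfolding R_def using convolution_integral(2,3)[OF cf(1) iA] convolution_integral(2,3)[OF cf(2) iB]
        convolution_integral(2,3)[OF cf(3) iP] by simp
    also have "\<dots> = (LBINT x. A x) + (LBINT x. f3 x) * (LBINT x. P x)"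
      using \<eta>(2) int2 by (simp add: f1_def)
    also have "(LBINT x. A x) = energy \<alpha> \<phi> + b * wl2sq W \<phi> - c * l2sq \<phi>"
      unfolding A_def energy_def wl2sq_def l2sq_def
      using energy_integrable[OF \<alpha> \<phi>] iW[OF cphi] C0c_integrable[OF C0c_norm_sq[OF cphi]] by simp
    also have "(LBINT x. P x) = (1 + inverse \<alpha>) * l2sq \<phi>" unfolding P_def l2sq_def by simp
    finally show ?thesis by simp
  qed
  have "\<exists>y. R y < 0"
  proof (rule ccontr)
    assume "\<not> (\<exists>y. R y < 0)"
    then have "0 \<le> (LBINT y. R y)" by (intro integral_nonneg_AE AE_I2) (auto simp: not_less)
    then show False using less unfolding intR f3_def by linarith
  qed
  then obtain y where y: "R y < 0" by blast
  have "energy \<alpha> (?g y) + b * wl2sq W (?g y) - c * l2sq (?g y)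
    = (LBINT x. energy_form \<alpha> (\<lambda>j. pd j (?g y) x) + b * (W x * (norm (?g y x))\<^sup>2) - c * (norm (?g y x))\<^sup>2)"
    unfolding energy_def wl2sq_def l2sq_def
    using energy_integrable[OF \<alpha> Cg] iW[OF C1c_C0c[OF Cg]] C0c_integrable[OF C0c_norm_sq[OF C1c_C0c[OF Cg]]] by simp
  also have "\<dots> \<le> (LBINT x. f1 (x - y) * A x + (\<Sum>j\<in>UNIV. f2 j (x - y) * Bj j x) + f3 (x - y) * P x)"
  proof (rule integral_mono)
    show "integrable lborel (\<lambda>x. energy_form \<alpha> (\<lambda>j. pd j (?g y) x) + b * (W x * (norm (?g y x))\<^sup>2) - c * (norm (?g y x))\<^sup>2)"
      using energy_integrable[OF \<alpha> Cg] iW[OF C1c_C0c[OF Cg]] C0c_integrable[OF C0c_norm_sq[OF C1c_C0c[OF Cg]]] by auto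
    show "integrable lborel (\<lambda>x. f1 (x - y) * A x + (\<Sum>j\<in>UNIV. f2 j (x - y) * Bj j x) + f3 (x - y) * P x)"
      using convolution_integral(1)[OF cf(1) iA] convolution_integral(1)[OF cf(2) iB] convolution_integral(1)[OF cf(3) iP] by auto
    fix x
    have "energy_form \<alpha> (\<lambda>j. pd j (?g y) x) \<le> f1 (x - y) * energy_form \<alpha> (\<lambda>j. pd j \<phi> x) + (\<Sum>j\<in>UNIV. f2 j (x - y) * Bj j x) + f3 (x - y) * P x"
      unfolding pdg f1_def f2_def f3_def Bj_def P_def
      using energy_form_product_le[OF \<alpha>, of "\<lambda>j. pd j \<eta> (x - y)" "\<phi> x" "\<eta> (x - y)" "\<lambda>j. pd j \<phi> x"]
      by (simp only: mult_ac)
    moreover have n2: "(norm (?g y x))\<^sup>2 = f1 (x - y) * (norm (\<phi> x))\<^sup>2" by (simp add: f1_def power_mult_distrib)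
    ultimately show "energy_form \<alpha> (\<lambda>j. pd j (?g y) x) + b * (W x * (norm (?g y x))\<^sup>2) - c * (norm (?g y x))\<^sup>2
      \<le> f1 (x - y) * A x + (\<Sum>j\<in>UNIV. f2 j (x - y) * Bj j x) + f3 (x - y) * P x"
      unfolding n2 A_def by (simp add: algebra_simps)
  qed
  also have "\<dots> = R y" unfolding R_def
    using convolution_integral(1)[OF cf(1) iA] convolution_integral(1)[OF cf(2) iB] convolution_integral(1)[OF cf(3) iP] by simp
  finally have "energy \<alpha> (?g y) + b * wl2sq W (?g y) < c * l2sq (?g y)" using y by linarith
  then show ?thesis using Cg by blast
qed

lemma cutoff_exists:
  assumes "\<delta> > 0"
  shows "\<exists>(\<eta> :: real^'n \<Rightarrow> real) R. R > 0 \<and> C1c \<eta> \<and> (LBINT x. (\<eta> x)\<^sup>2) = 1 \<and> {x. \<eta> x \<noteq> 0} \<subseteq> Q_hat R \<and>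
    (LBINT x. (\<Sum>j\<in>UNIV. (pd j \<eta> x)\<^sup>2)) \<le> \<delta>"
proof -
  let ?l = "(\<chi> i. - 1 / 2) :: real^'n" and ?u = "(\<chi> i. 1 / 2) :: real^'n"
  define h where "h = bump 1 ?l ?u"
  have Ch: "C1c h" unfolding h_def by (rule test_functions_C1c[OF bump_test_function]) simp
  have h0: "h x \<noteq> 0 \<longleftrightarrow> x \<in> Q_hat 1" for x
    unfolding h_def by (subst bump_nonzero_iff) (auto simp: mem_box_cart Q_hat_def)
  define Z where "Z = (LBINT x. (h x)\<^sup>2)"
  have Z: "Z > 0"
  proof -
    have "Z \<noteq> 0"
    proof
      assume "Z = 0"
      then have "AE x in lborel. (h x)\<^sup>2 = 0"
        unfolding Z_def using C0c_integrable[OF C0c_sq[OF C1c_C0c[OF Ch]]]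
        by (subst (asm) integral_nonneg_eq_0_iff_AE) auto
      then have "AE x in lborel. x \<notin> box ?l ?u"
      proof (rule eventually_mono)
        fix x assume "(h x)\<^sup>2 = 0"
        then have "x \<notin> Q_hat 1" using h0[of x] by auto
        then show "x \<notin> box ?l ?u" by (simp add: mem_box_cart Q_hat_def)
      qed
      then have "emeasure lborel (box ?l ?u) = 0" by (subst (asm) AE_iff_measurable[OF _ refl]) auto
      moreover have "emeasure lborel (box ?l ?u) = 1"
        using emeasure_lborel_cube(1)[of 1 ?u ?l] by simp
      ultimately show False by simp
    qed
    moreover have "0 \<le> Z" unfolding Z_def by (intro integral_nonneg_AE AE_I2) auto
    ultimately show ?thesis by simp
  qed
  define G where "G = (LBINT x. (\<Sum>j\<in>UNIV. (pd j h x)\<^sup>2))"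
  have G: "0 \<le> G" unfolding G_def by (intro integral_nonneg_AE AE_I2 sum_nonneg) auto
  have iG: "integrable lborel (\<lambda>x. \<Sum>j\<in>UNIV. (pd j h x)\<^sup>2)"
    by (intro C0c_integrable C0c_sum C0c_sq C0c_pd Ch)
  define R where "R = max 1 (G / (Z * \<delta>))"
  have R: "R \<ge> 1" "G / (Z * \<delta>) \<le> R" by (auto simp: R_def)
  have R0: "R > 0" using R by simp
  define c where "c = 1 / sqrt (Z * R ^ CARD('n))"
  have c2: "c\<^sup>2 = 1 / (Z * R ^ CARD('n))" using Z R0 by (simp add: c_def power_divide)
  define \<eta> where "\<eta> = (\<lambda>x. c *\<^sub>R h (0 + inverse R *\<^sub>R x))"
  have iR: "inverse R \<noteq> 0" using R0 by simp
  have C1: "C1c (\<lambda>x. h (0 + inverse R *\<^sub>R x))" by (rule C1c_affine(1)[OF Ch iR])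
  have C\<eta>: "C1c \<eta>" unfolding \<eta>_def by (rule C1c_cmult(1)[OF C1])
  have pd\<eta>: "pd j \<eta> x = c * (inverse R * pd j h (0 + inverse R *\<^sub>R x))" for j x
    unfolding \<eta>_def C1c_cmult(2)[OF C1] C1c_affine(2)[OF Ch iR] by simp
  have aR: "inverse (\<bar>inverse R\<bar> ^ CARD('n)) = R ^ CARD('n)" using R0 by (simp add: power_inverse)
  have "(LBINT x. (\<eta> x)\<^sup>2) = c\<^sup>2 * (LBINT x. (h (0 + inverse R *\<^sub>R x))\<^sup>2)"
    unfolding \<eta>_def by (simp add: power_mult_distrib)
  also have "\<dots> = c\<^sup>2 * (R ^ CARD('n) * Z)"
    using integral_affine[OF C0c_integrable[OF C0c_sq[OF C1c_C0c[OF Ch]]] iR, of 0] unfolding aR Z_def by simp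
  also have "\<dots> = 1" unfolding c2 using Z R0 by simp
  finally have 1: "(LBINT x. (\<eta> x)\<^sup>2) = 1" .
  have "(LBINT x. (\<Sum>j\<in>UNIV. (pd j \<eta> x)\<^sup>2)) = (LBINT x. (c\<^sup>2 * (inverse R)\<^sup>2) * (\<Sum>j\<in>UNIV. (pd j h (0 + inverse R *\<^sub>R x))\<^sup>2))"
    unfolding pd\<eta> by (simp add: power_mult_distrib sum_distrib_left mult.assoc)
  also have "\<dots> = (c\<^sup>2 * (inverse R)\<^sup>2) * (R ^ CARD('n) * G)"
    using integral_affine[OF iG iR, of 0] unfolding aR G_def by simp
  also have "\<dots> = G / (Z * (R * R))" unfolding c2 using Z R0 by (simp add: field_simps power2_eq_square)
  also have "\<dots> \<le> \<delta>"
  proof -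
    have "G \<le> R * (Z * \<delta>)" using R(2) Z assms by (simp add: field_simps)
    also have "\<dots> \<le> (R * R) * (Z * \<delta>)" using R(1) Z assms by (intro mult_right_mono) auto
    finally show ?thesis using Z R0 by (simp add: field_simps)
  qed
  finally have 2: "(LBINT x. (\<Sum>j\<in>UNIV. (pd j \<eta> x)\<^sup>2)) \<le> \<delta>" .
  have "{x. \<eta> x \<noteq> 0} \<subseteq> Q_hat R"
  proof
    fix x assume "x \<in> {x. \<eta> x \<noteq> 0}"
    then have "inverse R *\<^sub>R x \<in> Q_hat 1" using h0 by (simp add: \<eta>_def)
    then show "x \<in> Q_hat R" unfolding Q_hat_iff using R0 by (auto simp: abs_mult field_simps)
  qed
  then show ?thesis using R0 C\<eta> 1 2 by blast
qed

lemma box_localization: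
  fixes \<phi> :: "real^'n \<Rightarrow> real^'n" and \<eta> :: "real^'n \<Rightarrow> real"
  assumes \<alpha>: "\<alpha> > 0" and \<beta>: "\<beta> > 0" and L: "L \<ge> 1"
    and \<eta>: "C1c \<eta>" "(LBINT x. (\<eta> x)\<^sup>2) = 1" "{x. \<eta> x \<noteq> 0} \<subseteq> Q_hat R"
      "(1 + inverse \<alpha>) * (LBINT x. (\<Sum>j\<in>UNIV. (pd j \<eta> x)\<^sup>2)) \<le> \<delta>"
    and W: "W \<in> borel_measurable borel" "\<And>x. 0 \<le> W x \<and> W x \<le> 1"
    and \<phi>: "C1c \<phi>" "{x. \<phi> x \<noteq> 0} \<subseteq> Q_hat t"
    and less: "energy \<alpha> \<phi> + inverse (L\<^sup>2) * \<beta> * wl2sq W \<phi> < inverse (L\<^sup>2) * c * l2sq \<phi>"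
    and m: "t / 2 + L * R / 2 \<le> real m"
  shows "\<exists>z\<in>grid m. \<exists>\<psi>. C1c \<psi> \<and> {x. \<psi> x \<noteq> 0} \<subseteq> Q_hat (R + 1) \<and> l2sq \<psi> = 1 \<and>
    energy \<alpha> \<psi> + \<beta> * wl2sq (\<lambda>x. W (intvec z + L *\<^sub>R x)) \<psi> < c + \<delta>"
proof -
  have L0: "L > 0" "L \<noteq> 0" "\<bar>L\<bar> = L" using L by auto
  define p where "p = (\<lambda>x. \<phi> (0 + L *\<^sub>R x))"
  define U where "U = (\<lambda>x. W (0 + L *\<^sub>R x))"
  have Cp: "C1c p" unfolding p_def by (rule C1c_affine(1)[OF \<phi>(1) L0(2)])
  have U: "U \<in> borel_measurable borel" "\<And>x. 0 \<le> U x \<and> U x \<le> 1"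
    using W unfolding U_def by measurable
  let ?k = "L\<^sup>2 / L ^ CARD('n)"
  have k: "?k > 0" "inverse (L ^ CARD('n)) = ?k * inverse (L\<^sup>2)" using L0 by (auto simp: field_simps)
  have "energy \<alpha> p + \<beta> * wl2sq U p = ?k * (energy \<alpha> \<phi> + inverse (L\<^sup>2) * \<beta> * wl2sq W \<phi>)"
    unfolding p_def U_def energy_scale[OF \<alpha> \<phi>(1) L0(2)] wl2sq_scale[OF C1c_C0c[OF \<phi>(1)] L0(2) W] L0(3) k(2)
    by (simp add: algebra_simps)
  also have "\<dots> < ?k * (inverse (L\<^sup>2) * c * l2sq \<phi>)" using less k(1) by (rule mult_strict_left_mono)
  also have "\<dots> = c * l2sq p"
    unfolding p_def l2sq_scale[OF C1c_C0c[OF \<phi>(1)] L0(2)] L0(3) k(2) by (simp add: mult_ac)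
  finally have "energy \<alpha> p + \<beta> * wl2sq U p < c * l2sq p" .
  moreover have "(1 + inverse \<alpha>) * (LBINT x. (\<Sum>j\<in>UNIV. (pd j \<eta> x)\<^sup>2)) * l2sq p \<le> \<delta> * l2sq p"
    using \<eta>(4) l2sq_nonneg by (rule mult_right_mono)
  ultimately have "energy \<alpha> p + \<beta> * wl2sq U p + (1 + inverse \<alpha>) * (LBINT x. (\<Sum>j\<in>UNIV. (pd j \<eta> x)\<^sup>2)) * l2sq p < (c + \<delta>) * l2sq p"
    by (simp add: distrib_right)
  from ims_localization[OF \<alpha> \<eta>(1,2) Cp U this]
  obtain y where Cg: "C1c (\<lambda>x. \<eta> (x - y) *\<^sub>R p x)"
    and lt: "energy \<alpha> (\<lambda>x. \<eta> (x - y) *\<^sub>R p x) + \<beta> * wl2sq U (\<lambda>x. \<eta> (x - y) *\<^sub>R p x) < (c + \<delta>) * l2sq (\<lambda>x. \<eta> (x - y) *\<^sub>R p x)"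
    by blast
  define g where "g = (\<lambda>x. \<eta> (x - y) *\<^sub>R p x)"
  note Cg = Cg[folded g_def] and lt = lt[folded g_def]
  have wnn: "0 \<le> wl2sq U g" unfolding wl2sq_def using U(2) by (intro integral_nonneg_AE AE_I2) simp
  have npos: "0 < l2sq g"
  proof (rule ccontr)
    assume "\<not> 0 < l2sq g"
    then have "l2sq g = 0" using l2sq_nonneg[of g] by simp
    then show False using lt energy_nonneg[OF \<alpha>, of g] wnn \<beta> by (simp add: not_less add_nonneg_nonneg flip: not_le)
  qed
  have "\<exists>x. g x \<noteq> 0"
  proof (rule ccontr)
    assume "\<nexists>x. g x \<noteq> 0"
    then have "l2sq g = 0" by (simp add: l2sq_def)
    with npos show False by simp
  qed
  then obtain x0 where x0: "\<eta> (x0 - y) \<noteq> 0" "\<phi> (L *\<^sub>R x0) \<noteq> 0" by (auto simp: g_def p_def)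
  have ybound: "\<bar>L * y $ i\<bar> \<le> real m" for i
  proof -
    have "x0 - y \<in> Q_hat R" "L *\<^sub>R x0 \<in> Q_hat t" using x0 \<eta>(3) \<phi>(2) by auto
    then have 1: "\<bar>x0 $ i - y $ i\<bar> < R / 2" "\<bar>L * x0 $ i\<bar> < t / 2" by (auto simp: Q_hat_iff)
    have "\<bar>L * x0 $ i - L * y $ i\<bar> = L * \<bar>x0 $ i - y $ i\<bar>" using L0 by (simp add: abs_mult flip: right_diff_distrib)
    also have "\<dots> \<le> L * (R / 2)" using 1(1) L0 by (intro mult_left_mono) auto
    finally have "\<bar>L * x0 $ i - L * y $ i\<bar> \<le> L * R / 2" by simp
    then show ?thesis using 1(2) m by linarith
  qed
  define z where "z = cell_of (L *\<^sub>R y)"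
  have z: "z \<in> grid m" unfolding z_def by (rule cell_of_in_grid) (simp add: ybound)
  have zc: "\<bar>L * y $ i - of_int (z $ i)\<bar> \<le> 1 / 2" for i
  proof -
    have "L *\<^sub>R y \<in> unit_cell z" by (simp add: mem_unit_cell_iff z_def)
    then have "- 1 / 2 < L * y $ i - of_int (z $ i)" "L * y $ i - of_int (z $ i) \<le> 1 / 2" by (auto simp: unit_cell_def)
    then show ?thesis by linarith
  qed
  define a where "a = inverse L *\<^sub>R intvec z"
  define q where "q = (\<lambda>x. g (a + 1 *\<^sub>R x))"
  define r where "r = 1 / sqrt (l2sq g)"
  define \<psi> where "\<psi> = (\<lambda>x. r *\<^sub>R q x)"
  have r2: "r\<^sup>2 = 1 / l2sq g" using npos by (simp add: r_def power_divide)
  have Cq: "C1c q" unfolding q_def by (rule C1c_affine(1)[OF Cg]) simp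
  have C\<psi>: "C1c \<psi>" unfolding \<psi>_def by (rule C1c_cmult(1)[OF Cq])
  have WU: "W (intvec z + L *\<^sub>R x) = U (a + 1 *\<^sub>R x)" for x
    unfolding U_def a_def using L0 by (simp add: scaleR_add_right)
  have nq: "l2sq q = l2sq g" unfolding q_def using l2sq_scale[OF C1c_C0c[OF Cg], of 1 a] by simp
  have Kq: "energy \<alpha> q = energy \<alpha> g" unfolding q_def using energy_scale[OF \<alpha> Cg, of 1 a] by simp
  have wq: "wl2sq (\<lambda>x. W (intvec z + L *\<^sub>R x)) q = wl2sq U g"
    unfolding q_def WU using wl2sq_scale[OF C1c_C0c[OF Cg] _ U, of 1 a] by simp
  have n\<psi>: "l2sq \<psi> = 1"
    using npos r2 nq unfolding \<psi>_def by (simp add: l2sq_def power_mult_distrib)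
  have K\<psi>: "energy \<alpha> \<psi> = r\<^sup>2 * energy \<alpha> g"
    unfolding \<psi>_def energy_def C1c_cmult(2)[OF Cq] energy_form_scale using Kq by (simp add: energy_def)
  have w\<psi>: "wl2sq (\<lambda>x. W (intvec z + L *\<^sub>R x)) \<psi> = r\<^sup>2 * wl2sq U g"
    unfolding \<psi>_def using wq by (simp add: wl2sq_def power_mult_distrib mult.left_commute)
  have "energy \<alpha> \<psi> + \<beta> * wl2sq (\<lambda>x. W (intvec z + L *\<^sub>R x)) \<psi> = r\<^sup>2 * (energy \<alpha> g + \<beta> * wl2sq U g)"
    unfolding K\<psi> w\<psi> by (simp add: algebra_simps)
  also have "\<dots> < r\<^sup>2 * ((c + \<delta>) * l2sq g)" using lt npos r2 by (intro mult_strict_left_mono) auto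
  also have "\<dots> = c + \<delta>" unfolding r2 using npos by simp
  finally have e: "energy \<alpha> \<psi> + \<beta> * wl2sq (\<lambda>x. W (intvec z + L *\<^sub>R x)) \<psi> < c + \<delta>" .
  have s: "{x. \<psi> x \<noteq> 0} \<subseteq> Q_hat (R + 1)"
  proof
    fix x assume "x \<in> {x. \<psi> x \<noteq> 0}"
    then have "\<eta> (a + x - y) \<noteq> 0" by (auto simp: \<psi>_def q_def g_def)
    then have q: "a + x - y \<in> Q_hat R" using \<eta>(3) by blast
    show "x \<in> Q_hat (R + 1)" unfolding Q_hat_iff
    proof
      fix i
      have "\<bar>a $ i + x $ i - y $ i\<bar> < R / 2" using q by (simp add: Q_hat_iff)
      moreover have "\<bar>y $ i - a $ i\<bar> \<le> 1 / 2"
      proof -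
        have "L * (y $ i - a $ i) = L * y $ i - of_int (z $ i)" using L0 by (simp add: a_def field_simps)
        then have "L * \<bar>y $ i - a $ i\<bar> \<le> 1 / 2" using zc[of i] L0 by (metis abs_mult)
        moreover have "1 * \<bar>y $ i - a $ i\<bar> \<le> L * \<bar>y $ i - a $ i\<bar>" using L by (intro mult_right_mono) auto
        ultimately show ?thesis by simp
      qed
      ultimately show "\<bar>x $ i\<bar> < (R + 1) / 2"
        using abs_triangle_ineq[of "a $ i + x $ i - y $ i" "y $ i - a $ i"] by (simp add: add_divide_distrib)
    qed
  qed
  show ?thesis using z C\<psi> s n\<psi> e by blast
qed

section \<open>Large deviations in a box\<close>

lemma C1c_modulus:
  fixes \<psi> :: "real^'n \<Rightarrow> real^'n"
  assumes C: "C1c \<psi>"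
  shows "\<exists>K\<ge>0. \<forall>x v \<tau>. (\<forall>j. \<bar>v $ j\<bar> \<le> \<tau>) \<longrightarrow> \<bar>(norm (\<psi> (x + v)))\<^sup>2 - (norm (\<psi> x))\<^sup>2\<bar> \<le> K * \<tau>"
proof -
  have "\<forall>j. \<exists>B>0. \<forall>x. norm (pd j \<psi> x) \<le> B" using C0c_bounded[OF C0c_pd[OF C]] by blast
  then obtain B where B: "\<And>j x. norm (pd j \<psi> x) \<le> B j" by metis
  obtain A where A: "A > 0" "\<And>x. norm (\<psi> x) \<le> A" using C0c_bounded[OF C1c_C0c[OF C]] by blast
  define K where "K = (\<Sum>j\<in>UNIV. B j)"
  have B0: "0 \<le> B j" for j using B[of j undefined] norm_ge_zero[of "pd j \<psi> undefined"] by linarith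
  then have K: "0 \<le> K" unfolding K_def by (intro sum_nonneg)
  show ?thesis
  proof (intro exI[of _ "2 * A * K"] conjI allI impI)
    show "0 \<le> 2 * A * K" using A K by simp
    fix x v :: "real^'n" and \<tau> assume v: "\<forall>j. \<bar>v $ j\<bar> \<le> \<tau>"
    have \<tau>0: "0 \<le> \<tau>" using v abs_ge_zero order_trans by blast
    have "norm (frechet_derivative \<psi> (at y) v) \<le> \<tau> * K" for y
    proof -
      have "norm (frechet_derivative \<psi> (at y) v) \<le> (\<Sum>j\<in>UNIV. norm (v $ j *\<^sub>R pd j \<psi> y))"
        unfolding frechet_eq_sum_pd[OF C] by (rule norm_sum)
      also have "\<dots> \<le> (\<Sum>j\<in>UNIV. \<tau> * B j)"
        using v B \<tau>0 by (intro sum_mono) (auto intro!: mult_mono)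
      finally show ?thesis by (simp add: K_def sum_distrib_left)
    qed
    from C1c_increment_bound[OF C this, of x 1]
    have n: "norm (\<psi> (x + v) - \<psi> x) \<le> \<tau> * K" by simp
    have "\<bar>(norm (\<psi> (x + v)))\<^sup>2 - (norm (\<psi> x))\<^sup>2\<bar> = \<bar>norm (\<psi> (x + v)) - norm (\<psi> x)\<bar> * (norm (\<psi> (x + v)) + norm (\<psi> x))"
      by (simp add: power2_eq_square square_diff_square_factored abs_mult)
    also have "\<dots> \<le> (\<tau> * K) * (A + A)"
      using n norm_triangle_ineq3[of "\<psi> (x + v)" "\<psi> x"] A by (intro mult_mono add_mono) auto
    finally show "\<bar>(norm (\<psi> (x + v)))\<^sup>2 - (norm (\<psi> x))\<^sup>2\<bar> \<le> 2 * A * K * \<tau>" by (simp add: mult_ac)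
  qed
qed

locale iid_field = random_field M V + prob_space M
  for M :: "'w measure" and V :: "real^'n \<Rightarrow> 'w \<Rightarrow> real" +
  fixes \<xi> :: "int^'n \<Rightarrow> 'w \<Rightarrow> real"
  assumes indep: "indep_vars (\<lambda>_. borel) \<xi> UNIV"
    and ident: "\<And>z. distr M borel (\<xi> z) = distr M borel (\<xi> 0)"
    and \<xi>_range: "\<And>z. AE \<omega> in M. 0 \<le> \<xi> z \<omega> \<and> \<xi> z \<omega> \<le> 1"
    and \<xi>_le: "\<And>z. AE \<omega> in M. measure lborel ({x. V x \<omega> = 1} \<inter> unit_cell z) \<ge> \<xi> z \<omega>"
begin

abbreviation "G \<equiv> G_fun M (\<xi> 0)"

abbreviation "pot z L \<omega> \<equiv> wl2sq (\<lambda>x. V (intvec z + L *\<^sub>R x) \<omega>)"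

lemma \<xi>_meas [measurable]: "\<xi> z \<in> borel_measurable M"
  using indep unfolding indep_vars_def by auto

lemma exp_integrable:
  assumes "0 \<le> u" shows "integrable M (\<lambda>\<omega>. exp (- u * \<xi> z \<omega>))"
proof (rule integrable_const_bound[of _ 1])
  show "AE \<omega> in M. norm (exp (- u * \<xi> z \<omega>)) \<le> 1"
    using \<xi>_range[of z] by eventually_elim (use assms in auto)
qed measurable

lemma exp_expectation_bounds:
  assumes "0 \<le> u" "u \<le> v"
  shows "expectation (\<lambda>\<omega>. exp (- v * \<xi> z \<omega>)) \<le> expectation (\<lambda>\<omega>. exp (- u * \<xi> z \<omega>))"
    and "exp (- (v - u)) * expectation (\<lambda>\<omega>. exp (- u * \<xi> z \<omega>)) \<le> expectation (\<lambda>\<omega>. exp (- v * \<xi> z \<omega>))"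
proof -
  have i: "integrable M (\<lambda>\<omega>. exp (- u * \<xi> z \<omega>))" "integrable M (\<lambda>\<omega>. exp (- v * \<xi> z \<omega>))"
    using exp_integrable[of u z] exp_integrable[of v z] assms by auto
  show "expectation (\<lambda>\<omega>. exp (- v * \<xi> z \<omega>)) \<le> expectation (\<lambda>\<omega>. exp (- u * \<xi> z \<omega>))"
  proof (rule integral_mono_AE[OF i(2,1)])
    show "AE \<omega> in M. exp (- v * \<xi> z \<omega>) \<le> exp (- u * \<xi> z \<omega>)"
      using \<xi>_range[of z] by eventually_elim (use assms in \<open>auto intro: mult_right_mono\<close>)
  qed
  have "(\<integral>\<omega>. exp (- (v - u)) * exp (- u * \<xi> z \<omega>) \<partial>M) \<le> expectation (\<lambda>\<omega>. exp (- v * \<xi> z \<omega>))"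
  proof (rule integral_mono_AE[OF _ i(2)])
    show "AE \<omega> in M. exp (- (v - u)) * exp (- u * \<xi> z \<omega>) \<le> exp (- v * \<xi> z \<omega>)"
      using \<xi>_range[of z]
    proof eventually_elim
      case (elim \<omega>)
      have "(v - u) * \<xi> z \<omega> \<le> (v - u) * 1" using elim assms by (intro mult_left_mono) auto
      then have "- (v - u) + - u * \<xi> z \<omega> \<le> - v * \<xi> z \<omega>" by (simp add: algebra_simps)
      then show ?case unfolding exp_add[symmetric] by simp
    qed
  qed (use i(1) in simp)
  then show "exp (- (v - u)) * expectation (\<lambda>\<omega>. exp (- u * \<xi> z \<omega>)) \<le> expectation (\<lambda>\<omega>. exp (- v * \<xi> z \<omega>))"
    by simp
qed

lemma exp_expectation_pos:
  assumes "0 \<le> u" shows "0 < expectation (\<lambda>\<omega>. exp (- u * \<xi> z \<omega>))"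
proof -
  have "0 < exp (- u) * expectation (\<lambda>\<omega>. exp (- 0 * \<xi> z \<omega>))" by (simp add: prob_space)
  also have "\<dots> \<le> expectation (\<lambda>\<omega>. exp (- u * \<xi> z \<omega>))" using exp_expectation_bounds(2)[of 0 u z] assms by simp
  finally show ?thesis .
qed

lemma expectation_exp:
  assumes "0 \<le> u" shows "expectation (\<lambda>\<omega>. exp (- u * \<xi> z \<omega>)) = exp (- G u)"
proof -
  have "expectation (\<lambda>\<omega>. exp (- u * \<xi> z \<omega>)) = (\<integral>x. exp (- u * x) \<partial>distr M borel (\<xi> z))"
    by (subst integral_distr) auto
  also have "\<dots> = (\<integral>x. exp (- u * x) \<partial>distr M borel (\<xi> 0))" by (simp only: ident[of z])
  also have "\<dots> = expectation (\<lambda>\<omega>. exp (- u * \<xi> 0 \<omega>))"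
    by (subst integral_distr) auto
  also have "\<dots> = exp (- G u)" unfolding G_fun_def using exp_expectation_pos[OF assms, of 0] by simp
  finally show ?thesis .
qed

lemma G_bounds:
  assumes "0 \<le> u" "u \<le> v" shows "G u \<le> G v" "G v \<le> G u + (v - u)"
proof -
  have v: "0 \<le> v" using assms by simp
  show "G u \<le> G v" using exp_expectation_bounds(1)[OF assms, of 0] unfolding expectation_exp[OF v] expectation_exp[OF assms(1)] by simp
  have "exp (- (v - u)) * exp (- G u) \<le> exp (- G v)"
    using exp_expectation_bounds(2)[OF assms, of 0] unfolding expectation_exp[OF v] expectation_exp[OF assms(1)] .
  then show "G v \<le> G u + (v - u)" unfolding exp_add[symmetric] by simp
qed

lemma G_0: "G 0 = 0" by (simp add: G_fun_def prob_space)

lemma G_nonneg: "0 \<le> u \<Longrightarrow> 0 \<le> G u" using G_bounds(1)[of 0 u] by (simp add: G_0)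

lemma G_le: "0 \<le> u \<Longrightarrow> G u \<le> u" using G_bounds(2)[of 0 u] by (simp add: G_0)

lemma G_meas [measurable]: "G \<in> borel_measurable borel"
  unfolding G_fun_def[abs_def] by measurable

lemma Gamma_integrable:
  assumes "\<phi> \<in> L2" "0 < h"
  shows "integrable lborel (\<lambda>x. G (h * (norm (\<phi> x))\<^sup>2))"
proof (rule Bochner_Integration.integrable_bound)
  have [measurable]: "\<phi> \<in> borel_measurable borel" using assms(1) by (simp add: L2_def)
  show "integrable lborel (\<lambda>x. h * (norm (\<phi> x))\<^sup>2)" using assms(1) by (simp add: L2_def)
  show "(\<lambda>x. G (h * (norm (\<phi> x))\<^sup>2)) \<in> borel_measurable lborel" by measurable
  show "AE x in lborel. norm (G (h * (norm (\<phi> x))\<^sup>2)) \<le> norm (h * (norm (\<phi> x))\<^sup>2)"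
    using assms(2) G_nonneg G_le by (intro AE_I2) simp
qed

lemma Gamma_bounds:
  assumes "\<phi> \<in> L2" "0 < h"
  shows "0 \<le> Gamma_fun G h \<phi>" "Gamma_fun G h \<phi> \<le> h * l2sq \<phi>"
proof -
  show "0 \<le> Gamma_fun G h \<phi>" unfolding Gamma_fun_def using assms(2)
    by (intro integral_nonneg_AE AE_I2 G_nonneg) auto
  have "Gamma_fun G h \<phi> \<le> (LBINT x. h * (norm (\<phi> x))\<^sup>2)"
    unfolding Gamma_fun_def using assms
    by (intro integral_mono Gamma_integrable G_le) (auto simp: L2_def)
  then show "Gamma_fun G h \<phi> \<le> h * l2sq \<phi>" by (simp add: l2sq_def)
qed

lemma C_cal_finite:
  assumes \<alpha>: "\<alpha> > 0" and \<beta>: "\<beta> > 0"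
  shows "\<exists>C. C_cal TYPE('n) G \<alpha> \<beta> = ereal C"
proof -
  let ?d = "real CARD('n)"
  obtain \<eta> :: "real^'n \<Rightarrow> real" and R where \<eta>: "C1c \<eta>" "(LBINT x. (\<eta> x)\<^sup>2) = 1"
    using cutoff_exists[of 1, where 'n='n] by auto
  define i where "i = (undefined :: 'n)"
  define \<phi> where "\<phi> x = \<eta> x *\<^sub>R (axis i 1 :: real^'n)" for x
  have d: "(\<phi> has_derivative (\<lambda>v. frechet_derivative \<eta> (at x) v *\<^sub>R axis i 1)) (at x)" for x
    unfolding \<phi>_def[abs_def] by (rule has_derivative_scaleR_left[OF C1c_has_derivative[OF \<eta>(1)]])
  have C\<phi>: "C1c \<phi>"
    by (rule C1cI[OF d]) (use \<eta>(1) in \<open>auto simp: C1c_def \<phi>_def intro!: continuous_intros\<close>)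
  have n\<phi>: "L2_norm \<phi> = 1" unfolding L2_norm_def \<phi>_def using \<eta>(2) by (simp add: power2_abs)
  have L2: "\<phi> \<in> L2" by (rule C0c_L2[OF C1c_C0c[OF C\<phi>]])
  have n1: "l2sq \<phi> = 1" using L2_norm_sq[of \<phi>] n\<phi> by simp
  have "G_cal G \<phi> ?d \<le> ereal 1"
    unfolding G_cal_def
  proof (rule SUP_least)
    fix h :: real assume "h \<in> {0<..}"
    then have h: "h > 0" by simp
    have "inverse h * (Gamma_fun G h \<phi> - ?d) \<le> inverse h * h"
      using Gamma_bounds(2)[OF L2 h] n1 h by (intro mult_left_mono) auto
    then show "ereal (inverse h * (Gamma_fun G h \<phi> - ?d)) \<le> ereal 1" using h by simp
  qed
  then have "ereal \<beta> * G_cal G \<phi> ?d \<le> ereal \<beta> * ereal 1" using \<beta> by (intro ereal_mult_left_mono) auto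
  then have "ereal (K_energy \<alpha> \<phi>) + ereal \<beta> * G_cal G \<phi> ?d \<le> ereal (K_energy \<alpha> \<phi> + \<beta>)"
    by (metis add_left_mono mult.right_neutral one_ereal_def plus_ereal.simps(1))
  moreover have "C_cal TYPE('n) G \<alpha> \<beta> \<le> ereal (K_energy \<alpha> \<phi>) + ereal \<beta> * G_cal G \<phi> ?d"
    unfolding C_cal_def using C1c_H1(1)[OF C\<phi>] n\<phi> by (intro INF_lower) auto
  ultimately have up: "C_cal TYPE('n) G \<alpha> \<beta> \<le> ereal (K_energy \<alpha> \<phi> + \<beta>)" by (rule order_trans[rotated])
  have lo: "ereal (- (\<beta> * ?d)) \<le> C_cal TYPE('n) G \<alpha> \<beta>"
    unfolding C_cal_def
  proof (rule INF_greatest)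
    fix \<phi> :: "real^'n \<Rightarrow> real^'n" assume "\<phi> \<in> {\<phi> \<in> H1. L2_norm \<phi> = 1}"
    then have L: "\<phi> \<in> L2" by (simp add: H1_def)
    have "ereal (- ?d) \<le> ereal (inverse 1 * (Gamma_fun G 1 \<phi> - ?d))" using Gamma_bounds(1)[OF L, of 1] by simp
    also have "\<dots> \<le> G_cal G \<phi> ?d" unfolding G_cal_def by (rule SUP_upper) simp
    finally have "ereal \<beta> * ereal (- ?d) \<le> ereal \<beta> * G_cal G \<phi> ?d" using \<beta> by (intro ereal_mult_left_mono) auto
    then have "ereal 0 + ereal \<beta> * ereal (- ?d) \<le> ereal (K_energy \<alpha> \<phi>) + ereal \<beta> * G_cal G \<phi> ?d"
      using K_energy_nonneg[OF \<alpha>, of \<phi>] by (intro add_mono) auto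
    then show "ereal (- (\<beta> * ?d)) \<le> ereal (K_energy \<alpha> \<phi>) + ereal \<beta> * G_cal G \<phi> ?d" by simp
  qed
  show ?thesis using up lo by (cases "C_cal TYPE('n) G \<alpha> \<beta>") auto
qed

lemma expectation_product:
  assumes "finite I" "\<And>w. w \<in> I \<Longrightarrow> 0 \<le> m w"
  shows "integrable M (\<lambda>\<omega>. \<Prod>w\<in>I. exp (- m w * \<xi> w \<omega>))"
    and "expectation (\<lambda>\<omega>. \<Prod>w\<in>I. exp (- m w * \<xi> w \<omega>)) = exp (- (\<Sum>w\<in>I. G (m w)))"
proof -
  have "indep_vars (\<lambda>_. borel) (\<lambda>w \<omega>. exp (- m w * \<xi> w \<omega>)) I"
    by (rule indep_vars_compose2[OF indep_vars_subset[OF indep]]) auto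
  note * = assms(1) this exp_integrable[OF assms(2)]
  show "integrable M (\<lambda>\<omega>. \<Prod>w\<in>I. exp (- m w * \<xi> w \<omega>))"
    by (rule indep_vars_integrable[OF *])
  have "expectation (\<lambda>\<omega>. \<Prod>w\<in>I. exp (- m w * \<xi> w \<omega>)) = (\<Prod>w\<in>I. expectation (\<lambda>\<omega>. exp (- m w * \<xi> w \<omega>)))"
    by (rule indep_vars_lebesgue_integral[OF *])
  also have "\<dots> = (\<Prod>w\<in>I. exp (- G (m w)))" using assms(2) by (intro prod.cong refl expectation_exp)
  also have "\<dots> = exp (- (\<Sum>w\<in>I. G (m w)))" by (simp add: exp_sum assms(1) flip: sum_negf)
  finally show "expectation (\<lambda>\<omega>. \<Prod>w\<in>I. exp (- m w * \<xi> w \<omega>)) = exp (- (\<Sum>w\<in>I. G (m w)))" .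
qed

lemma cell_mass:
  assumes w: "\<omega> \<in> space M"
  shows "integrable lborel (\<lambda>y. indicator (unit_cell w) y * V (intvec z + y) \<omega>)"
    and "(LBINT y. indicator (unit_cell w) y * V (intvec z + y) \<omega>)
      = measure lborel ({x. V x \<omega> = 1} \<inter> unit_cell (z + w))"
proof -
  have Vm[measurable]: "(\<lambda>x. V x \<omega>) \<in> borel_measurable borel" by (rule V_section[OF w])
  have cell: "intvec z + 1 *\<^sub>R y \<in> unit_cell (z + w) \<longleftrightarrow> y \<in> unit_cell w" for y
    by (simp add: unit_cell_def)
  have S: "{x. V x \<omega> = 1} \<in> sets borel" by measurable
  then have S': "{x. V x \<omega> = 1} \<inter> unit_cell (z + w) \<in> sets lborel" by auto
  have fin: "emeasure lborel ({x. V x \<omega> = 1} \<inter> unit_cell (z + w)) < \<infinity>"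
  proof -
    have "emeasure lborel ({x. V x \<omega> = 1} \<inter> unit_cell (z + w)) \<le> emeasure lborel (unit_cell (z + w))"
      by (rule emeasure_mono) auto
    then show ?thesis by (simp add: emeasure_unit_cell order_le_less_trans)
  qed
  have i: "integrable lborel (indicator ({x. V x \<omega> = 1} \<inter> unit_cell (z + w)) :: _ \<Rightarrow> real)"
    by (rule integrable_real_indicator[OF S' fin])
  have eq: "indicator ({x. V x \<omega> = 1} \<inter> unit_cell (z + w)) (intvec z + 1 *\<^sub>R y) = indicator (unit_cell w) y * V (intvec z + y) \<omega>" for y
    using V_01[OF w, of "intvec z + y"] cell[of y] by (auto simp: indicator_def)
  show "integrable lborel (\<lambda>y. indicator (unit_cell w) y * V (intvec z + y) \<omega>)"
    using integrable_affine[OF i, of 1 "intvec z"] unfolding eq by simp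
  show "(LBINT y. indicator (unit_cell w) y * V (intvec z + y) \<omega>)
      = measure lborel ({x. V x \<omega> = 1} \<inter> unit_cell (z + w))"
    using integral_affine[OF i, of 1 "intvec z"] unfolding eq by simp
qed

lemma box_chernoff:
  fixes \<psi> :: "real^'n \<Rightarrow> real^'n"
  assumes C: "C1c \<psi>" and supp: "{x. \<psi> x \<noteq> 0} \<subseteq> Q_hat r" and r: "r > 0" and h: "h > 0" and \<theta>: "\<theta> > 0"
  shows "\<exists>L0\<ge>1. \<forall>L\<ge>L0. \<forall>z a. prob {\<omega> \<in> space M. pot z L \<omega> \<psi> \<le> a}
    \<le> exp (L ^ CARD('n) * (h * a - Gamma_fun G h \<psi> + h * \<theta>))"
proof -
  let ?u = "\<lambda>x. (norm (\<psi> x))\<^sup>2"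
  obtain K where K: "K \<ge> 0" and modulus: "\<And>x v \<tau>. (\<forall>j. \<bar>v $ j\<bar> \<le> \<tau>) \<Longrightarrow> \<bar>?u (x + v) - ?u x\<bar> \<le> K * \<tau>"
    using C1c_modulus[OF C] by auto
  define L0 where "L0 = max 1 ((2 * r + 3) ^ CARD('n) * (2 * K) / \<theta>)"
  note cpsi = C1c_C0c[OF C]
  show ?thesis
  proof (intro exI[of _ L0] conjI allI impI)
    show "1 \<le> L0" by (simp add: L0_def)
    fix L z a assume "L0 \<le> L"
    then have L: "L \<ge> 1" "(2 * r + 3) ^ CARD('n) * (2 * K) / \<theta> \<le> L" by (auto simp: L0_def)
    then have L': "L > 0" "L \<noteq> 0" "\<bar>L\<bar> = L" "inverse L \<noteq> 0" by auto
    define N where "N = nat \<lceil>L * r\<rceil>"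
    have N: "L * r \<le> real N" "real N \<le> L * r + 1" using L' r by (auto simp: N_def)
    define m where "m w = max 0 (?u (inverse L *\<^sub>R intvec w) - K / L)" for w
    have m0: "0 \<le> m w" for w by (simp add: m_def)
    have close: "m w \<le> ?u (inverse L *\<^sub>R y)" "?u (inverse L *\<^sub>R y) \<le> m w + 2 * K / L" if "y \<in> unit_cell w" for y w
    proof -
      have c: "- 1 / 2 < y $ j - of_int (w $ j)" "y $ j - of_int (w $ j) \<le> 1 / 2" for j
        using that by (auto simp: unit_cell_def)
      have b: "\<bar>(inverse L *\<^sub>R (y - intvec w)) $ j\<bar> \<le> inverse L" for j
      proof -
        have "\<bar>y $ j - of_int (w $ j)\<bar> \<le> 1" using c[of j] by linarith
        then have "inverse L * \<bar>y $ j - of_int (w $ j)\<bar> \<le> inverse L * 1" using L' by (intro mult_left_mono) auto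
        then show ?thesis using L' by (simp add: abs_mult)
      qed
      have "inverse L *\<^sub>R intvec w + inverse L *\<^sub>R (y - intvec w) = inverse L *\<^sub>R y"
        by (simp add: scaleR_diff_right)
      then have "\<bar>?u (inverse L *\<^sub>R y) - ?u (inverse L *\<^sub>R intvec w)\<bar> \<le> K / L"
        using modulus[of "inverse L *\<^sub>R (y - intvec w)" "inverse L" "inverse L *\<^sub>R intvec w"] b
        by (simp add: divide_inverse)
      moreover have "0 \<le> ?u (inverse L *\<^sub>R y)" "0 \<le> K / L" using K L' by auto
      ultimately show "m w \<le> ?u (inverse L *\<^sub>R y)" "?u (inverse L *\<^sub>R y) \<le> m w + 2 * K / L"
        unfolding m_def by (auto simp: max_def)
    qed
    have grid: "cell_of y \<in> grid N" if "\<psi> (inverse L *\<^sub>R y) \<noteq> 0" for y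
    proof (rule cell_of_in_grid)
      fix i
      have "inverse L *\<^sub>R y \<in> Q_hat r" using that supp by blast
      then have "\<bar>inverse L * y $ i\<bar> < r / 2" by (simp add: Q_hat_iff)
      then have "inverse L * \<bar>y $ i\<bar> < r / 2" using L' by (simp add: abs_mult)
      then have "\<bar>y $ i\<bar> < L * (r / 2)" using L' by (simp add: field_simps)
      also have "\<dots> \<le> L * r" using L' r by simp
      finally show "\<bar>y $ i\<bar> \<le> real N" using N by linarith
    qed
    have lower: "(\<Sum>w\<in>grid N. m w * measure lborel ({x. V x \<omega> = 1} \<inter> unit_cell (z + w)))
      \<le> L ^ CARD('n) * pot z L \<omega> \<psi>" if w: "\<omega> \<in> space M" for \<omega>
    proof -
      have Vm[measurable]: "(\<lambda>x. V x \<omega>) \<in> borel_measurable borel" by (rule V_section[OF w])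
      have cc1: "C0c (\<lambda>y. \<psi> (0 + inverse L *\<^sub>R y))" by (rule C0c_affine[OF cpsi L'(4)])
      have if0: "integrable lborel (\<lambda>y. V (intvec z + y) \<omega> * ?u (0 + inverse L *\<^sub>R y))"
        by (rule weighted_diff(2)[OF C0c_L2[OF cc1] C0c_L2[OF cc1] zero_less_one]) (use V_bounds[OF w] in auto)
      have "pot z L \<omega> \<psi> = inverse (L ^ CARD('n)) * (LBINT y. V (intvec z + y) \<omega> * ?u (inverse L *\<^sub>R y))"
        using integral_affine[OF if0 L'(2), of 0] L' by (simp add: wl2sq_def)
      then have "L ^ CARD('n) * pot z L \<omega> \<psi> = (LBINT y. V (intvec z + y) \<omega> * ?u (inverse L *\<^sub>R y))"
        using L' by simp
      also have "\<dots> \<ge> (LBINT y. (\<Sum>w\<in>grid N. m w * (indicator (unit_cell w) y * V (intvec z + y) \<omega>)))"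
      proof (rule integral_mono)
        show "integrable lborel (\<lambda>y. \<Sum>w\<in>grid N. m w * (indicator (unit_cell w) y * V (intvec z + y) \<omega>))"
          using cell_mass(1)[OF w] by auto
        show "integrable lborel (\<lambda>y. V (intvec z + y) \<omega> * ?u (inverse L *\<^sub>R y))" using if0 by simp
        fix y
        have "(\<Sum>w\<in>grid N. m w * (indicator (unit_cell w) y * V (intvec z + y) \<omega>))
          = (\<Sum>w\<in>grid N. if w = cell_of y then m w * V (intvec z + y) \<omega> else 0)"
          by (intro sum.cong) (auto simp: mem_unit_cell_iff indicator_def)
        also have "\<dots> \<le> m (cell_of y) * V (intvec z + y) \<omega>"
          using m0 V_bounds[OF w] by (simp add: finite_grid)
        also have "\<dots> \<le> ?u (inverse L *\<^sub>R y) * V (intvec z + y) \<omega>"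
          using close(1)[of y "cell_of y"] V_bounds[OF w] by (intro mult_right_mono) (auto simp: mem_unit_cell_iff)
        finally show "(\<Sum>w\<in>grid N. m w * (indicator (unit_cell w) y * V (intvec z + y) \<omega>))
          \<le> V (intvec z + y) \<omega> * ?u (inverse L *\<^sub>R y)" by (simp add: mult.commute)
      qed
      also have "(LBINT y. (\<Sum>w\<in>grid N. m w * (indicator (unit_cell w) y * V (intvec z + y) \<omega>)))
        = (\<Sum>w\<in>grid N. m w * measure lborel ({x. V x \<omega> = 1} \<inter> unit_cell (z + w)))"
        using cell_mass[OF w] by (subst Bochner_Integration.integral_sum) auto
      finally show ?thesis .
    qed
    have Gsum: "L ^ CARD('n) * (Gamma_fun G h \<psi> - h * \<theta>) \<le> (\<Sum>w\<in>grid N. G (h * m w))"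
    proof -
      have cc1: "C0c (\<lambda>y. \<psi> (0 + inverse L *\<^sub>R y))" by (rule C0c_affine[OF cpsi L'(4)])
      have iG: "integrable lborel (\<lambda>y. G (h * ?u (0 + inverse L *\<^sub>R y)))"
        by (rule Gamma_integrable[OF C0c_L2[OF cc1] h])
      then have iG': "integrable lborel (\<lambda>y. G (h * ?u (inverse L *\<^sub>R y)))" by simp
      have "Gamma_fun G h \<psi> = inverse (L ^ CARD('n)) * (LBINT y. G (h * ?u (inverse L *\<^sub>R y)))"
        using integral_affine[OF iG L'(2), of 0] L' by (simp add: Gamma_fun_def)
      then have "L ^ CARD('n) * Gamma_fun G h \<psi> = (LBINT y. G (h * ?u (inverse L *\<^sub>R y)))"
        using L' by simp
      also have "\<dots> = (\<Sum>w\<in>grid N. LBINT y. indicator (unit_cell w) y *\<^sub>R G (h * ?u (inverse L *\<^sub>R y)))"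
      proof (rule integral_sum_cells[OF iG'])
        fix y assume "G (h * ?u (inverse L *\<^sub>R y)) \<noteq> 0"
        then have "\<psi> (inverse L *\<^sub>R y) \<noteq> 0" using G_0 by auto
        then show "cell_of y \<in> grid N" by (rule grid)
      qed
      also have "\<dots> \<le> (\<Sum>w\<in>(grid N :: (int^'n) set). G (h * m w) + h * (2 * K / L))"
      proof (rule sum_mono)
        fix w :: "int^'n"
        have e1: "emeasure lborel (unit_cell w :: (real^'n) set) = 1" by (rule emeasure_unit_cell)
        have ii: "integrable lborel (\<lambda>y. indicator (unit_cell w) y *\<^sub>R (G (h * m w) + h * (2 * K / L)))"
          using e1 by (intro integrable_scaleR_left integrable_real_indicator) auto
        have "(LBINT y. indicator (unit_cell w) y *\<^sub>R G (h * ?u (inverse L *\<^sub>R y)))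
          \<le> (LBINT y. indicator (unit_cell w) y *\<^sub>R (G (h * m w) + h * (2 * K / L)))"
        proof (rule integral_mono[OF _ ii])
          show "integrable lborel (\<lambda>y. indicator (unit_cell w) y *\<^sub>R G (h * ?u (inverse L *\<^sub>R y)))"
            by (intro integrable_mult_indicator iG') simp
          fix y
          show "indicator (unit_cell w) y *\<^sub>R G (h * ?u (inverse L *\<^sub>R y)) \<le> indicator (unit_cell w) y *\<^sub>R (G (h * m w) + h * (2 * K / L))"
          proof (cases "y \<in> unit_cell w")
            case True
            have le: "0 \<le> h * m w" "h * m w \<le> h * ?u (inverse L *\<^sub>R y)"
              using m0[of w] close(1)[OF True] h by auto
            have "G (h * ?u (inverse L *\<^sub>R y)) \<le> G (h * m w) + (h * ?u (inverse L *\<^sub>R y) - h * m w)"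
              by (rule G_bounds(2)[OF le])
            also have "h * ?u (inverse L *\<^sub>R y) - h * m w \<le> h * (2 * K / L)"
              using close(2)[OF True] h unfolding right_diff_distrib[symmetric] by (intro mult_left_mono) auto
            finally show ?thesis using True by simp
          qed simp
        qed
        also have "\<dots> = G (h * m w) + h * (2 * K / L)"
          using e1 by (simp add: measure_def)
        finally show "(LBINT y. indicator (unit_cell w) y *\<^sub>R G (h * ?u (inverse L *\<^sub>R y))) \<le> G (h * m w) + h * (2 * K / L)" .
      qed
      also have "\<dots> = (\<Sum>w\<in>grid N. G (h * m w)) + real (card (grid N :: (int^'n) set)) * (h * (2 * K / L))"
        by (simp add: sum.distrib)
      also have "real (card (grid N :: (int^'n) set)) * (h * (2 * K / L)) \<le> (L * (2 * r + 3)) ^ CARD('n) * (h * (2 * K / L))"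
      proof (rule mult_right_mono)
        have "2 * real N + 1 \<le> L * (2 * r + 3)" using N L by (simp add: algebra_simps)
        then have "(2 * real N + 1) ^ CARD('n) \<le> (L * (2 * r + 3)) ^ CARD('n)" by (intro power_mono) auto
        then show "real (card (grid N :: (int^'n) set)) \<le> (L * (2 * r + 3)) ^ CARD('n)" by (simp add: card_grid add.commute)
        show "0 \<le> h * (2 * K / L)" using h K L' by simp
      qed
      also have "(L * (2 * r + 3)) ^ CARD('n) * (h * (2 * K / L)) = L ^ CARD('n) * h * ((2 * r + 3) ^ CARD('n) * (2 * K) / L)"
        by (simp add: power_mult_distrib)
      also have "\<dots> \<le> L ^ CARD('n) * h * \<theta>"
        using L(2) L' \<theta> h by (intro mult_left_mono) (auto simp: field_simps)
      finally show ?thesis by (simp add: algebra_simps)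
    qed
    define X where "X \<omega> = (\<Prod>v\<in>(\<lambda>w. z + w) ` grid N. exp (- (h * m (v - z)) * \<xi> v \<omega>))" for \<omega>
    have fin: "finite ((\<lambda>w. z + w) ` grid N)" by (intro finite_imageI finite_grid)
    have hm: "0 \<le> h * m w" for w using h m0 by simp
    note EX = expectation_product[OF fin hm, of "\<lambda>v. v - z"]
    have sumG: "(\<Sum>v\<in>(\<lambda>w. z + w) ` grid N. G (h * m (v - z))) = (\<Sum>w\<in>grid N. G (h * m w))"
      by (subst sum.reindex) (auto simp: inj_on_def)
    have Xval: "X \<omega> = exp (- h * (\<Sum>w\<in>grid N. m w * \<xi> (z + w) \<omega>))" for \<omega>
    proof -
      have "X \<omega> = (\<Prod>w\<in>grid N. exp (- (h * m w) * \<xi> (z + w) \<omega>))"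
        unfolding X_def by (subst prod.reindex) (auto simp: inj_on_def)
      also have "\<dots> = exp (\<Sum>w\<in>grid N. - (h * m w) * \<xi> (z + w) \<omega>)" by (simp add: exp_sum finite_grid)
      also have "(\<Sum>w\<in>grid N. - (h * m w) * \<xi> (z + w) \<omega>) = - h * (\<Sum>w\<in>grid N. m w * \<xi> (z + w) \<omega>)"
        by (simp add: sum_distrib_left mult.assoc)
      finally show ?thesis .
    qed
    let ?A = "{\<omega> \<in> space M. pot z L \<omega> \<psi> \<le> a}"
    have [measurable]: "(\<lambda>\<omega>. pot z L \<omega> \<psi>) \<in> borel_measurable M"
      by (rule wl2sq_measurable[OF cpsi])
    have A: "?A \<in> sets M" by measurable
    have "prob ?A = expectation (indicator ?A)" using A by simp
    also have "\<dots> \<le> expectation (\<lambda>\<omega>. exp (h * (L ^ CARD('n) * a)) * X \<omega>)"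
    proof (rule integral_mono_AE)
      show "integrable M (indicator ?A :: 'w \<Rightarrow> real)" using A by (auto simp: emeasure_eq_measure)
      show "integrable M (\<lambda>\<omega>. exp (h * (L ^ CARD('n) * a)) * X \<omega>)" using EX(1) unfolding X_def by simp
      have "AE \<omega> in M. \<forall>v. measure lborel ({x. V x \<omega> = 1} \<inter> unit_cell v) \<ge> \<xi> v \<omega>"
        unfolding AE_all_countable using \<xi>_le by blast
      then show "AE \<omega> in M. indicator ?A \<omega> \<le> exp (h * (L ^ CARD('n) * a)) * X \<omega>"
        using AE_space
      proof eventually_elim
        case (elim \<omega>)
        show ?case
        proof (cases "\<omega> \<in> ?A")
          case True
          have "(\<Sum>w\<in>grid N. m w * \<xi> (z + w) \<omega>) \<le> (\<Sum>w\<in>grid N. m w * measure lborel ({x. V x \<omega> = 1} \<inter> unit_cell (z + w)))"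
            using elim(1) m0 by (intro sum_mono mult_left_mono) auto
          also have "\<dots> \<le> L ^ CARD('n) * pot z L \<omega> \<psi>" by (rule lower[OF elim(2)])
          also have "\<dots> \<le> L ^ CARD('n) * a" using True L' by (intro mult_left_mono) auto
          finally have "h * (\<Sum>w\<in>grid N. m w * \<xi> (z + w) \<omega>) \<le> h * (L ^ CARD('n) * a)" using h by (intro mult_left_mono) auto
          then show ?thesis using True unfolding Xval exp_add[symmetric] by simp
        qed (simp add: Xval)
      qed
    qed
    also have "\<dots> = exp (h * (L ^ CARD('n) * a)) * exp (- (\<Sum>w\<in>grid N. G (h * m w)))"
      using EX(2) unfolding X_def sumG by simp
    also have "\<dots> \<le> exp (L ^ CARD('n) * (h * a - Gamma_fun G h \<psi> + h * \<theta>))"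
      unfolding exp_add[symmetric] using Gsum by (simp add: algebra_simps)
    finally show "prob ?A \<le> exp (L ^ CARD('n) * (h * a - Gamma_fun G h \<psi> + h * \<theta>))" .
  qed
qed

lemma box_estimate_single:
  fixes \<psi> :: "real^'n \<Rightarrow> real^'n"
  assumes \<alpha>: "\<alpha> > 0" and \<beta>: "\<beta> > 0" and Ccal: "C_cal TYPE('n) G \<alpha> \<beta> = ereal C"
    and C: "C1c \<psi>" and supp: "{x. \<psi> x \<noteq> 0} \<subseteq> Q_hat r" and n: "l2sq \<psi> = 1" and r: "r > 0" and \<epsilon>: "\<epsilon> > 0"
  shows "\<exists>\<kappa>>0. \<exists>L0\<ge>1. \<forall>L\<ge>L0. \<forall>z. prob {\<omega> \<in> space M. pot z L \<omega> \<psi> \<le> (C - \<epsilon> - energy \<alpha> \<psi>) / \<beta>}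
    \<le> exp (- (L ^ CARD('n) * (real CARD('n) + \<kappa>)))"
proof -
  let ?d = "real CARD('n)"
  define a where "a = (C - \<epsilon> - energy \<alpha> \<psi>) / \<beta>"
  define \<delta> where "\<delta> = \<epsilon> / (2 * \<beta>)"
  have \<delta>: "\<delta> > 0" using \<epsilon> \<beta> by (simp add: \<delta>_def)
  have "\<exists>h>0. a + \<delta> < inverse h * (Gamma_fun G h \<psi> - ?d)"
  proof (rule ccontr)
    assume a: "\<not> (\<exists>h>0. a + \<delta> < inverse h * (Gamma_fun G h \<psi> - ?d))"
    have "G_cal G \<psi> ?d \<le> ereal (a + \<delta>)"
      unfolding G_cal_def
    proof (rule SUP_least)
      fix h :: real assume "h \<in> {0<..}"
      then have "\<not> a + \<delta> < inverse h * (Gamma_fun G h \<psi> - ?d)" using a by blast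
      then show "ereal (inverse h * (Gamma_fun G h \<psi> - ?d)) \<le> ereal (a + \<delta>)" by simp
    qed
    then have "ereal \<beta> * G_cal G \<psi> ?d \<le> ereal \<beta> * ereal (a + \<delta>)" using \<beta> by (intro ereal_mult_left_mono) auto
    then have le: "ereal (K_energy \<alpha> \<psi>) + ereal \<beta> * G_cal G \<psi> ?d \<le> ereal (K_energy \<alpha> \<psi>) + ereal \<beta> * ereal (a + \<delta>)"
      by (rule add_left_mono)
    have "L2_norm \<psi> = 1" using n by (simp add: L2_norm_def l2sq_def)
    then have "ereal C \<le> ereal (K_energy \<alpha> \<psi>) + ereal \<beta> * G_cal G \<psi> ?d"
      unfolding Ccal[symmetric] C_cal_def using C1c_H1(1)[OF C] by (intro INF_lower) auto
    with le have "C \<le> K_energy \<alpha> \<psi> + \<beta> * (a + \<delta>)"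
      by (metis ereal_less_eq(3) order_trans plus_ereal.simps(1) times_ereal.simps(1))
    also have "\<dots> = C - \<epsilon> / 2"
      unfolding K_energy_C1c[OF \<alpha> C] a_def \<delta>_def using \<beta> by (simp add: field_simps)
    finally show False using \<epsilon> by simp
  qed
  then obtain h where h: "h > 0" "a + \<delta> < inverse h * (Gamma_fun G h \<psi> - ?d)" by blast
  have "h * (a + \<delta>) < h * (inverse h * (Gamma_fun G h \<psi> - ?d))" using h by (intro mult_strict_left_mono)
  also have "h * (inverse h * (Gamma_fun G h \<psi> - ?d)) = Gamma_fun G h \<psi> - ?d" using h(1) by simp
  finally have hh: "h * (a + \<delta>) < Gamma_fun G h \<psi> - ?d" .
  obtain L0 where L0: "L0 \<ge> 1" "\<And>L z a. L \<ge> L0 \<Longrightarrow> prob {\<omega> \<in> space M. pot z L \<omega> \<psi> \<le> a}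
    \<le> exp (L ^ CARD('n) * (h * a - Gamma_fun G h \<psi> + h * (\<delta> / 2)))"
    using box_chernoff[OF C supp r h(1), of "\<delta> / 2"] \<delta> by auto
  show ?thesis
  proof (rule exI[of _ "h * \<delta> / 2"], intro conjI exI[of _ L0] allI impI)
    fix L z assume L: "L0 \<le> L"
    have "prob {\<omega> \<in> space M. pot z L \<omega> \<psi> \<le> a}
      \<le> exp (L ^ CARD('n) * (h * a - Gamma_fun G h \<psi> + h * (\<delta> / 2)))" by (rule L0(2)[OF L])
    also have "\<dots> \<le> exp (L ^ CARD('n) * (- (?d + h * \<delta> / 2)))"
      unfolding exp_le_cancel_iff
    proof (rule mult_left_mono)
      show "h * a - Gamma_fun G h \<psi> + h * (\<delta> / 2) \<le> - (?d + h * \<delta> / 2)"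
        using hh by (simp add: distrib_left)
    qed (use L L0(1) in auto)
    finally show "prob {\<omega> \<in> space M. pot z L \<omega> \<psi> \<le> (C - \<epsilon> - energy \<alpha> \<psi>) / \<beta>}
      \<le> exp (- (L ^ CARD('n) * (?d + h * \<delta> / 2)))" unfolding a_def mult_minus_right .
  qed (use h \<delta> L0 in auto)
qed

end

context iid_field
begin

lemma box_estimate:
  assumes \<alpha>: "\<alpha> > 0" and \<beta>: "\<beta> > 0" and Ccal: "C_cal TYPE('n) G \<alpha> \<beta> = ereal C" and r: "r > 0" and \<epsilon>: "\<epsilon> > 0"
  shows "\<exists>K \<kappa> L0. \<exists>B. 0 \<le> K \<and> 0 < \<kappa> \<and> 1 \<le> L0 \<and> (\<forall>L\<ge>L0. \<forall>z. B L z \<in> sets M \<and>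
    prob (B L z) \<le> K * exp (- (L ^ CARD('n) * (real CARD('n) + \<kappa>))) \<and>
    (\<forall>\<omega>\<in>space M. \<forall>\<psi>. C1c \<psi> \<longrightarrow> {x. \<psi> x \<noteq> 0} \<subseteq> Q_hat r \<longrightarrow> l2sq \<psi> = 1 \<longrightarrow>
      energy \<alpha> \<psi> + \<beta> * pot z L \<omega> \<psi> < C - \<epsilon> \<longrightarrow> \<omega> \<in> B L z))"
proof -
  let ?d = "real CARD('n)"
  define S where "S = {\<psi> :: real^'n \<Rightarrow> real^'n. C1c \<psi> \<and> {x. \<psi> x \<noteq> 0} \<subseteq> Q_hat r \<and> l2sq \<psi> = 1 \<and> energy \<alpha> \<psi> \<le> C}"
  define e where "e = min 1 (\<epsilon> / (2 * (1 + 3 * \<beta>)))"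
  have e: "0 < e" "e \<le> 1" "e * (1 + 3 * \<beta>) \<le> \<epsilon> / 2"
  proof -
    show "0 < e" "e \<le> 1" using \<epsilon> \<beta> by (auto simp: e_def)
    have "e \<le> \<epsilon> / (2 * (1 + 3 * \<beta>))" by (simp add: e_def)
    then show "e * (1 + 3 * \<beta>) \<le> \<epsilon> / 2" using \<beta> by (simp add: field_simps)
  qed
  have "\<exists>N\<subseteq>S. finite N \<and> (\<forall>\<psi>\<in>S. \<exists>\<psi>'\<in>N. near \<alpha> e \<psi> \<psi>')"
    by (rule rellich_net[OF \<alpha> e(1), where r=r and B="max 1 C"]) (auto simp: S_def)
  then obtain N where N: "N \<subseteq> S" "finite N"
    and net: "\<forall>\<psi>\<in>S. \<exists>\<psi>'\<in>N. near \<alpha> e \<psi> \<psi>'"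
    by (elim exE conjE)
  define ev where "ev \<psi> L z = {\<omega> \<in> space M. pot z L \<omega> \<psi> \<le> (C - \<epsilon> / 2 - energy \<alpha> \<psi>) / \<beta>}" for \<psi> L z
  have "\<exists>\<kappa>>0. \<exists>L0\<ge>1. \<forall>L\<ge>L0. \<forall>z. prob (ev \<psi> L z) \<le> exp (- (L ^ CARD('n) * (?d + \<kappa>)))" if "\<psi> \<in> N" for \<psi>
    unfolding ev_def
    by (rule box_estimate_single[OF \<alpha> \<beta> Ccal]) (use that N(1) r \<epsilon> in \<open>auto simp: S_def\<close>)
  then have "\<forall>\<psi>\<in>N. \<exists>\<kappa>. \<kappa> > 0 \<and> (\<exists>L0\<ge>1. \<forall>L\<ge>L0. \<forall>z. prob (ev \<psi> L z) \<le> exp (- (L ^ CARD('n) * (?d + \<kappa>))))" by blast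
  from bchoice[OF this] obtain \<kappa>f where \<kappa>f: "\<And>\<psi>. \<psi> \<in> N \<Longrightarrow> \<kappa>f \<psi> > 0"
    "\<forall>\<psi>\<in>N. \<exists>L0. L0 \<ge> 1 \<and> (\<forall>L\<ge>L0. \<forall>z. prob (ev \<psi> L z) \<le> exp (- (L ^ CARD('n) * (?d + \<kappa>f \<psi>))))" by blast
  from bchoice[OF \<kappa>f(2)] obtain Lf where Lf: "\<And>\<psi> L z. \<psi> \<in> N \<Longrightarrow> L \<ge> Lf \<psi> \<Longrightarrow> prob (ev \<psi> L z) \<le> exp (- (L ^ CARD('n) * (?d + \<kappa>f \<psi>)))"
    by blast
  define \<kappa> where "\<kappa> = Min (insert 1 (\<kappa>f ` N))"
  define L0 where "L0 = Max (insert 1 (Lf ` N))"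
  have \<kappa>: "\<kappa> > 0" "\<And>\<psi>. \<psi> \<in> N \<Longrightarrow> \<kappa> \<le> \<kappa>f \<psi>" using N(2) \<kappa>f(1) by (auto simp: \<kappa>_def)
  have L0: "L0 \<ge> 1" "\<And>\<psi>. \<psi> \<in> N \<Longrightarrow> Lf \<psi> \<le> L0" using N(2) by (auto simp: L0_def)
  have evs: "ev \<psi> L z \<in> sets M" if "\<psi> \<in> N" for \<psi> L z
  proof -
    have "C0c \<psi>" using that N(1) C1c_C0c by (auto simp: S_def)
    from wl2sq_measurable[OF this] have [measurable]: "(\<lambda>\<omega>. pot z L \<omega> \<psi>) \<in> borel_measurable M" .
    show ?thesis unfolding ev_def by measurable
  qed
  define B where "B L z = (\<Union>\<psi>\<in>N. ev \<psi> L z)" for L z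
  have "B L z \<in> sets M" "prob (B L z) \<le> real (card N) * exp (- (L ^ CARD('n) * (?d + \<kappa>)))" if L: "L \<ge> L0" for L z
  proof -
    show "B L z \<in> sets M" unfolding B_def using N(2) evs by (intro sets.finite_UN) auto
    have "prob (B L z) \<le> (\<Sum>\<psi>\<in>N. prob (ev \<psi> L z))" unfolding B_def by (rule measure_UNION_le[OF N(2) evs])
    also have "\<dots> \<le> (\<Sum>\<psi>\<in>N. exp (- (L ^ CARD('n) * (?d + \<kappa>))))"
    proof (rule sum_mono)
      fix \<psi> assume p: "\<psi> \<in> N"
      have "prob (ev \<psi> L z) \<le> exp (- (L ^ CARD('n) * (?d + \<kappa>f \<psi>)))" using Lf[OF p] L0(2)[OF p] L by force
      also have "\<dots> \<le> exp (- (L ^ CARD('n) * (?d + \<kappa>)))"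
        using \<kappa>(2)[OF p] L L0(1) by (auto intro!: mult_left_mono)
      finally show "prob (ev \<psi> L z) \<le> exp (- (L ^ CARD('n) * (?d + \<kappa>)))" .
    qed
    finally show "prob (B L z) \<le> real (card N) * exp (- (L ^ CARD('n) * (?d + \<kappa>)))" by simp
  qed
  moreover have "\<omega> \<in> B L z" if w: "\<omega> \<in> space M" and p: "C1c \<psi>" "{x. \<psi> x \<noteq> 0} \<subseteq> Q_hat r" "l2sq \<psi> = 1"
    and less: "energy \<alpha> \<psi> + \<beta> * pot z L \<omega> \<psi> < C - \<epsilon>" for \<omega> \<psi> L z
  proof -
    let ?W = "\<lambda>x. V (intvec z + L *\<^sub>R x) \<omega>"
    have W: "?W \<in> borel_measurable borel" "\<And>x. 0 \<le> ?W x \<and> ?W x \<le> 1"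
    proof -
      have [measurable]: "(\<lambda>x. V x \<omega>) \<in> borel_measurable borel" by (rule V_section[OF w])
      show "?W \<in> borel_measurable borel" by measurable
      show "\<And>x. 0 \<le> ?W x \<and> ?W x \<le> 1" by (rule V_bounds[OF w])
    qed
    have "0 \<le> wl2sq ?W \<psi>" unfolding wl2sq_def using W(2) by (intro integral_nonneg_AE AE_I2) simp
    then have "0 \<le> \<beta> * wl2sq ?W \<psi>" using \<beta> by simp
    then have "\<psi> \<in> S" using p less \<epsilon> by (simp add: S_def)
    then obtain \<psi>' where p': "\<psi>' \<in> N" "l2sq (\<lambda>x. \<psi> x - \<psi>' x) \<le> e\<^sup>2" "\<bar>energy \<alpha> \<psi> - energy \<alpha> \<psi>'\<bar> \<le> e"
      using net by blast
    have C': "C1c \<psi>'" using p'(1) N(1) by (auto simp: S_def)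
    have "\<bar>wl2sq ?W \<psi>' - wl2sq ?W \<psi>\<bar> \<le> e * (2 + l2sq \<psi>)"
      by (rule wl2sq_close[OF C0c_L2[OF C1c_C0c[OF C']] C0c_L2[OF C1c_C0c[OF p(1)]] e(1,2) _ W])
         (use p'(2) in \<open>simp add: l2sq_commute[of \<psi>']\<close>)
    then have "\<beta> * wl2sq ?W \<psi>' \<le> \<beta> * (wl2sq ?W \<psi> + e * 3)" using \<beta> p(3) by (intro mult_left_mono) auto
    then have "energy \<alpha> \<psi>' + \<beta> * wl2sq ?W \<psi>' \<le> C - \<epsilon> + e * (1 + 3 * \<beta>)"
      using less p'(3) by (simp add: algebra_simps)
    then have "\<beta> * wl2sq ?W \<psi>' \<le> C - \<epsilon> / 2 - energy \<alpha> \<psi>'" using e(3) by simp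
    then have "wl2sq ?W \<psi>' \<le> (C - \<epsilon> / 2 - energy \<alpha> \<psi>') / \<beta>" using \<beta> by (simp add: field_simps)
    then have "\<omega> \<in> ev \<psi>' L z" using w by (simp add: ev_def)
    then show ?thesis using p'(1) by (auto simp: B_def)
  qed
  ultimately show ?thesis using \<kappa>(1) L0(1)
    by - (rule exI[of _ "real (card N)"], rule exI[of _ \<kappa>], rule exI[of _ L0], rule exI[of _ B], auto)
qed

lemma lambda_eig_limit:
  assumes \<alpha>: "\<alpha> > 0" and \<beta>: "\<beta> > 0" and \<epsilon>: "\<epsilon> > 0"
  shows "((\<lambda>t. prob {\<omega> \<in> space M. lambda_eig (\<lambda>x. V x \<omega>) t \<alpha> \<beta> > C_cal TYPE('n) G \<alpha> \<beta> - ereal \<epsilon>}) \<longlongrightarrow> 1) at_top"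
proof -
  let ?d = "real CARD('n)"
  obtain C where Ccal: "C_cal TYPE('n) G \<alpha> \<beta> = ereal C" using C_cal_finite[OF \<alpha> \<beta>] by blast
  define \<delta> where "\<delta> = \<epsilon> / 4"
  have \<delta>: "\<delta> > 0" using \<epsilon> by (simp add: \<delta>_def)
  have i\<alpha>: "1 + inverse \<alpha> > 0" using \<alpha> by (simp add: add_pos_pos)
  obtain \<eta> :: "real^'n \<Rightarrow> real" and R where R: "R > 0" and \<eta>: "C1c \<eta>" "(LBINT x. (\<eta> x)\<^sup>2) = 1" "{x. \<eta> x \<noteq> 0} \<subseteq> Q_hat R"
    "(LBINT x. (\<Sum>j\<in>UNIV. (pd j \<eta> x)\<^sup>2)) \<le> \<delta> / (1 + inverse \<alpha>)"
    using cutoff_exists[of "\<delta> / (1 + inverse \<alpha>)", where 'n='n] \<delta> i\<alpha> by auto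
  have \<eta>4: "(1 + inverse \<alpha>) * (LBINT x. (\<Sum>j\<in>UNIV. (pd j \<eta> x)\<^sup>2)) \<le> \<delta>"
    using \<eta>(4) i\<alpha> by (simp add: pos_le_divide_eq mult.commute)
  obtain K \<kappa> L0 B where K: "0 \<le> K" "0 < \<kappa>" "1 \<le> L0"
    and B: "\<And>L z. L \<ge> L0 \<Longrightarrow> B L z \<in> sets M"
    and PB: "\<And>L z. L \<ge> L0 \<Longrightarrow> prob (B L z) \<le> K * exp (- (L ^ CARD('n) * (?d + \<kappa>)))"
    and bad: "\<And>L z \<omega> \<psi>. L \<ge> L0 \<Longrightarrow> \<omega> \<in> space M \<Longrightarrow> C1c \<psi> \<Longrightarrow> {x. \<psi> x \<noteq> 0} \<subseteq> Q_hat (R + 1) \<Longrightarrow> l2sq \<psi> = 1 \<Longrightarrow>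
      energy \<alpha> \<psi> + \<beta> * pot z L \<omega> \<psi> < C - 2 * \<delta> \<Longrightarrow> \<omega> \<in> B L z"
  proof -
    have R1: "R + 1 > 0" and d2: "2 * \<delta> > 0" using R \<delta> by auto
    from box_estimate[OF \<alpha> \<beta> Ccal R1 d2] show ?thesis using that by blast
  qed
  define L where "L t = ln t powr (1 / ?d)" for t :: real
  define E where "E t = {\<omega> \<in> space M. lambda_eig (\<lambda>x. V x \<omega>) t \<alpha> \<beta> > C_cal TYPE('n) G \<alpha> \<beta> - ereal \<epsilon>}" for t
  have d1: "?d \<ge> 1" by (simp add: Suc_leI)
  have main: "1 - 5 ^ CARD('n) * K * t powr (- \<kappa>) \<le> prob (E t)"
    if t: "t > 1" "ln t \<ge> 1" "L t \<ge> L0" "ln t * R \<le> t" for t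
  proof -
    have lnpos: "ln t > 0" using t by simp
    have Ld: "L t ^ CARD('n) = ln t"
      using lnpos by (simp add: L_def powr_realpow[symmetric] powr_powr)
    have L2: "(L t)\<^sup>2 = ln t powr (2 / ?d)"
      using lnpos by (simp add: L_def powr_realpow[symmetric] powr_powr)
    have L2': "ln t powr (- 2 / ?d) = inverse ((L t)\<^sup>2)"
      unfolding L2 by (simp add: powr_minus[symmetric])
    have L1: "L t \<ge> 1" using t(3) K(3) by simp
    have Lln: "L t \<le> ln t"
    proof -
      have "ln t powr (1 / ?d) \<le> ln t powr 1" using t(2) d1 by (intro powr_mono) auto
      then show ?thesis using lnpos by (simp add: L_def)
    qed
    have L2pos: "(L t)\<^sup>2 > 0" using L1 by simp
    define m where "m = nat \<lceil>t\<rceil>"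
    have m: "t \<le> real m" "real m \<le> t + 1" using t(1) by (auto simp: m_def)
    have mb: "t / 2 + L t * R / 2 \<le> real m"
    proof -
      have "L t * R \<le> ln t * R" using Lln R by (intro mult_right_mono) auto
      then show ?thesis using t(4) m(1) by linarith
    qed
    let ?c = "(C - \<epsilon>) * inverse ((L t)\<^sup>2)"
    let ?A = "{\<omega> \<in> space M. C_frak (\<lambda>x. V x \<omega>) \<alpha> \<beta> t \<le> ereal ?c}"
    have A: "?A \<in> sets M" by (rule C_frak_le_sets[OF \<alpha> less_imp_le[OF \<beta>]])
    have iff: "lambda_eig W t \<alpha> \<beta> > C_cal TYPE('n) G \<alpha> \<beta> - ereal \<epsilon> \<longleftrightarrow> \<not> C_frak W \<alpha> \<beta> t \<le> ereal ?c" for W :: "real^'n \<Rightarrow> real"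
    proof (cases "C_frak W \<alpha> \<beta> t")
      case (real x)
      have "C - \<epsilon> < (L t)\<^sup>2 * x \<longleftrightarrow> ?c < x" using L2pos by (simp add: field_simps)
      then show ?thesis unfolding lambda_eig_def Ccal L2[symmetric] real by (simp add: not_le)
    next
      case PInf
      then show ?thesis unfolding lambda_eig_def Ccal L2[symmetric] using L2pos by simp
    next
      case MInf
      then show ?thesis unfolding lambda_eig_def Ccal L2[symmetric] using L2pos by simp
    qed
    have Eeq: "E t = space M - ?A" unfolding E_def iff by blast
    have sub: "?A \<subseteq> (\<Union>z\<in>grid m. B (L t) z)"
    proof
      fix \<omega> assume "\<omega> \<in> ?A"
      then have w: "\<omega> \<in> space M" and le: "C_frak (\<lambda>x. V x \<omega>) \<alpha> \<beta> t \<le> ereal ?c" by auto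
      have "?c < (C - \<epsilon> + \<delta>) * inverse ((L t)\<^sup>2)" using L2pos \<delta> by (intro mult_strict_right_mono) auto
      then have "C_frak (\<lambda>x. V x \<omega>) \<alpha> \<beta> t < ereal ((C - \<epsilon> + \<delta>) * inverse ((L t)\<^sup>2))"
        using le by (simp add: order_le_less_trans)
      then obtain \<phi> where \<phi>: "\<phi> \<in> test_functions (Q_hat t)"
        and less: "energy \<alpha> \<phi> + ln t powr (- 2 / ?d) * \<beta> * wl2sq (\<lambda>x. V x \<omega>) \<phi> < (C - \<epsilon> + \<delta>) * inverse ((L t)\<^sup>2) * l2sq \<phi>"
        unfolding C_frak_less_iff[OF \<alpha> V_section[OF w] V_bounds[OF w]] by blast
      have less': "energy \<alpha> \<phi> + inverse ((L t)\<^sup>2) * \<beta> * wl2sq (\<lambda>x. V x \<omega>) \<phi> < inverse ((L t)\<^sup>2) * (C - \<epsilon> + \<delta>) * l2sq \<phi>"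
        using less unfolding L2' by (simp add: mult.commute mult.left_commute)
      obtain z \<psi> where z: "z \<in> grid m" and p: "C1c \<psi>" "{x. \<psi> x \<noteq> 0} \<subseteq> Q_hat (R + 1)" "l2sq \<psi> = 1"
        "energy \<alpha> \<psi> + \<beta> * pot z (L t) \<omega> \<psi> < C - \<epsilon> + \<delta> + \<delta>"
        using box_localization[OF \<alpha> \<beta> L1 \<eta>(1-3) \<eta>4 V_section[OF w] V_bounds[OF w] test_functions_C1c[OF \<phi>]
            Q_hat_test_functions[OF \<phi>] less' mb] by blast
      have "C - \<epsilon> + \<delta> + \<delta> = C - 2 * \<delta>" by (simp add: \<delta>_def)
      then have "\<omega> \<in> B (L t) z" using bad[OF t(3) w p(1-3)] p(4) by simp
      then show "\<omega> \<in> (\<Union>z\<in>grid m. B (L t) z)" using z by blast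
    qed
    have "prob ?A \<le> prob (\<Union>z\<in>grid m. B (L t) z)"
      by (rule finite_measure_mono[OF sub]) (intro sets.finite_UN finite_grid B t(3))
    also have "\<dots> \<le> (\<Sum>z\<in>grid m. prob (B (L t) z))"
      by (rule measure_UNION_le[OF finite_grid B[OF t(3)]])
    also have "\<dots> \<le> (\<Sum>z\<in>(grid m :: (int^'n) set). K * exp (- (ln t * (?d + \<kappa>))))"
      using PB[OF t(3)] unfolding Ld by (intro sum_mono)
    also have "\<dots> = (2 * real m + 1) ^ CARD('n) * (K * exp (- (ln t * (?d + \<kappa>))))"
      by (simp add: card_grid add.commute)
    also have "\<dots> \<le> (5 * t) ^ CARD('n) * (K * exp (- (ln t * (?d + \<kappa>))))"
      using m(2) t(1) K(1) by (intro mult_right_mono power_mono) auto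
    also have "exp (- (ln t * (?d + \<kappa>))) = t powr (- ?d) * t powr (- \<kappa>)"
      using t(1) by (simp add: powr_def exp_add[symmetric] algebra_simps)
    also have "(5 * t) ^ CARD('n) * (K * (t powr (- ?d) * t powr (- \<kappa>))) = 5 ^ CARD('n) * K * t powr (- \<kappa>)"
      using t(1) by (simp add: power_mult_distrib powr_minus powr_realpow)
    finally have "prob ?A \<le> 5 ^ CARD('n) * K * t powr (- \<kappa>)" .
    then show ?thesis unfolding Eeq prob_compl[OF A] by simp
  qed
  have lim: "((\<lambda>t. 1 - 5 ^ CARD('n) * K * t powr (- \<kappa>)) \<longlongrightarrow> 1) at_top"
  proof -
    have "((\<lambda>t. t powr (- \<kappa>)) \<longlongrightarrow> 0) at_top"
      using K(2) by (intro tendsto_neg_powr filterlim_ident) auto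
    then have "((\<lambda>t. 1 - 5 ^ CARD('n) * K * t powr (- \<kappa>)) \<longlongrightarrow> 1 - 5 ^ CARD('n) * K * 0) at_top"
      by (intro tendsto_intros)
    then show ?thesis by simp
  qed
  have Linf: "\<forall>\<^sub>F t in at_top. L t \<ge> L0"
  proof -
    have p: "1 / ?d > 0" by simp
    have "filterlim (\<lambda>t::real. ln t powr (1 / ?d)) at_top at_top" using p by real_asymp
    then show ?thesis unfolding L_def filterlim_at_top by blast
  qed
  have ev: "\<forall>\<^sub>F t in at_top. 1 - 5 ^ CARD('n) * K * t powr (- \<kappa>) \<le> prob (E t)"
  proof -
    have 1: "\<forall>\<^sub>F t::real in at_top. t > 1" by (rule eventually_gt_at_top)
    have 2: "\<forall>\<^sub>F t::real in at_top. ln t \<ge> 1" by real_asymp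
    have 3: "\<forall>\<^sub>F t::real in at_top. ln t * R \<le> t" using R by real_asymp
    show ?thesis using 1 2 3 Linf by eventually_elim (rule main)
  qed
  have "((\<lambda>t. prob (E t)) \<longlongrightarrow> 1) at_top"
    by (rule tendsto_sandwich[OF ev _ lim tendsto_const]) (simp add: prob_le_1)
  then show ?thesis unfolding E_def .
qed

end

theorem theorem1p2:
  fixes M :: "'w measure"
    and V :: "real^'n \<Rightarrow> 'w \<Rightarrow> real"
    and \<xi> :: "int^'n \<Rightarrow> 'w \<Rightarrow> real"
    and \<alpha> \<beta> p \<mu> :: real
  assumes dim: "CARD('n) \<ge> 2"
    and prob: "prob_space M"
    and V_meas: "(\<lambda>(x, \<omega>). V x \<omega>) \<in> borel_measurable (borel \<Otimes>\<^sub>M M)"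
    and V_01: "\<And>x \<omega>. \<omega> \<in> space M \<Longrightarrow> V x \<omega> \<in> {0, 1}"
    and S_closed: "\<And>\<omega>. \<omega> \<in> space M \<Longrightarrow> closed {x. V x \<omega> = 1}"
    and \<alpha>: "\<alpha> > 0" and \<beta>: "\<beta> > 0"
    and indep: "prob_space.indep_vars M (\<lambda>_. borel) \<xi> UNIV"
    and ident: "\<And>z. distr M borel (\<xi> z) = distr M borel (\<xi> 0)"
    and \<xi>_range: "\<And>z. AE \<omega> in M. 0 \<le> \<xi> z \<omega> \<and> \<xi> z \<omega> \<le> 1"
    and \<xi>_le: "\<And>z. AE \<omega> in M. measure lborel ({x. V x \<omega> = 1} \<inter> unit_cell z) \<ge> \<xi> z \<omega>"
    and p: "0 < p" "p < 1"
    and \<xi>_zero: "\<And>z. measure M {\<omega> \<in> space M. \<xi> z \<omega> = 0} \<le> p"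
    and \<mu>: "\<And>z. \<mu> = prob_space.expectation M (\<xi> z)" "\<mu> > 0"
  shows "\<forall>\<epsilon>::real. \<epsilon> > 0 \<longrightarrow>
    ((\<lambda>t::real. measure M {\<omega> \<in> space M.
        lambda_eig (\<lambda>x. V x \<omega>) t \<alpha> \<beta> > C_cal TYPE('n) (G_fun M (\<xi> 0)) \<alpha> \<beta> - ereal \<epsilon>})
      \<longlongrightarrow> 1) at_top"
proof -
  interpret prob_space M by (rule prob)
  interpret iid_field M V \<xi>
    by unfold_locales (fact V_meas V_01 indep ident \<xi>_range \<xi>_le)+
  show ?thesis using lambda_eig_limit[OF \<alpha> \<beta>] by blast
qed

end
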